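(* Let $p$ be a rational prime with $p\nmid6$ and let $c\in\overline{\mathbb{Z}_p}$ with $v_p(c)=0$. Write $F_{4,c}:=\frac{E_4}{j-c}=\sum_{n\ge1}a_n(F_{4,c})q^n$. Then for all $l\in\mathbb{Z}^+$, \[ a_{p^l}(F_{4,c})\equiv\big(c(c-1728)\big)^{\frac{p^l-1}{2}}\cdot\sum_{m=0}^{p^l-1}\frac{(6m)!}{(m!)^3(3m)!}\,c^{-m}\pmod p. \]
   Context: $q=e^{2\pi i z}$; $E_4$ is the normalized weight-$4$ Eisenstein series and $j=q^{-1}+744+\cdots$. The $q$-expansion of $E_4/(j-c)$ is the formal expansion $\sum_{m\ge0}c^mE_4j^{-m-1}$ in powers of $q$ (using $j^{-1}=q+O(q^2)$), whose $n$-th coefficient is an integer polynomial in $c$, so lies in $\overline{\mathbb{Z}_p}$; congruences are in $\overline{\mathbb{Z}_p}$. *)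

theory Defs
  imports
    "HOL-Analysis.Analysis"
    "HOL-Algebra.Algebraic_Closure_Type"
    "Berlekamp_Zassenhaus.Finite_Field"
begin

section \<open>The ring of p-adic integers\<close>

text \<open>
  The prime is carried by a type parameter \<open>'p\<close> of class \<open>prime_card\<close>, that is, \<open>p = CARD('p)\<close>.
  A p-adic integer is a compatible system of residues modulo the powers of p (the projective
  limit of the rings of integers modulo \<open>p ^ n\<close>), each residue being represented in
  \<open>{0..<p ^ n}\<close>.
\<close>

typedef ('p::prime_card) padic_int =
  "{x :: nat \<Rightarrow> int. \<forall>n. x n \<in> {0..<int CARD('p) ^ n} \<and> x (Suc n) mod int CARD('p) ^ n = x n}"
  morphisms padic_residue Abs_padic_int
  by (rule exI[of _ "\<lambda>_. 0"]) (auto simp: prime_gt_0_nat[OF prime_card])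

setup_lifting type_definition_padic_int

lemma padic_pow_pos [simp]: "(0::int) < int CARD('p::prime_card) ^ n"
  by (simp add: prime_gt_0_nat[OF prime_card])

lemma padic_mod_mod [simp]:
  "(a mod int CARD('p::prime_card) ^ Suc n) mod int CARD('p) ^ n = a mod int CARD('p) ^ n"
  by (rule mod_mod_cancel) simp

lemma padic_residue_mod_Suc:
  "padic_residue x (Suc n) mod int CARD('p::prime_card) ^ n = padic_residue (x :: 'p padic_int) n"
  using padic_residue[of x] by auto

lemma padic_residue_range:
  "0 \<le> padic_residue (x :: 'p::prime_card padic_int) n"
  "padic_residue (x :: 'p::prime_card padic_int) n < int CARD('p) ^ n"
  using padic_residue[of x] by auto

lemma padic_residue_mod_self [simp]:
  "padic_residue (x :: 'p::prime_card padic_int) n mod int CARD('p) ^ n = padic_residue x n"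
  using padic_residue_range[of x n] by simp

lemma padic_compatible:
  assumes "f (Suc n) mod int CARD('p::prime_card) ^ n = f n mod int CARD('p) ^ n"
  shows "f n mod int CARD('p) ^ n \<in> {0..<int CARD('p) ^ n} \<and>
         f (Suc n) mod int CARD('p) ^ Suc n mod int CARD('p) ^ n = f n mod int CARD('p) ^ n"
  using assms padic_mod_mod[where 'p='p] by (auto simp del: power_Suc)

lemma padic_int_eqI:
  "(\<And>n. padic_residue x n = padic_residue y n) \<Longrightarrow> x = y"
  by (metis ext padic_residue_inject)

instantiation padic_int :: (prime_card) comm_ring_1
begin

lift_definition zero_padic_int :: "'a padic_int" is "\<lambda>_. 0" by simp
lift_definition one_padic_int :: "'a padic_int" is "\<lambda>n. 1 mod int CARD('a) ^ n"
  by (rule padic_compatible) simp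
lift_definition plus_padic_int :: "'a padic_int \<Rightarrow> 'a padic_int \<Rightarrow> 'a padic_int"
  is "\<lambda>x y n. (x n + y n) mod int CARD('a) ^ n"
  by (rule padic_compatible) (metis mod_add_eq mod_mod_trivial)
lift_definition times_padic_int :: "'a padic_int \<Rightarrow> 'a padic_int \<Rightarrow> 'a padic_int"
  is "\<lambda>x y n. (x n * y n) mod int CARD('a) ^ n"
  by (rule padic_compatible) (metis mod_mult_eq mod_mod_trivial)
lift_definition minus_padic_int :: "'a padic_int \<Rightarrow> 'a padic_int \<Rightarrow> 'a padic_int"
  is "\<lambda>x y n. (x n - y n) mod int CARD('a) ^ n"
  by (rule padic_compatible) (metis mod_diff_eq mod_mod_trivial)
lift_definition uminus_padic_int :: "'a padic_int \<Rightarrow> 'a padic_int"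
  is "\<lambda>x n. (- x n) mod int CARD('a) ^ n"
  by (rule padic_compatible) (metis mod_minus_eq mod_mod_trivial)

instance
proof
  fix a b c :: "'a padic_int"
  have mod_self: "x n mod int CARD('a) ^ n = x n"
    if "\<forall>n. (0 \<le> x n \<and> x n < int CARD('a) ^ n) \<and> x (Suc n) mod int CARD('a) ^ n = x n"
    for x :: "nat \<Rightarrow> int" and n using that by simp
  show "a + b + c = a + (b + c)"
    by transfer (auto simp: mod_simps add.assoc)
  show "a + b = b + a"
    by transfer (auto simp: add.commute)
  show "0 + a = a"
    by transfer (auto simp: mod_self)
  show "- a + a = 0"
    by transfer (auto simp: mod_simps)
  show "a - b = a + - b"
    by transfer (auto simp: mod_simps)
  show "a * b * c = a * (b * c)"
    by transfer (auto simp: mod_simps mult.assoc)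
  show "a * b = b * a"
    by transfer (auto simp: mult.commute)
  show "1 * a = a"
    by transfer (auto simp: mod_simps mod_self)
  show "(a + b) * c = a * c + b * c"
    by transfer (auto simp: mod_simps distrib_right)
  show "(0 :: 'a padic_int) \<noteq> 1"
  proof
    assume "(0 :: 'a padic_int) = 1"
    hence "padic_residue (0 :: 'a padic_int) 1 = padic_residue (1 :: 'a padic_int) 1" by simp
    moreover have "CARD('a) > 1" using prime_card prime_gt_1_nat by blast
    ultimately show False by (simp add: zero_padic_int.rep_eq one_padic_int.rep_eq)
  qed
qed

end

lemma padic_residue_of_nat:
  "padic_residue (of_nat k :: 'p::prime_card padic_int) n = int k mod int CARD('p) ^ n"
  by (induction k)
     (auto simp: zero_padic_int.rep_eq one_padic_int.rep_eq plus_padic_int.rep_eq mod_simps)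

lemma padic_residue_cong:
  assumes "m \<le> n"
  shows "padic_residue (x :: 'p::prime_card padic_int) n mod int CARD('p) ^ m = padic_residue x m"
  using assms
proof (induction n rule: dec_induct)
  case (step n)
  have "padic_residue x (Suc n) mod int CARD('p) ^ m =
      (padic_residue x (Suc n) mod int CARD('p) ^ n) mod int CARD('p) ^ m"
    using step.hyps by (simp add: mod_mod_cancel le_imp_power_dvd)
  thus ?case using step.IH by (simp add: padic_residue_mod_Suc)
qed simp

lemma padic_int_nonzero_residue:
  assumes "x \<noteq> (0 :: 'p::prime_card padic_int)"
  obtains n where "padic_residue x n \<noteq> 0"
  using assms padic_int_eqI[of x 0] by (auto simp: zero_padic_int.rep_eq)

instance padic_int :: (prime_card) idom
proof
  fix x y :: "'a padic_int"
  assume "x \<noteq> 0" "y \<noteq> 0"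
  then obtain n m where nm: "padic_residue x n \<noteq> 0" "padic_residue y m \<noteq> 0"
    using padic_int_nonzero_residue by metis
  let ?p = "int CARD('a)" and ?X = "padic_residue x (n + m)" and ?Y = "padic_residue y (n + m)"
  have X: "\<not> ?p ^ n dvd ?X" and Y: "\<not> ?p ^ m dvd ?Y"
    using nm padic_residue_cong[of n "n + m" x] padic_residue_cong[of m "n + m" y]
    by (auto simp: dvd_eq_mod_eq_0)
  have p: "prime_elem ?p" using prime_card_int[where 'a='a] by blast
  have "\<not> ?p ^ (n + m) dvd ?X * ?Y"
  proof
    assume d: "?p ^ (n + m) dvd ?X * ?Y"
    have "X0 \<noteq> 0 \<Longrightarrow> \<not> ?p ^ k dvd X0 \<Longrightarrow> multiplicity ?p X0 < k" for X0 k
      using p by (meson multiplicity_dvd' not_le)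
    moreover have "?X \<noteq> 0" "?Y \<noteq> 0" using X Y by auto
    ultimately have "multiplicity ?p ?X < n" "multiplicity ?p ?Y < m" using X Y by auto
    moreover have "multiplicity ?p (?X * ?Y) \<ge> n + m"
      using d p \<open>?X \<noteq> 0\<close> \<open>?Y \<noteq> 0\<close>
      by (intro multiplicity_geI) (auto simp: prime_elem_def)
    moreover have "multiplicity ?p (?X * ?Y) = multiplicity ?p ?X + multiplicity ?p ?Y"
      using p \<open>?X \<noteq> 0\<close> \<open>?Y \<noteq> 0\<close> by (rule prime_elem_multiplicity_mult_distrib)
    ultimately show False by simp
  qed
  hence "padic_residue (x * y) (n + m) \<noteq> 0"
    by (simp add: times_padic_int.rep_eq dvd_eq_mod_eq_0)
  thus "x * y \<noteq> 0" by (auto simp: zero_padic_int.rep_eq)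
qed

instance padic_int :: (prime_card) ring_char_0
proof
  show "inj (of_nat :: nat \<Rightarrow> 'a padic_int)"
  proof (rule injI)
    fix a b :: nat
    assume eq: "(of_nat a :: 'a padic_int) = of_nat b"
    have "CARD('a) > 1" using prime_card prime_gt_1_nat by blast
    hence lt: "a + b < CARD('a) ^ (a + b)" using power_gt_expt by simp
    have "int a mod int CARD('a) ^ (a + b) = int b mod int CARD('a) ^ (a + b)"
      using eq padic_residue_of_nat[where 'p='a] by metis
    hence "a mod CARD('a) ^ (a + b) = b mod CARD('a) ^ (a + b)"
      by (metis of_nat_eq_iff of_nat_mod of_nat_power)
    thus "a = b" using lt by simp
  qed
qed

instance fract :: ("{idom, ring_char_0}") field_char_0
proof
  show "inj (of_nat :: nat \<Rightarrow> 'a fract)"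
    by (rule injI) (simp add: of_nat_fract eq_fract)
qed


section \<open>The algebraic closure of the p-adic numbers\<close>

type_synonym 'p padic = "'p padic_int fract"
type_synonym 'p padic_ac = "'p padic alg_closure"

text \<open>The valuation on the p-adic numbers, normalised by \<open>v(p) = 1\<close> and \<open>v(0) = \<infinity>\<close>.\<close>

definition padic_val :: "'p::prime_card padic \<Rightarrow> ereal" where
  "padic_val x =
     (if x = 0 then \<infinity>
      else ereal (of_int (THE k. \<exists>u w. \<not> of_nat CARD('p) dvd u \<and> \<not> of_nat CARD('p) dvd w \<and>
             x = of_nat CARD('p) powi k * Fract u w)))"

definition ac_min_poly :: "'a::field alg_closure \<Rightarrow> 'a poly" where
  "ac_min_poly x = (THE P. Polynomial.lead_coeff P = 1 \<and> Factorial_Ring.irreducible P \<and> poly (map_poly to_ac P) x = 0)"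

text \<open>
  The unique extension of the valuation to the algebraic closure. The norm of \<open>x\<close> from the
  field generated by \<open>x\<close>, which has degree \<open>n\<close>, is up to sign the constant coefficient of
  the minimal polynomial of \<open>x\<close>, and \<open>v(x) = v(norm of x) / n\<close>.
\<close>

definition padic_ac_val :: "'p::prime_card padic_ac \<Rightarrow> ereal" where
  "padic_ac_val x = padic_val (Polynomial.coeff (ac_min_poly x) 0) / ereal (real (Polynomial.degree (ac_min_poly x)))"

text \<open>The integral closure of the p-adic integers in the algebraic closure.\<close>

definition padic_ac_int :: "'p::prime_card padic_ac set" where
  "padic_ac_int =
     {x. \<exists>P :: 'p padic_int poly. Polynomial.lead_coeff P = 1 \<and>
           poly (map_poly (\<lambda>a. to_ac (Fract a 1)) P) x = 0}"

definition padic_ac_cong ::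
    "'p::prime_card padic_ac \<Rightarrow> 'p padic_ac \<Rightarrow> 'p padic_ac \<Rightarrow> bool" where
  "padic_ac_cong m x y \<longleftrightarrow>
     x \<in> padic_ac_int \<and> y \<in> padic_ac_int \<and> (\<exists>z\<in>padic_ac_int. x - y = m * z)"


section \<open>Formal q-expansions\<close>

definition eisenstein_E4 :: "'a::field_char_0 fps" where
  "eisenstein_E4 = Abs_fps (\<lambda>n. if n = 0 then 1 else 240 * of_nat (\<Sum>d | d dvd n. d ^ 3))"

definition eisenstein_E6 :: "'a::field_char_0 fps" where
  "eisenstein_E6 = Abs_fps (\<lambda>n. if n = 0 then 1 else - 504 * of_nat (\<Sum>d | d dvd n. d ^ 5))"

definition modular_discriminant :: "'a::field_char_0 fps" where
  "modular_discriminant = fps_const (1 / 1728) * (eisenstein_E4 ^ 3 - eisenstein_E6 ^ 2)"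

definition modular_j :: "'a::field_char_0 fls" where
  "modular_j = fps_to_fls eisenstein_E4 ^ 3 / fps_to_fls modular_discriminant"

text \<open>
  The formal expansion of \<open>E4 / (j - c)\<close> in powers of \<open>q\<close>; the series converges in the
  \<open>q\<close>-adic topology because \<open>1 / j\<close> has no constant term.
\<close>

definition F4 :: "'a::field_char_0 \<Rightarrow> 'a fls" where
  "F4 c = (\<Sum>m. fls_const (c ^ m) * fps_to_fls eisenstein_E4 * inverse modular_j ^ (m + 1))"


section \<open>Well-definedness of the valuation and of the expansion\<close>


lemma padic_p_dvd_iff:
  "of_nat CARD('p) dvd (x :: 'p::prime_card padic_int) \<longleftrightarrow> padic_residue x 1 = 0"
proof
  assume "of_nat CARD('p) dvd x"
  then obtain y where "x = of_nat CARD('p) * y" by blast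
  thus "padic_residue x 1 = 0"
    by (simp add: times_padic_int.rep_eq padic_residue_of_nat mod_simps)
next
  assume x1: "padic_residue x 1 = 0"
  let ?p = "int CARD('p)"
  define f where "f = (\<lambda>n. padic_residue x (Suc n) div ?p)"
  have pf: "?p * f n = padic_residue x (Suc n)" for n
    using padic_residue_cong[of 1 "Suc n" x] x1 unfolding f_def by auto
  have p0: "?p > 0" by (simp add: prime_gt_0_nat[OF prime_card])
  have "f n \<in> {0..<?p ^ n} \<and> f (Suc n) mod ?p ^ n = f n" for n
  proof -
    have r: "?p * 0 \<le> ?p * f n" "?p * f n < ?p * ?p ^ n"
      using padic_residue_range[of x "Suc n"] pf[of n] by auto
    have "?p * (f (Suc n) mod ?p ^ n) = (?p * f (Suc n)) mod ?p ^ Suc n"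
      by (simp only: mult_mod_right power_Suc)
    also have "\<dots> = ?p * f n"
      unfolding pf by (rule padic_residue_mod_Suc)
    finally show ?thesis using r p0 by (simp only: mult_cancel_left mult_le_cancel_left_pos mult_less_cancel_left_pos) auto
  qed
  hence "padic_residue (Abs_padic_int f :: 'p padic_int) = f"
    by (intro Abs_padic_int_inverse) auto
  hence "x = of_nat CARD('p) * Abs_padic_int f"
    by (intro padic_int_eqI)
       (simp add: times_padic_int.rep_eq padic_residue_of_nat mod_simps pf padic_residue_mod_Suc)
  thus "of_nat CARD('p) dvd x" by simp
qed

lemma padic_p_dvd_mult_iff:
  "of_nat CARD('p) dvd (x * y :: 'p::prime_card padic_int) \<longleftrightarrow>
   of_nat CARD('p) dvd x \<or> of_nat CARD('p) dvd y"
proof -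
  have "Factorial_Ring.prime (int CARD('p))" by (rule prime_card_int)
  thus ?thesis
    unfolding padic_p_dvd_iff
    by (simp add: times_padic_int.rep_eq prime_dvd_mult_iff flip: dvd_eq_mod_eq_0)
       (metis One_nat_def dvd_eq_mod_eq_0 padic_residue_mod_self power_one_right)
qed

lemma padic_Fract_power:
  "Fract (of_nat CARD('p) ^ n) 1 = (of_nat CARD('p) :: 'p::prime_card padic) ^ n"
proof (induction n)
  case (Suc n)
  have "Fract (of_nat CARD('p) ^ Suc n) 1 =
      (Fract (of_nat CARD('p)) 1 :: 'p padic) * Fract (of_nat CARD('p) ^ n) 1"
    by simp
  thus ?case by (simp only: Suc.IH of_nat_fract power_Suc)
qed (simp add: One_fract_def)

lemma padic_val_eqI:
  assumes "\<not> of_nat CARD('p) dvd u" "\<not> of_nat CARD('p) dvd w"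
  shows "padic_val (of_nat CARD('p) powi k * Fract u w :: 'p::prime_card padic) = ereal (of_int k)"
proof -
  let ?p = "of_nat CARD('p) :: 'p padic_int" and ?P = "of_nat CARD('p) :: 'p padic"
  have card0: "CARD('p) \<noteq> 0" using prime_card[where 'a='p] by auto
  have P0: "?P \<noteq> 0" using card0 by simp
  have nz: "u \<noteq> 0" "w \<noteq> 0" using assms by auto
  have aux: False if "k < k'" and v: "\<not> ?p dvd v" "\<not> ?p dvd z" "\<not> ?p dvd u" "\<not> ?p dvd w"
    and eq: "?P powi k * Fract u w = ?P powi k' * Fract v z" for k k' :: int and u v w z
  proof -
    have nz: "u \<noteq> 0" "w \<noteq> 0" "v \<noteq> 0" "z \<noteq> 0" using v by auto
    define n where "n = nat (k' - k - 1)"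
    have n: "k' = k + int (Suc n)" using \<open>k < k'\<close> by (simp add: n_def)
    have "?P powi k' = ?P powi k * ?P powi int (Suc n)" unfolding n using P0 by (intro power_int_add) simp
    hence pk: "?P powi k' = ?P powi k * ?P ^ Suc n" by (simp only: power_int_of_nat)
    have "?P powi k \<noteq> 0" using P0 by (simp add: power_int_eq_0_iff)
    have "Fract u w = ?P ^ Suc n * Fract v z"
      using eq unfolding pk mult.assoc by (simp only: mult_left_cancel[OF \<open>?P powi k \<noteq> 0\<close>])
    also have "?P ^ Suc n = Fract (?p ^ Suc n) 1"
      by (rule padic_Fract_power [symmetric])
    finally have "u * z = ?p ^ Suc n * v * w"
      using nz by (simp add: eq_fract)
    hence "?p dvd u * z" by simp
    thus False using v by (simp add: padic_p_dvd_mult_iff)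
  qed
  have "(THE k'. \<exists>u' w'. \<not> ?p dvd u' \<and> \<not> ?p dvd w' \<and>
           ?P powi k * Fract u w = ?P powi k' * Fract u' w') = k"
  proof (rule the_equality)
    fix k' assume "\<exists>u' w'. \<not> ?p dvd u' \<and> \<not> ?p dvd w' \<and>
           ?P powi k * Fract u w = ?P powi k' * Fract u' w'"
    then obtain u' w' where "\<not> ?p dvd u'" "\<not> ?p dvd w'"
      "?P powi k * Fract u w = ?P powi k' * Fract u' w'" by blast
    thus "k' = k" using aux[of k k' u' w' u w] aux[of k' k u w u' w'] assms
      by (metis linorder_neqE)
  qed (use assms in blast)
  moreover have "?P powi k * Fract u w \<noteq> 0"
  proof -
    have "Fract u w \<noteq> 0" using nz by (simp add: Zero_fract_def eq_fract)
    thus ?thesis using P0 by (simp add: power_int_eq_0_iff)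
  qed
  ultimately show ?thesis by (simp add: padic_val_def)
qed

lemma padic_int_decompose:
  assumes "x \<noteq> (0 :: 'p::prime_card padic_int)"
  obtains n u where "\<not> of_nat CARD('p) dvd u" "x = of_nat CARD('p) ^ n * u"
proof -
  let ?p = "of_nat CARD('p) :: 'p padic_int"
  obtain m where m: "padic_residue x m \<noteq> 0" using padic_int_nonzero_residue[OF assms] .
  have bound: "\<not> ?p ^ k dvd x" if "k \<ge> m" for k
  proof
    assume "?p ^ k dvd x"
    hence "?p ^ m dvd x" using that le_imp_power_dvd dvd_trans by blast
    then obtain y where "x = ?p ^ m * y" by (rule dvdE)
    hence "x = of_nat (CARD('p) ^ m) * y" by simp
    hence "padic_residue x m = 0"
      by (simp only: times_padic_int.rep_eq padic_residue_of_nat) simp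
    thus False using m by simp
  qed
  define n where "n = Max {k. ?p ^ k dvd x}"
  have fin: "finite {k. ?p ^ k dvd x}"
    by (rule finite_subset[of _ "{..<m}"]) (use bound in \<open>auto simp: not_le[symmetric]\<close>)
  have "0 \<in> {k. ?p ^ k dvd x}" by simp
  hence "?p ^ n dvd x" using Max_in[OF fin] unfolding n_def by blast
  then obtain u where u: "x = ?p ^ n * u" by blast
  have "\<not> ?p dvd u"
  proof
    assume "?p dvd u"
    hence "?p ^ Suc n dvd x" using u by (auto simp: mult_ac)
    hence "Suc n \<le> n" unfolding n_def using Max_ge[OF fin] by blast
    thus False by simp
  qed
  thus thesis using u that by blast
qed

lemma padic_decompose:
  assumes "x \<noteq> (0 :: 'p::prime_card padic)"
  obtains k u w where "\<not> of_nat CARD('p) dvd u" "\<not> of_nat CARD('p) dvd w"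
    "x = of_nat CARD('p) powi k * Fract u w"
proof -
  let ?p = "of_nat CARD('p) :: 'p padic_int" and ?P = "of_nat CARD('p) :: 'p padic"
  have P0: "?P \<noteq> 0" using prime_card[where 'a='p] by auto
  obtain a b where ab: "x = Fract a b" "b \<noteq> 0" by (cases x) auto
  have a0: "a \<noteq> 0" using assms ab by (auto simp: fract_collapse)
  obtain n u where u: "\<not> ?p dvd u" "a = ?p ^ n * u" using padic_int_decompose[OF a0] .
  obtain m w where w: "\<not> ?p dvd w" "b = ?p ^ m * w" using padic_int_decompose[OF ab(2)] .
  have "x = Fract (?p ^ n) (?p ^ m) * Fract u w" using ab u w by simp
  also have "Fract (?p ^ n) (?p ^ m) = Fract (?p ^ n) 1 / Fract (?p ^ m) 1" by simp
  also have "\<dots> = ?P powi (int n - int m)"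
    unfolding padic_Fract_power using P0 by (simp add: power_int_diff)
  finally show thesis using that u w by blast
qed

lemma ac_min_poly_props:
  fixes x :: "'a::field alg_closure"
  shows "Polynomial.lead_coeff (ac_min_poly x) = 1"
    and "Factorial_Ring.irreducible (ac_min_poly x)"
    and "poly (map_poly to_ac (ac_min_poly x)) x = 0"
    and ac_min_poly_eqI: "\<And>P. Polynomial.lead_coeff P = 1 \<Longrightarrow> Factorial_Ring.irreducible P \<Longrightarrow>
           poly (map_poly to_ac P) x = 0 \<Longrightarrow> ac_min_poly x = P"
proof -
  let ?Q = "\<lambda>P. Polynomial.lead_coeff P = 1 \<and> Factorial_Ring.irreducible P \<and>
              poly (map_poly to_ac P) x = 0"
  interpret h: field_hom "to_ac :: 'a \<Rightarrow> _" by standard auto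
  interpret hp: map_poly_comm_ring_hom "to_ac :: 'a \<Rightarrow> _" ..
  have "\<exists>P. ?Q P \<and> (\<forall>R. poly (map_poly to_ac R) x = 0 \<longrightarrow> P dvd R)"
  proof -
    define n where "n = (LEAST n. \<exists>P::'a poly. P \<noteq> 0 \<and> poly (map_poly to_ac P) x = 0 \<and> Polynomial.degree P = n)"
    have "\<exists>n. \<exists>P::'a poly. P \<noteq> 0 \<and> poly (map_poly to_ac P) x = 0 \<and> Polynomial.degree P = n"
      using alg_closure_algebraic[of x] by metis
    from LeastI_ex[OF this] obtain P :: "'a poly" where P: "P \<noteq> 0" "poly (map_poly to_ac P) x = 0"
      "Polynomial.degree P = n" unfolding n_def by blast
    have min: "Polynomial.degree R \<ge> n" if "R \<noteq> 0" "poly (map_poly to_ac R) x = 0" for R :: "'a poly"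
      unfolding n_def using that by (intro Least_le) blast
    define P' where "P' = Polynomial.smult (inverse (Polynomial.lead_coeff P)) P"
    have "Polynomial.lead_coeff P \<noteq> 0" using P(1) by (simp only: leading_coeff_neq_0 not_False_eq_True)
    hence lc: "Polynomial.lead_coeff P' = 1" by (simp add: P'_def)
    have r: "poly (map_poly to_ac P') x = 0"
      using P(2) by (simp add: P'_def h.map_poly_hom_smult)
    have d: "Polynomial.degree P' = n"
      using P(3) \<open>Polynomial.lead_coeff P \<noteq> 0\<close> by (simp add: P'_def)
    have P'0: "P' \<noteq> 0" using lc by auto
    have "Factorial_Ring.irreducible P'"
    proof (rule Factorial_Ring.irreducibleI)
      show "P' \<noteq> 0" by fact
      show "\<not> P' dvd 1"
      proof
        assume "P' dvd 1"
        then obtain c where "P' = [:c:]" "c \<noteq> 0"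
          using P'0 by (auto simp: is_unit_iff_degree elim!: degree_eq_zeroE)
        thus False using r by simp
      qed
      fix a b assume ab: "P' = a * b"
      hence "a \<noteq> 0" "b \<noteq> 0" using P'0 by auto
      hence deg: "Polynomial.degree a + Polynomial.degree b = n" using d ab by (simp add: Polynomial.degree_mult_eq)
      have "poly (map_poly to_ac a) x = 0 \<or> poly (map_poly to_ac b) x = 0"
        using r unfolding ab by (simp add: hp.hom_mult)
      hence "Polynomial.degree a = 0 \<or> Polynomial.degree b = 0"
        using min[of a] min[of b] deg \<open>a \<noteq> 0\<close> \<open>b \<noteq> 0\<close> by auto
      thus "a dvd 1 \<or> b dvd 1" using \<open>a \<noteq> 0\<close> \<open>b \<noteq> 0\<close>
        by (auto simp: is_unit_iff_degree)
    qed
    moreover have "P' dvd R" if "poly (map_poly to_ac R) x = 0" for R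
    proof -
      have "poly (map_poly to_ac (R div P' * P' + R mod P')) x = 0"
        using that by simp
      hence "poly (map_poly to_ac (R mod P')) x = 0"
        unfolding hp.hom_add hp.hom_mult using r by simp
      hence "R mod P' = 0"
        using min[of "R mod P'"] degree_mod_less[OF P'0, of R] d by fastforce
      thus ?thesis by (simp add: dvd_eq_mod_eq_0)
    qed
    ultimately show ?thesis using lc r by blast
  qed
  then obtain M where M: "?Q M" "\<And>R. poly (map_poly to_ac R) x = 0 \<Longrightarrow> M dvd R" by blast
  have M_eq: "P = M" if P: "?Q P" for P
  proof -
    have "M dvd P" using M(2) P by blast
    moreover have "\<not> M dvd 1" using M(1) by (auto simp: Factorial_Ring.irreducible_def)
    ultimately have "P dvd M" using P by (blast dest: Factorial_Ring.irreducibleD')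
    thus ?thesis using \<open>M dvd P\<close> M(1) P poly_dvd_antisym[of P M] by auto
  qed
  have "?Q (ac_min_poly x)" unfolding ac_min_poly_def
    by (rule theI') (use M(1) M_eq in blast)
  thus "Polynomial.lead_coeff (ac_min_poly x) = 1" "Factorial_Ring.irreducible (ac_min_poly x)"
    "poly (map_poly to_ac (ac_min_poly x)) x = 0" by auto
  show "ac_min_poly x = P" if "Polynomial.lead_coeff P = 1" "Factorial_Ring.irreducible P"
           "poly (map_poly to_ac P) x = 0" for P
    using M_eq[OF \<open>?Q (ac_min_poly x)\<close>] M_eq[of P] that by simp
qed

lemma padic_val_uminus: "padic_val (- x) = padic_val (x :: 'p::prime_card padic)"
proof (cases "x = 0")
  case False
  obtain k u w where x: "\<not> of_nat CARD('p) dvd u" "\<not> of_nat CARD('p) dvd w"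
    "x = of_nat CARD('p) powi k * Fract u w" using padic_decompose[OF False] .
  have "- x = of_nat CARD('p) powi k * Fract (- u) w"
    unfolding x(3) by (metis minus_fract mult_minus_right)
  thus ?thesis using x padic_val_eqI[of u w k] padic_val_eqI[of "- u" w k] by simp
qed simp

lemma padic_ac_val_to_ac: "padic_ac_val (to_ac x) = padic_val (x :: 'p::prime_card padic)"
proof -
  have "ac_min_poly (to_ac x) = [:- x, 1:]"
    by (rule ac_min_poly_eqI) (auto intro!: irreducible_linear_field_poly)
  thus ?thesis
    by (simp add: padic_ac_val_def padic_val_uminus flip: one_ereal_def)
qed

lemma modular_discriminant_nth:
  "fps_nth (modular_discriminant :: 'a::field_char_0 fps) 0 = 0"
  "fps_nth (modular_discriminant :: 'a::field_char_0 fps) 1 = 1"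
  "fps_nth (modular_discriminant :: 'a::field_char_0 fps) 2 = -24"
proof -
  have "{d. d dvd Suc (Suc 0)} = {1, 2}" "{d. d dvd Suc 0} = {1}"
    using two_is_prime_nat unfolding prime_nat_iff by (auto simp: numeral_2_eq_2)
  thus 
  "fps_nth (modular_discriminant :: 'a::field_char_0 fps) 0 = 0"
  "fps_nth (modular_discriminant :: 'a::field_char_0 fps) 1 = 1"
  "fps_nth (modular_discriminant :: 'a::field_char_0 fps) 2 = -24"
  by (simp_all add: modular_discriminant_def eisenstein_E4_def eisenstein_E6_def
     power3_eq_cube power2_eq_square fps_mult_nth numeral_2_eq_2)
qed

lemma eisenstein_E4_nonzero: "(eisenstein_E4 :: 'a::field_char_0 fps) \<noteq> 0"
  by (auto simp: eisenstein_E4_def fps_eq_iff intro!: exI[of _ 0])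

lemma modular_discriminant_nonzero: "(modular_discriminant :: 'a::field_char_0 fps) \<noteq> 0"
  using modular_discriminant_nth(2) by (metis fps_zero_nth zero_neq_one)

lemma modular_j_subdegree: "fls_subdegree (modular_j :: 'a::field_char_0 fls) = -1"
proof -
  have "subdegree (modular_discriminant :: 'a fps) = 1"
    by (rule subdegreeI) (simp_all add: modular_discriminant_nth[unfolded One_nat_def])
  moreover have "subdegree (eisenstein_E4 :: 'a fps) = 0"
    by (rule subdegreeI) (simp_all add: eisenstein_E4_def)
  ultimately show ?thesis
    by (simp add: modular_j_def fls_divide_subdegree fls_subdegree_pow fls_subdegree_fls_to_fps
        eisenstein_E4_nonzero modular_discriminant_nonzero)
qed

lemma modular_j_nth:
  "fls_nth (modular_j :: 'a::field_char_0 fls) (-1) = 1"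
  "fls_nth (modular_j :: 'a::field_char_0 fls) 0 = 744"
proof -
  define J where "J = fls_regpart (fls_shift (-1) (modular_j :: 'a fls))"
  have J: "fps_to_fls J = fls_X * modular_j"
  proof -
    have "modular_j \<noteq> (0 :: 'a fls)" using modular_j_subdegree[where 'a='a] by auto
    hence "fls_subdegree (fls_shift (-1) (modular_j :: 'a fls)) \<ge> 0"
      by (simp add: modular_j_subdegree)
    thus ?thesis unfolding J_def
      by (simp only: fls_regpart_to_fls_trivial fls_X_times_conv_shift)
  qed
  have "fps_to_fls (J * modular_discriminant) = fps_to_fls (fps_X * (eisenstein_E4 :: 'a fps) ^ 3)"
    by (simp add: fls_times_fps_to_fls J modular_j_def modular_discriminant_nonzero fps_to_fls_power)
  hence eq: "J * modular_discriminant = fps_X * (eisenstein_E4 :: 'a fps) ^ 3"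
    by (simp only: fps_to_fls_eq_iff)
  have d: "{d. d dvd Suc 0} = {1}" by auto
  from arg_cong[OF eq, of "\<lambda>f. fps_nth f 1"] have J0: "fps_nth J 0 = 1"
    by (simp add: fps_mult_nth modular_discriminant_nth modular_discriminant_nth(2)[unfolded One_nat_def]
        eisenstein_E4_def power3_eq_cube)
  from arg_cong[OF eq, of "\<lambda>f. fps_nth f 2"] J0 have J1: "fps_nth J 1 = 744"
    by (simp add: fps_mult_nth numeral_2_eq_2 modular_discriminant_nth modular_discriminant_nth(2)[unfolded One_nat_def]
        modular_discriminant_nth(3)[unfolded numeral_2_eq_2]
        eisenstein_E4_def power3_eq_cube d eq_diff_eq)
  show "fls_nth (modular_j :: 'a fls) (-1) = 1" "fls_nth (modular_j :: 'a fls) 0 = 744"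
    using J0 J1 by (simp_all add: J_def modular_j_subdegree)
qed

lemma F4_sums:
  fixes c :: "'a::field_char_0"
  defines "G \<equiv> fps_to_fls eisenstein_E4 / (modular_j - fls_const c)"
  shows "(\<lambda>m. fls_const (c ^ m) * fps_to_fls eisenstein_E4 * inverse modular_j ^ (m + 1)) sums G"
proof -
  let ?E = "fps_to_fls eisenstein_E4 :: 'a fls" and ?j = "modular_j :: 'a fls"
  let ?f = "\<lambda>m. fls_const (c ^ m) * ?E * inverse ?j ^ (m + 1)"
  have j0: "?j \<noteq> 0" using modular_j_subdegree[where 'a='a] by auto
  have jc0: "?j - fls_const c \<noteq> 0"
    using modular_j_nth(1)[where 'a='a] by (auto dest!: arg_cong[of _ _ "\<lambda>f. fls_nth f (-1)"])
  have sdjc: "fls_subdegree (?j - fls_const c) = -1"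
    by (rule fls_subdegree_eqI) 
       (auto simp: modular_j_nth(1) modular_j_subdegree intro: fls_eq0_below_subdegree)
  have E0: "?E \<noteq> 0" using eisenstein_E4_nonzero by simp
  have sdE: "fls_subdegree ?E \<ge> 0" by (simp add: fls_subdegree_fls_to_fps)
  have psum: "(\<Sum>m<n. ?f m) = G - G * (fls_const c * inverse ?j) ^ n" for n
  proof (induction n)
    case (Suc n)
    have "?f n = G * (?j - fls_const c) * inverse ?j * (fls_const c * inverse ?j) ^ n"
      using jc0 by (simp add: G_def power_mult_distrib fls_const_power)
    also have "G * (?j - fls_const c) * inverse ?j = G * (1 - fls_const c * inverse ?j)"
      using j0 by (simp add: algebra_simps)
    finally have fn: "?f n = G * (1 - fls_const c * inverse ?j) * (fls_const c * inverse ?j) ^ n" .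
    show ?case unfolding sum.lessThan_Suc Suc.IH fn by (simp add: algebra_simps)
  qed simp
  have bound: "dist (\<Sum>m<n. ?f m) G \<le> inverse (2 ^ n)" for n
  proof (cases "c = 0 \<and> n > 0")
    case True
    thus ?thesis unfolding psum by (simp add: power_0_left)
  next
    case False
    hence D0: "G * (fls_const c * inverse ?j) ^ n \<noteq> 0"
      using E0 jc0 j0 by (auto simp: G_def)
    hence "fls_subdegree (G * (fls_const c * inverse ?j) ^ n) =
        fls_subdegree G + int n * (fls_subdegree (fls_const c * inverse ?j))"
      by (simp add: fls_subdegree_pow)
    also have "int n * (fls_subdegree (fls_const c * inverse ?j)) = int n"
      using False j0 by (cases "n = 0") (auto simp: modular_j_subdegree fls_inverse_subdegree)
    also have "fls_subdegree G = fls_subdegree ?E + 1"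
      using E0 jc0 sdjc by (simp add: G_def fls_divide_subdegree)
    finally have sd: "fls_subdegree (G * (fls_const c * inverse ?j) ^ n) \<ge> int n" using sdE by simp
    have "inverse ((2::real) ^ nat (fls_subdegree (G * (fls_const c * inverse ?j) ^ n))) \<le> inverse (2 ^ n)"
      using sd by (intro le_imp_inverse_le power_increasing) auto
    moreover have "fls_subdegree (G * (fls_const c * inverse ?j) ^ n) \<ge> 0" using sd by linarith
    ultimately show ?thesis unfolding psum dist_fls_def using D0 by auto
  qed
  have "(\<lambda>n. inverse ((2::real) ^ n)) \<longlonglongrightarrow> 0" by (rule LIMSEQ_inverse_realpow_zero) simp
  hence "(\<lambda>n. dist (\<Sum>m<n. ?f m) G) \<longlonglongrightarrow> 0"
    by (rule Lim_null_comparison[rotated]) (use bound in simp)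
  thus ?thesis unfolding sums_def by (subst tendsto_dist_iff)
qed

lemma F4_eq_divide: "F4 c = fps_to_fls eisenstein_E4 / (modular_j - fls_const c)"
  unfolding F4_def using sums_unique[OF F4_sums] by metis

end

theory Submission
  imports Defs "Jordan_Normal_Form.Char_Poly"
begin

text \<open>
  Put \<open>t = 1 / j\<close> and \<open>\<theta> = q d/dq\<close>. Ramanujan's differential equations give \<open>\<theta>t = t E6 / E4\<close> and show that
  \<open>sqrt E4\<close>, as a function of \<open>t\<close>, solves the third-order hypergeometric equation, whence
  \<open>sqrt E4 = H(t)\<close> with \<open>H = \<Sum>m. (6m)! / (m!^3 (3m)!) t^m\<close>. Since \<open>E6^2 = E4^3 (1 - 1728 t)\<close>, it follows that
  \<open>E4 / (j - c) = G(t) \<theta>t\<close> for \<open>G(t) = H(t) (1 - 1728 t)^(-1/2) / (1 - c t)\<close>. The coefficient of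
  \<open>q^P\<close>, \<open>P = p^l\<close>, is therefore \<open>P\<close> times that of a primitive of \<open>G\<close>, which modulo \<open>p\<close> leaves
  only the coefficient of \<open>t^(P - 1)\<close> in \<open>G\<close>. Modulo \<open>p\<close> and \<open>t^P\<close> the factor \<open>(1 - 1728 t)^(-1/2)\<close> equals
  \<open>(1 - 1728 t)^N\<close> with \<open>N = (P - 1) / 2\<close>, and \<open>H\<close> is a polynomial of degree at most \<open>N\<close> because
  \<open>binomial(2m, m)\<close> divides its coefficients. So the coefficient in question is \<open>c^(2N)\<close> times the value of
  a polynomial of degree at most \<open>2N\<close> at \<open>1 / c\<close>.
\<close>

section \<open>Convolution sums of divisor functions\<close>

text \<open>All series are formal, over a field of characteristic zero, so no transformation law of
  modular forms is used: Ramanujan's equations come from convolution sums of divisor functions.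
  Those are obtained by Liouville's elementary method from binary forms with the symmetry of the
  hexagonal lattice, whose invariants have one generator in degree 2 and one in degree 6; this
  suffices for the four sums that occur. For the third-order equation, \<open>E2\<close> is hidden
  in \<open>u = E2 E4 / E6\<close>: the polynomials in \<open>u\<close> and
  \<open>1 / (1 - 1728 t)\<close> are closed under \<open>t d/dt\<close>, so the claim about
  \<open>sqrt E4\<close> becomes a polynomial identity. The congruence is proved over any subring in
  which the integers prime to \<open>p\<close> are invertible. That the integral closure is such a
  ring, and that valuation zero makes \<open>c\<close> a unit in it, are separate algebraic facts.
  The condition on \<open>p\<close> enters through the oddness of \<open>p\<close>, which makes
  \<open>N\<close> an integer with \<open>P = 2 N + 1\<close>, and through the invertibility of 1728
  and 432.\<close>

definition quads :: "nat \<Rightarrow> (nat \<times> nat \<times> nat \<times> nat) set" where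
  "quads n = {(a, b, x, y). a > 0 \<and> b > 0 \<and> x > 0 \<and> y > 0 \<and> a * x + b * y = n}"

lemma finite_quads: "finite (quads n)"
proof (rule finite_subset)
  show "quads n \<subseteq> {..n} \<times> {..n} \<times> {..n} \<times> {..n}"
  proof
    fix q assume "q \<in> quads n"
    then obtain a b x y where q: "q = (a, b, x, y)" "a > 0" "b > 0" "x > 0" "y > 0" "a * x + b * y = n"
      by (auto simp: quads_def)
    have "a * 1 \<le> a * x" "1 * x \<le> a * x" "b * 1 \<le> b * y" "1 * y \<le> b * y"
      using q by (auto intro!: mult_le_mono simp del: mult_1_right)
    thus "q \<in> {..n} \<times> {..n} \<times> {..n} \<times> {..n}" using q unfolding mult_1 mult_1_right by (simp; linarith)
  qed
qed simp

lemma sum_quads_swap: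
  "(\<Sum>(a, b, x, y)\<in>quads n. f a b x y) = (\<Sum>(a, b, x, y)\<in>quads n. f b a y x)"
  by (rule sum.reindex_bij_witness[of _ "\<lambda>(a,b,x,y). (b,a,y,x)" "\<lambda>(a,b,x,y). (b,a,y,x)"])
     (auto simp: quads_def)

text \<open>Swapping the two summands \<open>a * x\<close> and \<open>b * y\<close> exchanges the
  regions \<open>P\<close> and \<open>Q\<close>, so they contribute equally. The remaining locus is
  a diagonal in both applications: \<open>a = b\<close> or \<open>x = y\<close>.\<close>

lemma sum_quads_trichotomy:
  fixes f :: "nat \<Rightarrow> nat \<Rightarrow> nat \<Rightarrow> nat \<Rightarrow> 'a::comm_ring_1"
  assumes P: "\<And>a b x y. P b a y x \<longleftrightarrow> Q a b x y"
    and disj: "\<And>a b x y. P a b x y \<Longrightarrow> \<not> Q a b x y"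
    and sym: "\<And>a b x y. f a b x y = f b a y x"
  shows "(\<Sum>(a, b, x, y)\<in>quads n. f a b x y) =
    (\<Sum>(a, b, x, y)\<in>quads n. if \<not> P a b x y \<and> \<not> Q a b x y then f a b x y else 0) +
    2 * (\<Sum>(a, b, x, y)\<in>quads n. if P a b x y then f a b x y else 0)"
proof -
  have "(\<Sum>(a, b, x, y)\<in>quads n. f a b x y) =
    (\<Sum>(a, b, x, y)\<in>quads n. if \<not> P a b x y \<and> \<not> Q a b x y then f a b x y else 0) +
    ((\<Sum>(a, b, x, y)\<in>quads n. if P a b x y then f a b x y else 0) +
     (\<Sum>(a, b, x, y)\<in>quads n. if Q a b x y then f a b x y else 0))"
    unfolding sum.distrib[symmetric] using disj by (intro sum.cong) auto
  also have "(\<Sum>(a, b, x, y)\<in>quads n. if Q a b x y then f a b x y else 0) =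
     (\<Sum>(a, b, x, y)\<in>quads n. if P a b x y then f a b x y else 0)"
    by (subst sum_quads_swap) (auto simp: P[symmetric] sym[symmetric] intro!: sum.cong)
  finally show ?thesis by simp
qed

text \<open>Rests on \<open>a * x + b * y = (a - b) * x + b * (x + y)\<close>.\<close>

lemma sum_quads_shear:
  fixes g :: "nat \<Rightarrow> nat \<Rightarrow> 'a::comm_ring_1"
  shows "(\<Sum>(a, b, x, y)\<in>quads n. if b < a then g a b else 0) =
         (\<Sum>(a, b, x, y)\<in>quads n. if x < y then g (a + b) b else 0)"
proof -
  have "(\<Sum>(a, b, x, y)\<in>quads n. if b < a then g a b else 0) =
        (\<Sum>(a, b, x, y)\<in>{(a, b, x, y)\<in>quads n. b < a}. g a b)"
    using finite_quads[of n] by (intro sum.mono_neutral_cong_right) (auto split: if_splits)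
  also have "\<dots> = (\<Sum>(a, b, x, y)\<in>{(a, b, x, y)\<in>quads n. x < y}. g (a + b) b)"
  proof (rule sum.reindex_bij_witness[of _ "\<lambda>(a,b,x,y). (a+b,b,x,y-x)" "\<lambda>(a,b,x,y). (a-b,b,x,y+x)"], goal_cases)
    case (2 q)
    then obtain a b x y where q: "q = (a, b, x, y)" "(a, b, x, y) \<in> quads n" "b < a" by auto
    then obtain k where "a = b + k" "k > 0" using less_imp_add_positive by blast
    thus ?case using q by (auto simp: quads_def algebra_simps)
  next
    case (4 q)
    then obtain a b x y where q: "q = (a, b, x, y)" "(a, b, x, y) \<in> quads n" "x < y" by auto
    then obtain k where "y = x + k" "k > 0" using less_imp_add_positive by blast
    thus ?case using q by (auto simp: quads_def algebra_simps)
  qed auto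
  also have "\<dots> = (\<Sum>(a, b, x, y)\<in>quads n. if x < y then g (a + b) b else 0)"
    using finite_quads[of n] by (intro sum.mono_neutral_cong_left) (auto split: if_splits)
  finally show ?thesis .
qed

text \<open>On this diagonal the equation reads \<open>d * (x + y) = n\<close>: \<open>d\<close>
  divides \<open>n\<close>, and \<open>x\<close> has \<open>n / d - 1\<close> possible
  values.\<close>

lemma sum_quads_diag1:
  fixes g :: "nat \<Rightarrow> nat \<Rightarrow> 'a::field_char_0"
  assumes "n > 0"
  shows "(\<Sum>(a, b, x, y)\<in>quads n. if a = b then g a b else 0) =
         (\<Sum>d | d dvd n. (of_nat n / of_nat d - 1) * g d d)"
proof -
  have "(\<Sum>(a, b, x, y)\<in>quads n. if a = b then g a b else 0) =
        (\<Sum>(a, b, x, y)\<in>{(a, b, x, y)\<in>quads n. a = b}. g a b)"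
    using finite_quads[of n] by (intro sum.mono_neutral_cong_right) (auto split: if_splits)
  also have "\<dots> = (\<Sum>(d, x)\<in>(SIGMA d:{d. d dvd n}. {1..<n div d}). g d d)"
  proof (rule sum.reindex_bij_witness[of _ "\<lambda>(d,x). (d,d,x,n div d - x)" "\<lambda>(a,b,x,y). (a,x)"], goal_cases)
    case (4 q)
    then obtain d x where q: "q = (d, x)" "d dvd n" "1 \<le> x" "x < n div d" by auto
    obtain k where "n = d * k" using q by (elim dvdE)
    moreover have "d > 0" using q assms by (auto intro: Nat.gr0I)
    ultimately show ?case using q by (auto simp: quads_def simp flip: distrib_left)
  qed (use assms in \<open>auto simp: quads_def simp flip: distrib_left\<close>)
  also have "\<dots> = (\<Sum>d | d dvd n. \<Sum>x\<in>{1..<n div d}. g d d)"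
    using assms by (subst sum.Sigma) auto
  also have "\<dots> = (\<Sum>d | d dvd n. (of_nat n / of_nat d - 1) * g d d)"
  proof (rule sum.cong)
    fix d assume "d \<in> {d. d dvd n}"
    then obtain k where "n = d * k" by auto
    with assms show "(\<Sum>x\<in>{1..<n div d}. g d d) = (of_nat n / of_nat d - 1) * g d d"
      by (simp add: of_nat_diff)
  qed simp
  finally show ?thesis .
qed

text \<open>Here \<open>(a + b) * x = n\<close>, so the divisor is \<open>d = a + b\<close> and
  \<open>x\<close> is its cofactor.\<close>

lemma sum_quads_diag2:
  fixes g :: "nat \<Rightarrow> nat \<Rightarrow> 'a::field_char_0"
  assumes "n > 0"
  shows "(\<Sum>(a, b, x, y)\<in>quads n. if x = y then g a b else 0) =
         (\<Sum>d | d dvd n. \<Sum>a\<in>{1..<d}. g a (d - a))"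
proof -
  have "(\<Sum>(a, b, x, y)\<in>quads n. if x = y then g a b else 0) =
        (\<Sum>(a, b, x, y)\<in>{(a, b, x, y)\<in>quads n. x = y}. g a b)"
    using finite_quads[of n] by (intro sum.mono_neutral_cong_right) (auto split: if_splits)
  also have "\<dots> = (\<Sum>(d, a)\<in>(SIGMA d:{d. d dvd n}. {1..<d}). g a (d - a))"
  proof (rule sum.reindex_bij_witness[of _ "\<lambda>(d,a). (a,d-a,n div d, n div d)" "\<lambda>(a,b,x,y). (a+b,a)"], goal_cases)
    case (4 q)
    then obtain d a where q: "q = (d, a)" "d dvd n" "1 \<le> a" "a < d" by auto
    obtain k where k: "n = d * k" using q by (elim dvdE)
    hence "k > 0" "d > 0" using assms by auto
    thus ?case using q k by (auto simp: quads_def simp flip: distrib_right)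
  qed (use assms in \<open>auto simp: quads_def simp flip: distrib_right\<close>)
  also have "\<dots> = (\<Sum>d | d dvd n. \<Sum>a\<in>{1..<d}. g a (d - a))"
    using assms by (subst sum.Sigma) auto
  finally show ?thesis .
qed

text \<open>The shear \<open>(a, b, x, y) \<mapsto> (a - b, b, x, x + y)\<close> is a bijection from the quadruples with
  \<open>b < a\<close> to those with \<open>x < y\<close>. Both halves are completed by symmetry, which is where the
  two invariance properties of \<open>G\<close> are needed; what remains are the two diagonals.\<close>

lemma sum_quads_hexagonal:
  fixes G :: "nat \<Rightarrow> nat \<Rightarrow> 'a::field_char_0"
  assumes "n > 0" and sym: "\<And>a b. G a b = G b a" and hex: "\<And>a b. G (a + b) b = G (a + b) a"
  shows "(\<Sum>(a, b, x, y)\<in>quads n. G (a + b) b - G a b) =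
    (\<Sum>d | d dvd n. (\<Sum>a\<in>{1..<d}. G d a) - (of_nat n / of_nat d - 1) * G d d)"
proof -
  have 1: "(\<Sum>(a, b, x, y)\<in>quads n. G a b) = 
     (\<Sum>d | d dvd n. (of_nat n / of_nat d - 1) * G d d) +
     2 * (\<Sum>(a, b, x, y)\<in>quads n. if b < a then G a b else 0)"
  proof -
    have "(\<Sum>d | d dvd n. (of_nat n / of_nat d - 1) * G d d) =
        (\<Sum>(a, b, x, y)\<in>quads n. if a = b then G a b else 0)"
      by (rule sum_quads_diag1[OF \<open>n > 0\<close>, symmetric])
    also have "\<dots> = (\<Sum>(a, b, x, y)\<in>quads n. if \<not> b < a \<and> \<not> a < b then G a b else 0)"
      by (intro sum.cong) auto
    finally have diag: "(\<Sum>d | d dvd n. (of_nat n / of_nat d - 1) * G d d) = \<dots>" .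
    show ?thesis unfolding diag
      by (intro sum_quads_trichotomy[where P = "\<lambda>a b x y. b < a" and Q = "\<lambda>a b x y. a < b"] sym) auto
  qed
  have 2: "(\<Sum>(a, b, x, y)\<in>quads n. G (a + b) b) = 
     (\<Sum>d | d dvd n. \<Sum>a\<in>{1..<d}. G d a) +
     2 * (\<Sum>(a, b, x, y)\<in>quads n. if x < y then G (a + b) b else 0)"
  proof -
    have "(\<Sum>d | d dvd n. \<Sum>a\<in>{1..<d}. G d a) = (\<Sum>d | d dvd n. \<Sum>a\<in>{1..<d}. G (a + (d - a)) (d - a))"
      by (intro sum.cong refl, subst hex) auto
    also have "\<dots> = (\<Sum>(a, b, x, y)\<in>quads n. if x = y then G (a + b) b else 0)"
      by (rule sum_quads_diag2[OF \<open>n > 0\<close>, symmetric])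
    also have "\<dots> = (\<Sum>(a, b, x, y)\<in>quads n. if \<not> x < y \<and> \<not> y < x then G (a + b) b else 0)"
      by (intro sum.cong) auto
    finally have diag: "(\<Sum>d | d dvd n. \<Sum>a\<in>{1..<d}. G d a) = \<dots>" .
    have "G (a + b) b = G (b + a) a" for a b
      using hex[of a b] by (simp only: add.commute)
    thus ?thesis unfolding diag
      by (intro sum_quads_trichotomy[where P = "\<lambda>a b x y. x < y" and Q = "\<lambda>a b x y. y < x"]) auto
  qed
  have 3: "(\<Sum>(a, b, x, y)\<in>quads n. G (a + b) b - G a b) =
     (\<Sum>(a, b, x, y)\<in>quads n. G (a + b) b) - (\<Sum>(a, b, x, y)\<in>quads n. G a b)"
    unfolding sum_subtractf[symmetric] by (intro sum.cong) auto
  show ?thesis unfolding 3 unfolding 1 2 sum_quads_shear sum_subtractf by simp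
qed

section \<open>Ramanujan's convolution identities for divisor sums\<close>

definition divisor_sum :: "nat \<Rightarrow> nat \<Rightarrow> 'a::field_char_0" where
  "divisor_sum k n = (\<Sum>d | d dvd n. of_nat d ^ k)"

definition divisor_conv :: "nat \<Rightarrow> nat \<Rightarrow> nat \<Rightarrow> 'a::field_char_0" where
  "divisor_conv i j n = (\<Sum>k\<in>{1..<n}. divisor_sum i k * divisor_sum j (n - k))"

lemma divisor_conv_quads:
  "divisor_conv i j n = (\<Sum>(a, b, x, y)\<in>quads n. of_nat a ^ i * of_nat b ^ j)"
proof -
  have "divisor_conv i j n = (\<Sum>k\<in>{1..<n}. \<Sum>(a, b)\<in>{a. a dvd k} \<times> {b. b dvd n - k}. of_nat a ^ i * of_nat b ^ j :: 'a)"
    unfolding divisor_conv_def divisor_sum_def by (simp add: sum_product sum.cartesian_product)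
  also have "\<dots> = (\<Sum>(k, a, b)\<in>(SIGMA k:{1..<n}. {a. a dvd k} \<times> {b. b dvd n - k}). of_nat a ^ i * of_nat b ^ j)"
    by (subst sum.Sigma) auto
  also have "\<dots> = (\<Sum>(a, b, x, y)\<in>quads n. of_nat a ^ i * of_nat b ^ j)"
  proof (rule sum.reindex_bij_witness[of _ "\<lambda>(a,b,x,y). (a*x,a,b)" "\<lambda>(k,a,b). (a,b,k div a,(n-k) div b)"], goal_cases)
    case (2 q)
    then obtain k a b where q: "q = (k, a, b)" "1 \<le> k" "k < n" "a dvd k" "b dvd n - k" by auto
    hence "k > 0" "n - k > 0" by auto
    hence "a > 0" "b > 0" using q dvd_pos_nat by blast+
    moreover have "k div a > 0" "(n - k) div b > 0"
      using q \<open>k > 0\<close> \<open>n - k > 0\<close> \<open>a > 0\<close> \<open>b > 0\<close> by (auto simp: div_greater_zero_iff dvd_imp_le)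
    ultimately have "a > 0" "b > 0" "k div a > 0" "(n - k) div b > 0" by auto
    thus ?case using q by (auto simp: quads_def)
  qed (auto simp: quads_def)
  finally show ?thesis .
qed

lemma divisor_conv_commute: "divisor_conv i j n = (divisor_conv j i n :: 'a::field_char_0)"
  unfolding divisor_conv_quads by (subst sum_quads_swap) (simp add: mult.commute)

text \<open>Faulhaber's formulas with denominators cleared and the upper end excluded. They evaluate
  the inner sums of \<open>G d a\<close> that \<open>sum_quads_hexagonal\<close> leaves
  over.\<close>

lemma power_sums:
  assumes "d > 0"
  shows "1 * (\<Sum>a\<in>{1..<d}. of_nat a ^ 0 :: 'a::field_char_0) = of_nat d - 1"
    and "2 * (\<Sum>a\<in>{1..<d}. of_nat a ^ 1 :: 'a) = of_nat d ^ 2 - of_nat d"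
    and "6 * (\<Sum>a\<in>{1..<d}. of_nat a ^ 2 :: 'a) = 2 * of_nat d ^ 3 - 3 * of_nat d ^ 2 + of_nat d"
    and "4 * (\<Sum>a\<in>{1..<d}. of_nat a ^ 3 :: 'a) = of_nat d ^ 4 - 2 * of_nat d ^ 3 + of_nat d ^ 2"
    and "30 * (\<Sum>a\<in>{1..<d}. of_nat a ^ 4 :: 'a) = 6 * of_nat d ^ 5 - 15 * of_nat d ^ 4 + 10 * of_nat d ^ 3 - of_nat d"
    and "12 * (\<Sum>a\<in>{1..<d}. of_nat a ^ 5 :: 'a) = 2 * of_nat d ^ 6 - 6 * of_nat d ^ 5 + 5 * of_nat d ^ 4 - of_nat d ^ 2"
    and "42 * (\<Sum>a\<in>{1..<d}. of_nat a ^ 6 :: 'a) = 6 * of_nat d ^ 7 - 21 * of_nat d ^ 6 + 21 * of_nat d ^ 5 - 7 * of_nat d ^ 3 + of_nat d"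
proof -
  have step: "c * (\<Sum>a\<in>{1..<d}. of_nat a ^ k :: 'a) = f (of_nat d)"
    if "f 1 = 0" "\<And>x. f (x + 1) = f x + c * x ^ k" for f k c
    using assms by (induction d rule: nat_induct_non_zero) (simp_all add: that add.commute[of 1] distrib_left)
  show "1 * (\<Sum>a\<in>{1..<d}. of_nat a ^ 0 :: 'a::field_char_0) = of_nat d - 1"
    by (rule step[where f = "\<lambda>x. x - 1"]) auto
  show "2 * (\<Sum>a\<in>{1..<d}. of_nat a ^ 1 :: 'a) = of_nat d ^ 2 - of_nat d"
    by (rule step[where f = "\<lambda>x. x ^ 2 - x"]) (simp_all add: power2_eq_square algebra_simps)
  show "6 * (\<Sum>a\<in>{1..<d}. of_nat a ^ 2 :: 'a) = 2 * of_nat d ^ 3 - 3 * of_nat d ^ 2 + of_nat d"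
    by (rule step[where f = "\<lambda>x. 2 * x ^ 3 - 3 * x ^ 2 + x"], simp, Groebner_Basis.algebra)
  show "4 * (\<Sum>a\<in>{1..<d}. of_nat a ^ 3 :: 'a) = of_nat d ^ 4 - 2 * of_nat d ^ 3 + of_nat d ^ 2"
    by (rule step[where f = "\<lambda>x. x ^ 4 - 2 * x ^ 3 + x ^ 2"], simp, Groebner_Basis.algebra)
  show "30 * (\<Sum>a\<in>{1..<d}. of_nat a ^ 4 :: 'a) = 6 * of_nat d ^ 5 - 15 * of_nat d ^ 4 + 10 * of_nat d ^ 3 - of_nat d"
    by (rule step[where f = "\<lambda>x. 6 * x ^ 5 - 15 * x ^ 4 + 10 * x ^ 3 - x"], simp, Groebner_Basis.algebra)
  show "12 * (\<Sum>a\<in>{1..<d}. of_nat a ^ 5 :: 'a) = 2 * of_nat d ^ 6 - 6 * of_nat d ^ 5 + 5 * of_nat d ^ 4 - of_nat d ^ 2"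
    by (rule step[where f = "\<lambda>x. 2 * x ^ 6 - 6 * x ^ 5 + 5 * x ^ 4 - x ^ 2"], simp, Groebner_Basis.algebra)
  show "42 * (\<Sum>a\<in>{1..<d}. of_nat a ^ 6 :: 'a) = 6 * of_nat d ^ 7 - 21 * of_nat d ^ 6 + 21 * of_nat d ^ 5 - 7 * of_nat d ^ 3 + of_nat d"
    by (rule step[where f = "\<lambda>x. 6 * x ^ 7 - 21 * x ^ 6 + 21 * x ^ 5 - 7 * x ^ 3 + x"], simp, Groebner_Basis.algebra)
qed

text \<open>The conditions on \<open>G\<close> express invariance under the swap and under replacing
  \<open>(a, b)\<close> by \<open>(a, a - b)\<close>; these generate a dihedral group of order 12.
  Its invariant of degree 2 is the norm form \<open>a^2 - a b + b^2\<close>, for which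
  \<open>G (a + b) b - G a b\<close> is \<open>2 a b\<close>.\<close>

lemma ramanujan_sum_1_1:
  fixes n :: nat
  assumes "n > 0"
  shows "12 * divisor_conv 1 1 n = (5 * divisor_sum 3 n - (6 * of_nat n - 1) * divisor_sum 1 n :: 'a::field_char_0)"
proof -
  define G where "G = (\<lambda>a b. (of_nat a ^ 2 - of_nat a * of_nat b + of_nat b ^ 2) :: 'a)"
  have hexagonal: "(\<Sum>(a, b, x, y)\<in>quads n. G (a + b) b - G a b) =
    (\<Sum>d | d dvd n. (\<Sum>a\<in>{1..<d}. G d a) - (of_nat n / of_nat d - 1) * G d d)"
    using assms by (rule sum_quads_hexagonal) (unfold G_def of_nat_add, Groebner_Basis.algebra+)
  have conv: "2 * divisor_conv 1 1 n = (\<Sum>(a, b, x, y)\<in>quads n. G (a + b) b - G a b)"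
    unfolding divisor_conv_quads sum_distrib_left sum.distrib[symmetric] G_def
    by (intro sum.cong refl) (clarsimp, Groebner_Basis.algebra)
  have "6 * (\<Sum>(a, b, x, y)\<in>quads n. G (a + b) b - G a b) =
     (\<Sum>d | d dvd n. 5 * of_nat d ^ 3 - (6 * of_nat n - 1) * of_nat d ^ 1)"
    unfolding hexagonal sum_distrib_left
  proof (rule sum.cong)
    fix d assume "d \<in> {d. d dvd n}"
    hence d: "d > 0" using assms by (auto intro: dvd_pos_nat)
    define D where "D = (of_nat d :: 'a)"
    have D: "D \<noteq> 0" using d by (simp add: D_def)
    have "(\<Sum>a\<in>{1..<d}. G d a) = (\<Sum>a\<in>{1..<d}. (D ^ 2) * of_nat a ^ 0 + (- D) * of_nat a ^ 1 + (1) * of_nat a ^ 2)"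
      unfolding G_def D_def by (intro sum.cong refl) Groebner_Basis.algebra
    also have "\<dots> = (D ^ 2) * (\<Sum>a\<in>{1..<d}. of_nat a ^ 0) + (- D) * (\<Sum>a\<in>{1..<d}. of_nat a ^ 1) + (1) * (\<Sum>a\<in>{1..<d}. of_nat a ^ 2)"
      by (simp only: sum.distrib sum_distrib_left)
    finally have "6 * (\<Sum>a\<in>{1..<d}. G d a) = 6 * (\<dots>)" by (rule arg_cong)
    also have "\<dots> = 6 * D ^ 2 * (1 * (\<Sum>a\<in>{1..<d}. of_nat a ^ 0)) + (- 3 * D) * (2 * (\<Sum>a\<in>{1..<d}. of_nat a ^ 1)) + 1 * (6 * (\<Sum>a\<in>{1..<d}. of_nat a ^ 2))"
      by Groebner_Basis.algebra
    also have "\<dots> = 5 * D ^ 3 - 6 * D ^ 2 + D"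
      unfolding power_sums[OF d] D_def[symmetric] by Groebner_Basis.algebra
    finally have *: "6 * (\<Sum>a\<in>{1..<d}. G d a) = 5 * D ^ 3 - 6 * D ^ 2 + D" .
    have G: "G d d = D ^ 2"
      unfolding G_def D_def by Groebner_Basis.algebra
    \<comment> \<open>Division by \<open>D\<close> lowers the exponent by one; this is the origin of
      the term with factor \<open>n\<close>.\<close>
    have Gdd: "of_nat n / D * G d d = of_nat n * (D ^ 1)"
      unfolding G using D by (simp add: eval_nat_numeral)
    have "6 * ((\<Sum>a\<in>{1..<d}. G d a) - (of_nat n / D - 1) * G d d) =
        6 * (\<Sum>a\<in>{1..<d}. G d a) - 6 * (of_nat n / D * G d d) + 6 * G d d"
      by (simp add: algebra_simps)
    hence "6 * ((\<Sum>a\<in>{1..<d}. G d a) - (of_nat n / D - 1) * G d d) = 5 * D ^ 3 - (6 * of_nat n - 1) * D ^ 1"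
      unfolding * Gdd unfolding G by (simp add: algebra_simps)
    thus "6 * ((\<Sum>a\<in>{1..<d}. G d a) - (of_nat n / of_nat d - 1) * G d d) = 5 * of_nat d ^ 3 - (6 * of_nat n - 1) * of_nat d ^ 1"
      by (simp add: D_def)
  qed simp
  also have "\<dots> = 5 * divisor_sum 3 n - (6 * of_nat n - 1) * divisor_sum 1 n"
    unfolding divisor_sum_def by (simp add: sum_subtractf sum.distrib sum_distrib_left)
  finally show ?thesis unfolding conv[symmetric] by (simp add: algebra_simps)
qed

text \<open>In degree 4 the only invariant is the square of the norm form; the difference is
  \<open>4 (a^3 b + a b^3)\<close>.\<close>

lemma ramanujan_sum_1_3:
  fixes n :: nat
  assumes "n > 0"
  shows "240 * divisor_conv 1 3 n = (21 * divisor_sum 5 n - (30 * of_nat n - 10) * divisor_sum 3 n - divisor_sum 1 n :: 'a::field_char_0)"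
proof -
  define G where "G = (\<lambda>a b. (of_nat a ^ 2 - of_nat a * of_nat b + of_nat b ^ 2) ^ 2 :: 'a)"
  have hexagonal: "(\<Sum>(a, b, x, y)\<in>quads n. G (a + b) b - G a b) =
    (\<Sum>d | d dvd n. (\<Sum>a\<in>{1..<d}. G d a) - (of_nat n / of_nat d - 1) * G d d)"
    using assms by (rule sum_quads_hexagonal) (unfold G_def of_nat_add, Groebner_Basis.algebra+)
  have conv: "4 * (divisor_conv 1 3 n + divisor_conv 3 1 n) = (\<Sum>(a, b, x, y)\<in>quads n. G (a + b) b - G a b)"
    unfolding divisor_conv_quads sum_distrib_left sum.distrib[symmetric] G_def
    by (intro sum.cong refl) (clarsimp, Groebner_Basis.algebra)
  have "30 * (\<Sum>(a, b, x, y)\<in>quads n. G (a + b) b - G a b) =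
     (\<Sum>d | d dvd n. 21 * of_nat d ^ 5 - (30 * of_nat n - 10) * of_nat d ^ 3 - of_nat d ^ 1)"
    unfolding hexagonal sum_distrib_left
  proof (rule sum.cong)
    fix d assume "d \<in> {d. d dvd n}"
    hence d: "d > 0" using assms by (auto intro: dvd_pos_nat)
    define D where "D = (of_nat d :: 'a)"
    have D: "D \<noteq> 0" using d by (simp add: D_def)
    have "(\<Sum>a\<in>{1..<d}. G d a) = (\<Sum>a\<in>{1..<d}. (D ^ 4) * of_nat a ^ 0 + (- 2 * D ^ 3) * of_nat a ^ 1 + (3 * D ^ 2) * of_nat a ^ 2 + (- 2 * D) * of_nat a ^ 3 + (1) * of_nat a ^ 4)"
      unfolding G_def D_def by (intro sum.cong refl) Groebner_Basis.algebra
    also have "\<dots> = (D ^ 4) * (\<Sum>a\<in>{1..<d}. of_nat a ^ 0) + (- 2 * D ^ 3) * (\<Sum>a\<in>{1..<d}. of_nat a ^ 1) + (3 * D ^ 2) * (\<Sum>a\<in>{1..<d}. of_nat a ^ 2) + (- 2 * D) * (\<Sum>a\<in>{1..<d}. of_nat a ^ 3) + (1) * (\<Sum>a\<in>{1..<d}. of_nat a ^ 4)"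
      by (simp only: sum.distrib sum_distrib_left)
    finally have "30 * (\<Sum>a\<in>{1..<d}. G d a) = 30 * (\<dots>)" by (rule arg_cong)
    also have "\<dots> = 30 * D ^ 4 * (1 * (\<Sum>a\<in>{1..<d}. of_nat a ^ 0)) + (- 30 * D ^ 3) * (2 * (\<Sum>a\<in>{1..<d}. of_nat a ^ 1)) + 15 * D ^ 2 * (6 * (\<Sum>a\<in>{1..<d}. of_nat a ^ 2)) + (- 15 * D) * (4 * (\<Sum>a\<in>{1..<d}. of_nat a ^ 3)) + 1 * (30 * (\<Sum>a\<in>{1..<d}. of_nat a ^ 4))"
      by Groebner_Basis.algebra
    also have "\<dots> = 21 * D ^ 5 - 30 * D ^ 4 + 10 * D ^ 3 - D"
      unfolding power_sums[OF d] D_def[symmetric] by Groebner_Basis.algebra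
    finally have *: "30 * (\<Sum>a\<in>{1..<d}. G d a) = 21 * D ^ 5 - 30 * D ^ 4 + 10 * D ^ 3 - D" .
    have G: "G d d = D ^ 4"
      unfolding G_def D_def by Groebner_Basis.algebra
    have Gdd: "of_nat n / D * G d d = of_nat n * (D ^ 3)"
      unfolding G using D by (simp add: eval_nat_numeral)
    have "30 * ((\<Sum>a\<in>{1..<d}. G d a) - (of_nat n / D - 1) * G d d) =
        30 * (\<Sum>a\<in>{1..<d}. G d a) - 30 * (of_nat n / D * G d d) + 30 * G d d"
      by (simp add: algebra_simps)
    hence "30 * ((\<Sum>a\<in>{1..<d}. G d a) - (of_nat n / D - 1) * G d d) = 21 * D ^ 5 - (30 * of_nat n - 10) * D ^ 3 - D ^ 1"
      unfolding * Gdd unfolding G by (simp add: algebra_simps)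
    thus "30 * ((\<Sum>a\<in>{1..<d}. G d a) - (of_nat n / of_nat d - 1) * G d d) = 21 * of_nat d ^ 5 - (30 * of_nat n - 10) * of_nat d ^ 3 - of_nat d ^ 1"
      by (simp add: D_def)
  qed simp
  also have "\<dots> = 21 * divisor_sum 5 n - (30 * of_nat n - 10) * divisor_sum 3 n - divisor_sum 1 n"
    unfolding divisor_sum_def by (simp add: sum_subtractf sum.distrib sum_distrib_left)
  finally show ?thesis unfolding conv[symmetric] divisor_conv_commute[of 3 1] by (simp add: algebra_simps)
qed

text \<open>The second generator of the invariants, of degree 6, has the difference
  \<open>4 a^3 b^3\<close>. It vanishes on the diagonal \<open>a = b\<close>, whence no term with
  factor \<open>n\<close> arises.\<close>

lemma ramanujan_sum_3_3:
  fixes n :: nat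
  assumes "n > 0"
  shows "120 * divisor_conv 3 3 n = (divisor_sum 7 n - divisor_sum 3 n :: 'a::field_char_0)"
proof -
  define G where "G = (\<lambda>a b. of_nat a ^ 2 * of_nat b ^ 2 * (of_nat a - of_nat b) ^ 2 :: 'a)"
  have hexagonal: "(\<Sum>(a, b, x, y)\<in>quads n. G (a + b) b - G a b) =
    (\<Sum>d | d dvd n. (\<Sum>a\<in>{1..<d}. G d a) - (of_nat n / of_nat d - 1) * G d d)"
    using assms by (rule sum_quads_hexagonal) (unfold G_def of_nat_add, Groebner_Basis.algebra+)
  have conv: "4 * divisor_conv 3 3 n = (\<Sum>(a, b, x, y)\<in>quads n. G (a + b) b - G a b)"
    unfolding divisor_conv_quads sum_distrib_left sum.distrib[symmetric] G_def
    by (intro sum.cong refl) (clarsimp, Groebner_Basis.algebra)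
  have "30 * (\<Sum>(a, b, x, y)\<in>quads n. G (a + b) b - G a b) =
     (\<Sum>d | d dvd n. of_nat d ^ 7 - of_nat d ^ 3)"
    unfolding hexagonal sum_distrib_left
  proof (rule sum.cong)
    fix d assume "d \<in> {d. d dvd n}"
    hence d: "d > 0" using assms by (auto intro: dvd_pos_nat)
    define D where "D = (of_nat d :: 'a)"
    have D: "D \<noteq> 0" using d by (simp add: D_def)
    have "(\<Sum>a\<in>{1..<d}. G d a) = (\<Sum>a\<in>{1..<d}. (D ^ 4) * of_nat a ^ 2 + (- 2 * D ^ 3) * of_nat a ^ 3 + (D ^ 2) * of_nat a ^ 4)"
      unfolding G_def D_def by (intro sum.cong refl) Groebner_Basis.algebra
    also have "\<dots> = (D ^ 4) * (\<Sum>a\<in>{1..<d}. of_nat a ^ 2) + (- 2 * D ^ 3) * (\<Sum>a\<in>{1..<d}. of_nat a ^ 3) + (D ^ 2) * (\<Sum>a\<in>{1..<d}. of_nat a ^ 4)"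
      by (simp only: sum.distrib sum_distrib_left)
    finally have "30 * (\<Sum>a\<in>{1..<d}. G d a) = 30 * (\<dots>)" by (rule arg_cong)
    also have "\<dots> = 5 * D ^ 4 * (6 * (\<Sum>a\<in>{1..<d}. of_nat a ^ 2)) + (- 15 * D ^ 3) * (4 * (\<Sum>a\<in>{1..<d}. of_nat a ^ 3)) + D ^ 2 * (30 * (\<Sum>a\<in>{1..<d}. of_nat a ^ 4))"
      by Groebner_Basis.algebra
    also have "\<dots> = D ^ 7 - D ^ 3"
      unfolding power_sums[OF d] D_def[symmetric] by Groebner_Basis.algebra
    finally have *: "30 * (\<Sum>a\<in>{1..<d}. G d a) = D ^ 7 - D ^ 3" .
    have G: "G d d = 0"
      by (simp add: G_def)
    have Gdd: "of_nat n / D * G d d = of_nat n * (0)"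
      unfolding G using D by (simp add: eval_nat_numeral)
    have "30 * ((\<Sum>a\<in>{1..<d}. G d a) - (of_nat n / D - 1) * G d d) =
        30 * (\<Sum>a\<in>{1..<d}. G d a) - 30 * (of_nat n / D * G d d) + 30 * G d d"
      by (simp add: algebra_simps)
    hence "30 * ((\<Sum>a\<in>{1..<d}. G d a) - (of_nat n / D - 1) * G d d) = D ^ 7 - D ^ 3"
      unfolding * Gdd unfolding G by (simp add: algebra_simps)
    thus "30 * ((\<Sum>a\<in>{1..<d}. G d a) - (of_nat n / of_nat d - 1) * G d d) = of_nat d ^ 7 - of_nat d ^ 3"
      by (simp add: D_def)
  qed simp
  also have "\<dots> = divisor_sum 7 n - divisor_sum 3 n"
    unfolding divisor_sum_def by (simp add: sum_subtractf sum.distrib sum_distrib_left)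
  finally show ?thesis unfolding conv[symmetric] by (simp add: algebra_simps)
qed

text \<open>The cube of the norm form has the difference
  \<open>6 (a^5 b + a b^5) + 14 a^3 b^3\<close>, so this convolution comes mixed with the one for
  the exponents 3 and 3.\<close>

lemma ramanujan_sum_1_5:
  fixes n :: nat
  assumes "n > 0"
  shows "504 * divisor_conv 1 5 n = (20 * divisor_sum 7 n - (42 * of_nat n - 21) * divisor_sum 5 n + divisor_sum 1 n :: 'a::field_char_0)"
proof -
  define G where "G = (\<lambda>a b. (of_nat a ^ 2 - of_nat a * of_nat b + of_nat b ^ 2) ^ 3 :: 'a)"
  have hexagonal: "(\<Sum>(a, b, x, y)\<in>quads n. G (a + b) b - G a b) =
    (\<Sum>d | d dvd n. (\<Sum>a\<in>{1..<d}. G d a) - (of_nat n / of_nat d - 1) * G d d)"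
    using assms by (rule sum_quads_hexagonal) (unfold G_def of_nat_add, Groebner_Basis.algebra+)
  have conv: "6 * (divisor_conv 1 5 n + divisor_conv 5 1 n) + 14 * divisor_conv 3 3 n = (\<Sum>(a, b, x, y)\<in>quads n. G (a + b) b - G a b)"
    unfolding divisor_conv_quads sum_distrib_left sum.distrib[symmetric] G_def
    by (intro sum.cong refl) (clarsimp, Groebner_Basis.algebra)
  have "420 * (\<Sum>(a, b, x, y)\<in>quads n. G (a + b) b - G a b) =
     (\<Sum>d | d dvd n. 249 * of_nat d ^ 7 - (420 * of_nat n - 210) * of_nat d ^ 5 - 49 * of_nat d ^ 3 + 10 * of_nat d ^ 1)"
    unfolding hexagonal sum_distrib_left
  proof (rule sum.cong)
    fix d assume "d \<in> {d. d dvd n}"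
    hence d: "d > 0" using assms by (auto intro: dvd_pos_nat)
    define D where "D = (of_nat d :: 'a)"
    have D: "D \<noteq> 0" using d by (simp add: D_def)
    have "(\<Sum>a\<in>{1..<d}. G d a) = (\<Sum>a\<in>{1..<d}. (D ^ 6) * of_nat a ^ 0 + (- 3 * D ^ 5) * of_nat a ^ 1 + (6 * D ^ 4) * of_nat a ^ 2 + (- 7 * D ^ 3) * of_nat a ^ 3 + (6 * D ^ 2) * of_nat a ^ 4 + (- 3 * D) * of_nat a ^ 5 + (1) * of_nat a ^ 6)"
      unfolding G_def D_def by (intro sum.cong refl) Groebner_Basis.algebra
    also have "\<dots> = (D ^ 6) * (\<Sum>a\<in>{1..<d}. of_nat a ^ 0) + (- 3 * D ^ 5) * (\<Sum>a\<in>{1..<d}. of_nat a ^ 1) + (6 * D ^ 4) * (\<Sum>a\<in>{1..<d}. of_nat a ^ 2) + (- 7 * D ^ 3) * (\<Sum>a\<in>{1..<d}. of_nat a ^ 3) + (6 * D ^ 2) * (\<Sum>a\<in>{1..<d}. of_nat a ^ 4) + (- 3 * D) * (\<Sum>a\<in>{1..<d}. of_nat a ^ 5) + (1) * (\<Sum>a\<in>{1..<d}. of_nat a ^ 6)"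
      by (simp only: sum.distrib sum_distrib_left)
    finally have "420 * (\<Sum>a\<in>{1..<d}. G d a) = 420 * (\<dots>)" by (rule arg_cong)
    also have "\<dots> = 420 * D ^ 6 * (1 * (\<Sum>a\<in>{1..<d}. of_nat a ^ 0)) + (- 630 * D ^ 5) * (2 * (\<Sum>a\<in>{1..<d}. of_nat a ^ 1)) + 420 * D ^ 4 * (6 * (\<Sum>a\<in>{1..<d}. of_nat a ^ 2)) + (- 735 * D ^ 3) * (4 * (\<Sum>a\<in>{1..<d}. of_nat a ^ 3)) + 84 * D ^ 2 * (30 * (\<Sum>a\<in>{1..<d}. of_nat a ^ 4)) + (- 105 * D) * (12 * (\<Sum>a\<in>{1..<d}. of_nat a ^ 5)) + 10 * (42 * (\<Sum>a\<in>{1..<d}. of_nat a ^ 6))"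
      by Groebner_Basis.algebra
    also have "\<dots> = 249 * D ^ 7 - 420 * D ^ 6 + 210 * D ^ 5 - 49 * D ^ 3 + 10 * D"
      unfolding power_sums[OF d] D_def[symmetric] by (simp add: algebra_simps eval_nat_numeral)
    finally have *: "420 * (\<Sum>a\<in>{1..<d}. G d a) = 249 * D ^ 7 - 420 * D ^ 6 + 210 * D ^ 5 - 49 * D ^ 3 + 10 * D" .
    have G: "G d d = D ^ 6"
      unfolding G_def D_def by Groebner_Basis.algebra
    have Gdd: "of_nat n / D * G d d = of_nat n * (D ^ 5)"
      unfolding G using D by (simp add: eval_nat_numeral)
    have "420 * ((\<Sum>a\<in>{1..<d}. G d a) - (of_nat n / D - 1) * G d d) =
        420 * (\<Sum>a\<in>{1..<d}. G d a) - 420 * (of_nat n / D * G d d) + 420 * G d d"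
      by (simp add: algebra_simps)
    hence "420 * ((\<Sum>a\<in>{1..<d}. G d a) - (of_nat n / D - 1) * G d d) = 249 * D ^ 7 - (420 * of_nat n - 210) * D ^ 5 - 49 * D ^ 3 + 10 * D ^ 1"
      unfolding * Gdd unfolding G by (simp add: algebra_simps)
    thus "420 * ((\<Sum>a\<in>{1..<d}. G d a) - (of_nat n / of_nat d - 1) * G d d) = 249 * of_nat d ^ 7 - (420 * of_nat n - 210) * of_nat d ^ 5 - 49 * of_nat d ^ 3 + 10 * of_nat d ^ 1"
      by (simp add: D_def)
  qed simp
  also have "\<dots> = 249 * divisor_sum 7 n - (420 * of_nat n - 210) * divisor_sum 5 n - 49 * divisor_sum 3 n + 10 * divisor_sum 1 n"
    unfolding divisor_sum_def by (simp add: sum_subtractf sum.distrib sum_distrib_left)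
  finally have 1: "420 * (6 * (divisor_conv 1 5 n + divisor_conv 5 1 n) + 14 * divisor_conv 3 3 n) =
    (249 * divisor_sum 7 n - (420 * of_nat n - 210) * divisor_sum 5 n - 49 * divisor_sum 3 n + 10 * divisor_sum 1 n :: 'a)"
    unfolding conv .
  \<comment> \<open>As \<open>420 * 12 = 10 * 504\<close> and \<open>420 * 14 = 49 * 120\<close>,
    subtracting 49 times \<open>ramanujan_sum_3_3\<close> removes the mixed term.\<close>
  have "10 * (504 * divisor_conv 1 5 n) =
      420 * (6 * (divisor_conv 1 5 n + divisor_conv 5 1 n) + 14 * divisor_conv 3 3 n) - 49 * (120 * divisor_conv 3 3 n :: 'a)"
    unfolding divisor_conv_commute[of 5 1] by Groebner_Basis.algebra
  also have "\<dots> = 10 * (20 * divisor_sum 7 n - (42 * of_nat n - 21) * divisor_sum 5 n + divisor_sum 1 n)"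
    unfolding 1 ramanujan_sum_3_3[OF assms] by Groebner_Basis.algebra
  finally show ?thesis by (subst (asm) mult_left_cancel) simp_all
qed

section \<open>Ramanujan's differential equations\<close>

definition fps_theta :: "'a::comm_ring_1 fps \<Rightarrow> 'a fps" where
  "fps_theta f = fps_X * fps_deriv f"

lemma fps_theta_nth [simp]: "fps_nth (fps_theta f) n = of_nat n * fps_nth f n"
  by (cases n) (simp_all add: fps_theta_def)

lemma fps_theta_add [simp]: "fps_theta (f + g) = fps_theta f + fps_theta g"
  and fps_theta_diff [simp]: "fps_theta (f - g) = fps_theta f - fps_theta g"
  and fps_theta_mult: "fps_theta (f * g) = fps_theta f * g + f * fps_theta g"
  and fps_theta_const [simp]: "fps_theta (fps_const c) = 0"
  and fps_theta_1 [simp]: "fps_theta 1 = 0"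
  and fps_theta_numeral [simp]: "fps_theta (numeral k) = 0"
  by (simp_all add: fps_theta_def algebra_simps)

lemma fps_theta_power: "fps_theta (f ^ n) = of_nat n * f ^ (n - 1) * fps_theta f"
  by (simp add: fps_theta_def fps_deriv_power fps_of_nat algebra_simps)

text \<open>Quasimodular: it completes \<open>E4\<close> and \<open>E6\<close> to a ring closed
  under \<open>fps_theta\<close>.\<close>

definition eisenstein_E2 :: "'a::field_char_0 fps" where
  "eisenstein_E2 = Abs_fps (\<lambda>n. if n = 0 then 1 else - 24 * divisor_sum 1 n)"

lemma eisenstein_nth_0 [simp]:
  "fps_nth (eisenstein_E2 :: 'a::field_char_0 fps) 0 = 1"
  "fps_nth (eisenstein_E4 :: 'a fps) 0 = 1" "fps_nth (eisenstein_E6 :: 'a fps) 0 = 1"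
  by (simp_all add: eisenstein_E2_def eisenstein_E4_def eisenstein_E6_def)

lemma eisenstein_nth:
  assumes "n > 0"
  shows "fps_nth eisenstein_E2 n = - 24 * divisor_sum 1 n"
    and "fps_nth eisenstein_E4 n = 240 * divisor_sum 3 n"
    and "fps_nth eisenstein_E6 n = - 504 * divisor_sum 5 n"
  using assms by (simp_all add: eisenstein_E2_def eisenstein_E4_def eisenstein_E6_def divisor_sum_def)

text \<open>The two end terms of the Cauchy product meet a constant term 1 and yield the divisor
  sums; the inner terms form the convolution.\<close>

lemma fps_mult_divisor_sums_nth:
  fixes f g :: "'a::field_char_0 fps"
  assumes "fps_nth f 0 = 1" "fps_nth g 0 = 1" "n > 0"
    and "\<And>k. k > 0 \<Longrightarrow> fps_nth f k = \<alpha> * divisor_sum i k"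
    and "\<And>k. k > 0 \<Longrightarrow> fps_nth g k = \<beta> * divisor_sum j k"
  shows "fps_nth (f * g) n = \<alpha> * divisor_sum i n + \<beta> * divisor_sum j n + \<alpha> * \<beta> * divisor_conv i j n"
proof -
  have "fps_nth (f * g) n = (\<Sum>k\<in>insert 0 (insert n {1..<n}). fps_nth f k * fps_nth g (n - k))"
    unfolding fps_mult_nth using assms(3) by (intro sum.cong) auto
  also have "\<dots> = fps_nth g n + (fps_nth f n + (\<Sum>k\<in>{1..<n}. fps_nth f k * fps_nth g (n - k)))"
    using assms(1-3) by (subst sum.insert; simp)+
  also have "(\<Sum>k\<in>{1..<n}. fps_nth f k * fps_nth g (n - k)) = \<alpha> * \<beta> * divisor_conv i j n"
    unfolding divisor_conv_def sum_distrib_left by (intro sum.cong) (simp_all add: assms)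
  finally show ?thesis using assms(3-5) by simp
qed

lemma ramanujan_E2: "12 * fps_theta eisenstein_E2 = (eisenstein_E2 ^ 2 - eisenstein_E4 :: 'a::field_char_0 fps)"
proof (rule fps_ext)
  fix n :: nat
  show "fps_nth (12 * fps_theta eisenstein_E2) n = fps_nth (eisenstein_E2 ^ 2 - eisenstein_E4 :: 'a fps) n"
  proof (cases "n = 0")
    case False
    hence n: "n > 0" by simp
    have "fps_nth (eisenstein_E2 ^ 2 :: 'a fps) n =
        -24 * divisor_sum 1 n + -24 * divisor_sum 1 n + -24 * -24 * divisor_conv 1 1 n"
      unfolding power2_eq_square by (rule fps_mult_divisor_sums_nth) (use n in \<open>simp_all add: eisenstein_nth\<close>)
    also have "\<dots> = -24 * divisor_sum 1 n + -24 * divisor_sum 1 n + 48 * (12 * divisor_conv 1 1 n)"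
      by simp
    finally show ?thesis
      unfolding ramanujan_sum_1_1[OF n] using n
      by (simp add: eisenstein_nth numeral_fps_const algebra_simps)
  qed (simp add: power2_eq_square numeral_fps_const)
qed

lemma ramanujan_E4: "3 * fps_theta eisenstein_E4 = (eisenstein_E2 * eisenstein_E4 - eisenstein_E6 :: 'a::field_char_0 fps)"
proof (rule fps_ext)
  fix n :: nat
  show "fps_nth (3 * fps_theta eisenstein_E4) n = fps_nth (eisenstein_E2 * eisenstein_E4 - eisenstein_E6 :: 'a fps) n"
  proof (cases "n = 0")
    case False
    hence n: "n > 0" by simp
    have "fps_nth (eisenstein_E2 * eisenstein_E4 :: 'a fps) n =
        -24 * divisor_sum 1 n + 240 * divisor_sum 3 n + -24 * 240 * divisor_conv 1 3 n"
      by (rule fps_mult_divisor_sums_nth) (use n in \<open>simp_all add: eisenstein_nth\<close>)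
    also have "\<dots> = -24 * divisor_sum 1 n + 240 * divisor_sum 3 n - 24 * (240 * divisor_conv 1 3 n)"
      by simp
    finally show ?thesis
      unfolding ramanujan_sum_1_3[OF n] using n
      by (simp add: eisenstein_nth numeral_fps_const algebra_simps)
  qed (simp add: numeral_fps_const)
qed

text \<open>Both products contain \<open>divisor_sum 7\<close> with coefficient 480; it cancels in
  the difference, so no series of weight 8 appears.\<close>

lemma ramanujan_E6: "2 * fps_theta eisenstein_E6 = (eisenstein_E2 * eisenstein_E6 - eisenstein_E4 ^ 2 :: 'a::field_char_0 fps)"
proof (rule fps_ext)
  fix n :: nat
  show "fps_nth (2 * fps_theta eisenstein_E6) n = fps_nth (eisenstein_E2 * eisenstein_E6 - eisenstein_E4 ^ 2 :: 'a fps) n"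
  proof (cases "n = 0")
    case False
    hence n: "n > 0" by simp
    have "fps_nth (eisenstein_E2 * eisenstein_E6 :: 'a fps) n =
        -24 * divisor_sum 1 n + -504 * divisor_sum 5 n + -24 * -504 * divisor_conv 1 5 n"
      by (rule fps_mult_divisor_sums_nth) (use n in \<open>simp_all add: eisenstein_nth\<close>)
    also have "\<dots> = -24 * divisor_sum 1 n + -504 * divisor_sum 5 n + 24 * (504 * divisor_conv 1 5 n)"
      by simp
    finally have 1: "fps_nth (eisenstein_E2 * eisenstein_E6 :: 'a fps) n = \<dots>" .
    have "fps_nth (eisenstein_E4 ^ 2 :: 'a fps) n =
        240 * divisor_sum 3 n + 240 * divisor_sum 3 n + 240 * 240 * divisor_conv 3 3 n"
      unfolding power2_eq_square by (rule fps_mult_divisor_sums_nth) (use n in \<open>simp_all add: eisenstein_nth\<close>)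
    also have "\<dots> = 240 * divisor_sum 3 n + 240 * divisor_sum 3 n + 480 * (120 * divisor_conv 3 3 n)"
      by simp
    finally show ?thesis
      unfolding fps_sub_nth 1 ramanujan_sum_1_5[OF n] ramanujan_sum_3_3[OF n] using n
      by (simp add: eisenstein_nth numeral_fps_const algebra_simps)
  qed (simp add: power2_eq_square numeral_fps_const)
qed

section \<open>The hypergeometric equation\<close>

text \<open>The series \<open>t = 1 / j\<close>, written without \<open>modular_j\<close> so that it
  is a power series; its constant term is zero, so it can be substituted into others.\<close>

definition hauptmodul :: "'a::field_char_0 fps" where
  "hauptmodul = modular_discriminant * inverse (eisenstein_E4 ^ 3)"

text \<open>The derivation \<open>t d/dt\<close> carried over to series in \<open>q\<close>, because
  \<open>t\<close> has logarithmic derivative \<open>E6 / E4\<close>.\<close>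

definition hauptmodul_deriv :: "'a::field_char_0 fps \<Rightarrow> 'a fps" where
  "hauptmodul_deriv f = eisenstein_E4 * inverse eisenstein_E6 * fps_theta f"

lemma inverse_eisenstein [simp]:
  "inverse eisenstein_E4 * eisenstein_E4 = (1 :: 'a::field_char_0 fps)"
  "inverse eisenstein_E6 * eisenstein_E6 = (1 :: 'a::field_char_0 fps)"
  by (simp_all add: inverse_mult_eq_1)

lemma inverse_eisenstein' [simp]:
  "eisenstein_E4 * inverse eisenstein_E4 = (1 :: 'a::field_char_0 fps)"
  "eisenstein_E6 * inverse eisenstein_E6 = (1 :: 'a::field_char_0 fps)"
  by (simp_all add: inverse_mult_eq_1')

lemma discriminant_eq: "1728 * modular_discriminant = (eisenstein_E4 ^ 3 - eisenstein_E6 ^ 2 :: 'a::field_char_0 fps)"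
proof -
  have "fps_const 1728 * fps_const (1 / 1728 :: 'a) = 1" by (subst fps_const_mult) simp
  thus ?thesis unfolding modular_discriminant_def mult.assoc[symmetric] numeral_fps_const by simp
qed

text \<open>In the derivative of \<open>E4^3 - E6^2\<close> the two terms \<open>E4^2 E6\<close>
  cancel, which leaves \<open>E2\<close> as a common factor.\<close>

lemma theta_discriminant: "fps_theta modular_discriminant = (eisenstein_E2 * modular_discriminant :: 'a::field_char_0 fps)"
proof -
  have "1728 * fps_theta modular_discriminant = fps_theta (1728 * modular_discriminant :: 'a fps)"
    by (simp add: fps_theta_mult)
  also have "\<dots> = eisenstein_E4 ^ 2 * (3 * fps_theta eisenstein_E4) - eisenstein_E6 * (2 * fps_theta eisenstein_E6)"
    unfolding discriminant_eq by (simp add: fps_theta_power algebra_simps)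
  also have "\<dots> = 1728 * (eisenstein_E2 * modular_discriminant)"
    unfolding ramanujan_E4 ramanujan_E6 mult.left_commute[of 1728] discriminant_eq
    by (simp add: algebra_simps power2_eq_square power3_eq_cube)
  finally show ?thesis by simp
qed

lemma hauptmodul_eq: "hauptmodul * eisenstein_E4 ^ 3 = (modular_discriminant :: 'a::field_char_0 fps)"
  unfolding hauptmodul_def mult.assoc by (subst inverse_mult_eq_1) simp_all

text \<open>The logarithmic derivative of \<open>\<Delta> / E4^3\<close> is
  \<open>E2 - (E2 - E6 / E4)\<close>: the quasimodular part cancels.\<close>

lemma theta_hauptmodul: "eisenstein_E4 * fps_theta hauptmodul = (eisenstein_E6 * hauptmodul :: 'a::field_char_0 fps)"
proof -
  define t where "t = (hauptmodul :: 'a fps)"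
  have 1: "fps_theta t * eisenstein_E4 ^ 3 + t * (eisenstein_E4 ^ 2 * (3 * fps_theta eisenstein_E4)) =
        eisenstein_E2 * (t * eisenstein_E4 ^ 3)"
  proof -
    have "fps_theta (t * eisenstein_E4 ^ 3) = eisenstein_E2 * (t * eisenstein_E4 ^ 3)"
      unfolding t_def hauptmodul_eq by (rule theta_discriminant)
    thus ?thesis by (simp add: fps_theta_mult fps_theta_power mult_ac)
  qed
  have "eisenstein_E4 ^ 2 * (eisenstein_E4 * fps_theta t) = eisenstein_E4 ^ 2 * (eisenstein_E6 * t)"
    using 1 unfolding ramanujan_E4 by (simp add: algebra_simps power2_eq_square power3_eq_cube)
  thus ?thesis by (simp add: eisenstein_E4_nonzero t_def)
qed

lemma hauptmodul_1728: "(1 - 1728 * hauptmodul) * eisenstein_E4 ^ 3 = (eisenstein_E6 ^ 2 :: 'a::field_char_0 fps)"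
  unfolding left_diff_distrib mult.assoc hauptmodul_eq discriminant_eq by simp

lemma hauptmodul_nth [simp]:
  "fps_nth (hauptmodul :: 'a::field_char_0 fps) 0 = 0"
  "fps_nth (hauptmodul :: 'a fps) (Suc 0) = 1"
proof -
  have "fps_nth (hauptmodul * eisenstein_E4 ^ 3) 0 = (0::'a)"
    unfolding hauptmodul_eq by (rule modular_discriminant_nth)
  thus 0: "fps_nth hauptmodul 0 = (0::'a)" by simp
  have "fps_nth (hauptmodul * eisenstein_E4 ^ 3) 1 = (1::'a)"
    unfolding hauptmodul_eq by (rule modular_discriminant_nth)
  thus "fps_nth hauptmodul (Suc 0) = (1::'a)" using 0 by (simp add: fps_mult_nth fps_power_zeroth)
qed

lemma hauptmodul_deriv_add [simp]: "hauptmodul_deriv (f + g) = hauptmodul_deriv f + hauptmodul_deriv g"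
  and hauptmodul_deriv_diff [simp]: "hauptmodul_deriv (f - g) = hauptmodul_deriv f - hauptmodul_deriv g"
  and hauptmodul_deriv_mult: "hauptmodul_deriv (f * g) = hauptmodul_deriv f * g + f * hauptmodul_deriv g"
  and hauptmodul_deriv_const [simp]: "hauptmodul_deriv 1 = 0" "hauptmodul_deriv (numeral k) = 0"
  by (simp_all add: hauptmodul_deriv_def fps_theta_mult algebra_simps)

lemma hauptmodul_deriv_numeral_mult [simp]: "hauptmodul_deriv (numeral k * f) = numeral k * hauptmodul_deriv f"
  by (simp add: hauptmodul_deriv_mult)

lemma hauptmodul_deriv_hauptmodul: "hauptmodul_deriv hauptmodul = (hauptmodul :: 'a::field_char_0 fps)"
proof -
  have "hauptmodul_deriv hauptmodul = inverse eisenstein_E6 * (eisenstein_E4 * fps_theta hauptmodul :: 'a fps)"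
    by (simp add: hauptmodul_deriv_def mult_ac)
  also have "\<dots> = inverse eisenstein_E6 * eisenstein_E6 * hauptmodul"
    unfolding theta_hauptmodul by (simp only: mult.assoc)
  finally show ?thesis by simp
qed

lemma hauptmodul_deriv_compose:
  "hauptmodul_deriv (f oo hauptmodul) = fps_theta f oo (hauptmodul :: 'a::field_char_0 fps)"
proof -
  let ?t = "hauptmodul :: 'a fps"
  have "hauptmodul_deriv (f oo ?t) = (fps_deriv f oo ?t) * hauptmodul_deriv ?t"
    by (simp add: hauptmodul_deriv_def fps_theta_def fps_compose_deriv mult_ac)
  also have "\<dots> = (fps_X * fps_deriv f) oo ?t"
    by (simp add: hauptmodul_deriv_hauptmodul fps_compose_mult_distrib mult_ac)
  finally show ?thesis by (simp add: fps_theta_def)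
qed

definition eisenstein_ratio :: "'a::field_char_0 fps" where
  "eisenstein_ratio = eisenstein_E4 ^ 3 * inverse eisenstein_E6 ^ 2"

lemma eisenstein_ratio_eq: "eisenstein_ratio * (1 - 1728 * hauptmodul) = (1 :: 'a::field_char_0 fps)"
proof -
  have "eisenstein_ratio * (1 - 1728 * hauptmodul) =
      inverse eisenstein_E6 ^ 2 * ((1 - 1728 * hauptmodul) * eisenstein_E4 ^ 3 :: 'a fps)"
    by (simp add: eisenstein_ratio_def mult_ac)
  thus ?thesis unfolding hauptmodul_1728 by (simp flip: power_mult_distrib)
qed

text \<open>Differentiate \<open>r * s = 1\<close> with \<open>s = 1 - 1728 t\<close>, which
  \<open>t d/dt\<close> sends to \<open>s - 1\<close>.\<close>

lemma hauptmodul_deriv_ratio: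
  "hauptmodul_deriv eisenstein_ratio = (eisenstein_ratio ^ 2 - eisenstein_ratio :: 'a::field_char_0 fps)"
proof -
  define r where "r = (eisenstein_ratio :: 'a fps)"
  define s where "s = (1 - 1728 * hauptmodul :: 'a fps)"
  have rs: "r * s = 1" using eisenstein_ratio_eq by (simp add: r_def s_def)
  have ds: "hauptmodul_deriv s = s - 1" by (simp add: s_def hauptmodul_deriv_hauptmodul)
  have "hauptmodul_deriv (r * s) = 0" unfolding rs by simp
  hence 1: "hauptmodul_deriv r * s + r * (s - 1) = 0" by (simp add: hauptmodul_deriv_mult ds)
  have "hauptmodul_deriv r = hauptmodul_deriv r * (r * s)" unfolding rs by simp
  also have "\<dots> = r * (hauptmodul_deriv r * s + r * (s - 1)) + r ^ 2 - r * (r * s)"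
    by (simp add: algebra_simps power2_eq_square)
  also have "\<dots> = r ^ 2 - r" unfolding 1 rs by simp
  finally have "hauptmodul_deriv r = r ^ 2 - r" .
  thus ?thesis by (simp add: r_def)
qed

text \<open>Up to an affine change, the logarithmic derivative of \<open>w = sqrt E4\<close>: it
  equals \<open>1 + 6 (D w) / w\<close> with \<open>D = t d/dt\<close>.\<close>

definition eisenstein_u :: "'a::field_char_0 fps" where
  "eisenstein_u = eisenstein_E2 * eisenstein_E4 * inverse eisenstein_E6"

text \<open>A Riccati equation. Together with \<open>hauptmodul_deriv_ratio\<close> it shows that
  the polynomials in \<open>u\<close> and \<open>r\<close> over the rationals are closed under
  \<open>t d/dt\<close>.\<close>

lemma hauptmodul_deriv_u:
  "12 * hauptmodul_deriv eisenstein_u =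
    (6 * eisenstein_u - 1) * eisenstein_ratio - eisenstein_u ^ 2 - 4 * (eisenstein_u :: 'a::field_char_0 fps)"
proof -
  define P Q R i where defs: "P = (eisenstein_E2 :: 'a fps)" "Q = (eisenstein_E4 :: 'a fps)"
    "R = (eisenstein_E6 :: 'a fps)" "i = inverse R"
  have iR: "i * R = 1" by (simp add: defs)
  have "fps_theta (i * R) = 0" unfolding iR by simp
  hence 0: "fps_theta i * R + i * fps_theta R = 0" by (simp add: fps_theta_mult)
  have "fps_theta i = fps_theta i * (i * R)" unfolding iR by simp
  also have "\<dots> = i * (fps_theta i * R + i * fps_theta R) - i ^ 2 * fps_theta R"
    by (simp add: algebra_simps power2_eq_square)
  also have "\<dots> = - (i ^ 2) * fps_theta R" unfolding 0 by simp
  finally have di: "fps_theta i = - (i ^ 2) * fps_theta R" .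
  have "12 * (Q * i * (fps_theta P * Q * i + P * fps_theta Q * i + P * Q * fps_theta i)) =
      Q * i * ((12 * fps_theta P) * Q * i + 4 * P * (3 * fps_theta Q) * i - 6 * P * Q * i ^ 2 * (2 * fps_theta R))"
    unfolding di by Groebner_Basis.algebra
  also have "\<dots> = Q * i * ((P ^ 2 - Q) * Q * i + 4 * P * (P * Q - R) * i - 6 * P * Q * i ^ 2 * (P * R - Q ^ 2))"
    unfolding defs ramanujan_E2 ramanujan_E4 ramanujan_E6 ..
  \<comment> \<open>Every surplus \<open>R\<close> is grouped with an \<open>i\<close>, so that the
    next step can use \<open>i * R = 1\<close>.\<close>
  also have "\<dots> = (6 * (P * Q * i) - 1) * (Q ^ 3 * i ^ 2) + 5 * (P * Q * i) ^ 2
      - 4 * (P * Q * i) * (i * R) - 6 * (P * Q * i) ^ 2 * (i * R)"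
    by Groebner_Basis.algebra
  also have "\<dots> = (6 * (P * Q * i) - 1) * (Q ^ 3 * i ^ 2) - (P * Q * i) ^ 2 - 4 * (P * Q * i)"
    unfolding iR by Groebner_Basis.algebra
  finally show ?thesis
    by (simp add: hauptmodul_deriv_def eisenstein_u_def eisenstein_ratio_def fps_theta_mult defs algebra_simps)
qed

text \<open>The first argument of \<open>fps_radical\<close> supplies a root of the constant term;
  the constant function 1 selects the branch with constant term 1.\<close>

definition eisenstein_E4_sqrt :: "'a::field_char_0 fps" where
  "eisenstein_E4_sqrt = fps_radical (\<lambda>_ _. 1) 2 eisenstein_E4"

lemma eisenstein_E4_sqrt_power: "eisenstein_E4_sqrt ^ 2 = (eisenstein_E4 :: 'a::field_char_0 fps)"
  unfolding eisenstein_E4_sqrt_def numeral_2_eq_2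
  by (subst power_radical[symmetric]) simp_all

lemma eisenstein_E4_sqrt_nth_0 [simp]: "fps_nth (eisenstein_E4_sqrt :: 'a::field_char_0 fps) 0 = 1"
  by (simp add: eisenstein_E4_sqrt_def fps_radical_def numeral_2_eq_2)

text \<open>Differentiate \<open>w^2 = E4\<close>, insert Ramanujan's equation for \<open>E4\<close>
  and cancel \<open>w\<close>.\<close>

lemma hauptmodul_deriv_E4_sqrt:
  "6 * hauptmodul_deriv eisenstein_E4_sqrt = eisenstein_E4_sqrt * (eisenstein_u - 1 :: 'a::field_char_0 fps)"
proof -
  define w where "w = (eisenstein_E4_sqrt :: 'a fps)"
  have w0: "w \<noteq> 0" using eisenstein_E4_sqrt_nth_0[where 'a='a] unfolding w_def by (metis fps_zero_nth zero_neq_one)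
  have "w * (6 * hauptmodul_deriv w) = 3 * hauptmodul_deriv (w ^ 2)"
    unfolding power2_eq_square hauptmodul_deriv_mult by simp
  also have "\<dots> = eisenstein_E4 * inverse eisenstein_E6 * (3 * fps_theta eisenstein_E4)"
    unfolding w_def eisenstein_E4_sqrt_power by (simp add: hauptmodul_deriv_def)
  also have "\<dots> = eisenstein_E4 * (eisenstein_u - inverse eisenstein_E6 * eisenstein_E6)"
    unfolding ramanujan_E4 eisenstein_u_def by (simp only: algebra_simps)
  also have "\<dots> = w * (w * (eisenstein_u - 1))"
    unfolding eisenstein_E4_sqrt_power[symmetric] w_def by (simp add: power2_eq_square)
  finally show ?thesis using w0 by (simp add: w_def)
qed

text \<open>The operator of the differential equation of \<open>3F2(1/6, 1/2, 5/6; 1, 1; 1728 t)\<close>, written with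
  \<open>D = t d/dt\<close> (which is \<^term>\<open>hauptmodul_deriv\<close> in terms of \<open>q\<close>) and normalised by the substitution
  \<open>eisenstein_ratio = 1 / (1 - 1728 t)\<close>, so that its coefficients are polynomial.\<close>

definition hypergeometric_op :: "'a::field_char_0 fps \<Rightarrow> 'a fps" where
  "hypergeometric_op f = 72 * hauptmodul_deriv (hauptmodul_deriv (hauptmodul_deriv f)) -
     (eisenstein_ratio - 1) * (108 * hauptmodul_deriv (hauptmodul_deriv f) + 46 * hauptmodul_deriv f + 5 * f)"

text \<open>Each derivative of \<open>w\<close> is \<open>w\<close> times a polynomial in
  \<open>u\<close> and its derivatives, and the Riccati equation expresses those through
  \<open>u\<close> and \<open>r\<close>. What remains is an identity of polynomials in two
  variables.\<close>

lemma hypergeometric_op_E4_sqrt: "hypergeometric_op eisenstein_E4_sqrt = (0 :: 'a::field_char_0 fps)"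
proof -
  define w u r where defs: "w = (eisenstein_E4_sqrt :: 'a fps)" "u = (eisenstein_u :: 'a fps)"
    "r = (eisenstein_ratio :: 'a fps)"
  define w1 w2 w3 where wdefs: "w1 = hauptmodul_deriv w" "w2 = hauptmodul_deriv w1" "w3 = hauptmodul_deriv w2"
  define u1 u2 where udefs: "u1 = hauptmodul_deriv u" "u2 = hauptmodul_deriv u1"
  have r1: "hauptmodul_deriv r = r ^ 2 - r" unfolding defs by (rule hauptmodul_deriv_ratio)
  have u1: "12 * u1 = (6 * u - 1) * r - u ^ 2 - 4 * u"
    unfolding defs udefs by (rule hauptmodul_deriv_u)
  have u2: "12 * u2 = 6 * u1 * r + (6 * u - 1) * (r ^ 2 - r) - 2 * u * u1 - 4 * u1"
    using arg_cong[OF u1, of hauptmodul_deriv]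
    by (simp add: hauptmodul_deriv_mult r1 udefs[symmetric] power2_eq_square)
  have w1: "6 * w1 = w * (u - 1)"
    unfolding defs wdefs by (rule hauptmodul_deriv_E4_sqrt)
  have w2: "6 * w2 = w1 * (u - 1) + w * u1"
    using arg_cong[OF w1, of hauptmodul_deriv] by (simp add: hauptmodul_deriv_mult wdefs udefs)
  have w3: "6 * w3 = w2 * (u - 1) + 2 * w1 * u1 + w * u2"
    using arg_cong[OF w2, of hauptmodul_deriv] by (simp add: hauptmodul_deriv_mult wdefs udefs algebra_simps)
  have w2': "36 * w2 = w * ((u - 1) ^ 2 + 6 * u1)"
  proof -
    have "36 * w2 = 6 * (6 * w2)" by simp
    also have "\<dots> = (6 * w1) * (u - 1) + 6 * w * u1" unfolding w2 by Groebner_Basis.algebra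
    also have "\<dots> = w * ((u - 1) ^ 2 + 6 * u1)" unfolding w1 by Groebner_Basis.algebra
    finally show ?thesis .
  qed
  have w3': "216 * w3 = w * ((u - 1) ^ 3 + 18 * (u - 1) * u1 + 36 * u2)"
  proof -
    have "216 * w3 = 36 * (6 * w3)" by simp
    also have "\<dots> = (36 * w2) * (u - 1) + 12 * (6 * w1) * u1 + 36 * w * u2" unfolding w3 by Groebner_Basis.algebra
    also have "\<dots> = w * ((u - 1) ^ 3 + 18 * (u - 1) * u1 + 36 * u2)" unfolding w1 w2' by Groebner_Basis.algebra
    finally show ?thesis .
  qed
  define E where "E = 72 * w3 - (r - 1) * (108 * w2 + 46 * w1 + 5 * w)"
  \<comment> \<open>The factor 216 makes the derivatives occur as \<open>216 * w3\<close>,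
    \<open>36 * w2\<close> and \<open>6 * w1\<close>, for which closed forms are at hand.\<close>
  have "36 * 6 * E =
    72 * (216 * w3) - (r - 1) * (648 * (36 * w2) + 1656 * (6 * w1) + 1080 * w)"
    unfolding E_def by Groebner_Basis.algebra
  also have "\<dots> = w * (72 * (u - 1) ^ 3 + 108 * (u - 1) * (12 * u1) + 216 * (12 * u2) -
      (r - 1) * (648 * (u - 1) ^ 2 + 324 * (12 * u1) + 1656 * (u - 1) + 1080))"
    unfolding w1 w2' w3' by Groebner_Basis.algebra
  \<comment> \<open>After elimination of \<open>u2\<close>, \<open>u1\<close> occurs only as
    \<open>12 * u1\<close>, the left-hand side of its Riccati equation.\<close>
  also have "\<dots> = w * (72 * (u - 1) ^ 3 + 108 * (u - 1) * (12 * u1) + 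
      18 * (6 * r * (12 * u1) + 12 * (6 * u - 1) * (r ^ 2 - r) - 2 * u * (12 * u1) - 4 * (12 * u1)) -
      (r - 1) * (648 * (u - 1) ^ 2 + 324 * (12 * u1) + 1656 * (u - 1) + 1080))"
    unfolding u2 by Groebner_Basis.algebra
  also have "\<dots> = 0"
    unfolding u1 by Groebner_Basis.algebra
  finally have "E = 0" by simp
  thus ?thesis by (simp add: E_def hypergeometric_op_def defs wdefs)
qed

section \<open>The hypergeometric series and its differential equation\<close>

definition hypergeometric_coeff :: "nat \<Rightarrow> 'a::field_char_0" where
  "hypergeometric_coeff m = fact (6 * m) / (fact m ^ 3 * fact (3 * m))"

text \<open>The cubic is \<open>(6 n + 1) (2 n + 1) (6 n + 5)\<close>, what is left of the six new
  factors of \<open>(6 n + 6)!\<close> after division by the three of \<open>(3 n + 3)!\<close>. Its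
  coefficients are the constants of \<open>hypergeometric_op\<close>.\<close>

lemma hypergeometric_coeff_Suc:
  "of_nat (Suc n) ^ 3 * hypergeometric_coeff (Suc n) =
   24 * (72 * of_nat n ^ 3 + 108 * of_nat n ^ 2 + 46 * of_nat n + 5) * (hypergeometric_coeff n :: 'a::field_char_0)"
proof -
  define x where "x = (of_nat n :: 'a)"
  have nz: "x + 1 \<noteq> 0" "3 * x + 1 \<noteq> 0" "3 * x + 2 \<noteq> 0" "3 * x + 3 \<noteq> 0"
  proof -
    have eqs: "x + 1 = of_nat (n + 1)" "3 * x + 1 = of_nat (3 * n + 1)"
      "3 * x + 2 = of_nat (3 * n + 2)" "3 * x + 3 = of_nat (3 * n + 3)"
      by (simp_all add: x_def)
    show "x + 1 \<noteq> 0" "3 * x + 1 \<noteq> 0" "3 * x + 2 \<noteq> 0" "3 * x + 3 \<noteq> 0"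
      unfolding eqs of_nat_eq_0_iff by simp_all
  qed
  have 6: "fact (6 * Suc n) = (6*x+6) * (6*x+5) * (6*x+4) * (6*x+3) * (6*x+2) * (6*x+1) * (fact (6 * n) :: 'a)"
  proof -
    have "6 * Suc n = Suc (Suc (Suc (Suc (Suc (Suc (6 * n))))))" by simp
    thus ?thesis unfolding x_def by (simp only: fact_Suc) (simp add: add_ac)
  qed
  have 3: "fact (3 * Suc n) = (3*x+3) * (3*x+2) * (3*x+1) * (fact (3 * n) :: 'a)"
  proof -
    have "3 * Suc n = Suc (Suc (Suc (3 * n)))" by simp
    thus ?thesis unfolding x_def by (simp only: fact_Suc) (simp add: add_ac)
  qed
  have 1: "of_nat (Suc n) = x + 1" "fact (Suc n) = (x + 1) * (fact n :: 'a)" by (simp_all add: x_def add.commute)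
  have "(6*x+6) * (6*x+5) * (6*x+4) * (6*x+3) * (6*x+2) * (6*x+1) =
      24 * (72 * x ^ 3 + 108 * x ^ 2 + 46 * x + 5) * ((3*x+3) * (3*x+2) * (3*x+1))"
    by Groebner_Basis.algebra
  thus ?thesis unfolding hypergeometric_coeff_def 6 3 1 x_def[symmetric] power_mult_distrib
    using nz by (simp add: divide_simps)
qed

definition hypergeometric_fps :: "'a::field_char_0 fps" where
  "hypergeometric_fps = Abs_fps hypergeometric_coeff"

text \<open>The recurrence times 72, with \<open>24 * 72 = 1728\<close>; the factor
  \<open>fps_X\<close> performs the index shift.\<close>

lemma hypergeometric_fps_ode:
  fixes H :: "'a::field_char_0 fps"
  defines "H \<equiv> hypergeometric_fps"
  shows "72 * fps_theta (fps_theta (fps_theta H)) = fps_X * (1728 * (72 * fps_theta (fps_theta (fps_theta H)) +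
     108 * fps_theta (fps_theta H) + 46 * fps_theta H + 5 * H))"
proof (rule fps_ext)
  fix n
  show "fps_nth (72 * fps_theta (fps_theta (fps_theta H))) n = fps_nth (fps_X * (1728 * (72 * fps_theta (fps_theta (fps_theta H)) +
     108 * fps_theta (fps_theta H) + 46 * fps_theta H + 5 * H))) n"
  proof (cases n)
    case (Suc m)
    have "72 * (of_nat (Suc m) ^ 3 * hypergeometric_coeff (Suc m)) =
      1728 * (72 * of_nat m ^ 3 + 108 * of_nat m ^ 2 + 46 * of_nat m + 5) * (hypergeometric_coeff m :: 'a)"
      unfolding hypergeometric_coeff_Suc by simp
    thus ?thesis unfolding Suc H_def
      by (simp add: numeral_fps_const hypergeometric_fps_def algebra_simps power2_eq_square power3_eq_cube
               del: of_nat_Suc)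
  qed (simp add: numeral_fps_const)
qed

lemma hypergeometric_op_compose:
  "hypergeometric_op (hypergeometric_fps oo hauptmodul) = (0 :: 'a::field_char_0 fps)"
proof -
  define t r where "t = (hauptmodul :: 'a fps)" "r = (eisenstein_ratio :: 'a fps)"
  define H where "H = (hypergeometric_fps :: 'a fps)"
  define y where "y = H oo t"
  define y1 y2 y3 where ydefs: "y1 = fps_theta H oo t" "y2 = fps_theta (fps_theta H) oo t"
    "y3 = fps_theta (fps_theta (fps_theta H)) oo t"
  have t0: "fps_nth t 0 = 0" by (simp add: t_r_def)
  have num: "numeral k oo t = (numeral k :: 'a fps)" for k
    unfolding numeral_fps_const by simp
  have "(72 * fps_theta (fps_theta (fps_theta H))) oo t =
    (fps_X * (1728 * (72 * fps_theta (fps_theta (fps_theta H)) +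
     108 * fps_theta (fps_theta H) + 46 * fps_theta H + 5 * H))) oo t"
    unfolding H_def by (rule arg_cong[OF hypergeometric_fps_ode])
  hence h: "72 * y3 = t * (1728 * (72 * y3 + 108 * y2 + 46 * y1 + 5 * y))"
    by (simp only: fps_compose_mult_distrib[OF t0] fps_compose_add_distrib num
        fps_X_fps_compose_startby0[OF t0] ydefs[symmetric] y_def[symmetric])
  \<comment> \<open>Solving for the third-order part \<open>Z\<close>:
    \<open>(1 - 1728 t) Z = 1728 t K\<close>, and \<open>1728 t r = r - 1\<close> turns this into
    \<open>Z = (r - 1) K\<close>.\<close>
  define K Z where "K = 108 * y2 + 46 * y1 + 5 * y" "Z = 72 * y3"
  have "72 * y3 + 108 * y2 + 46 * y1 + 5 * y = Z + K" by (simp add: K_Z_def add_ac)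
  hence "Z = t * (1728 * (Z + K))" using h by (simp only: K_Z_def(2))
  hence K: "Z - 1728 * t * Z = 1728 * t * K"
    by (simp add: algebra_simps)
  have r: "r * (1 - 1728 * t) = 1"
    unfolding t_r_def by (rule eisenstein_ratio_eq)
  have "Z = r * (1 - 1728 * t) * Z" unfolding r by simp
  also have "\<dots> = r * (Z - 1728 * t * Z)" by (simp add: algebra_simps)
  also have "\<dots> = (r - r * (1 - 1728 * t)) * K" unfolding K by (simp add: algebra_simps)
  finally have "72 * y3 - (r - 1) * (108 * y2 + 46 * y1 + 5 * y) = 0"
    unfolding r K_Z_def by simp
  thus ?thesis
    by (simp add: hypergeometric_op_def hauptmodul_deriv_compose ydefs y_def t_r_def H_def)
qed

section \<open>Uniqueness of the power series solution\<close>

lemma hypergeometric_op_diff [simp]: "hypergeometric_op (f - g) = hypergeometric_op f - hypergeometric_op g"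
  by (simp add: hypergeometric_op_def algebra_simps)

text \<open>\<open>E4 / E6\<close> has constant term 1, so on leading terms \<open>t d/dt\<close>
  acts like \<open>q d/dq\<close>.\<close>

lemma hauptmodul_deriv_leading:
  fixes f :: "'a::field_char_0 fps"
  assumes "\<And>j. j < k \<Longrightarrow> fps_nth f j = 0"
  shows "j < k \<Longrightarrow> fps_nth (hauptmodul_deriv f) j = 0"
    and "fps_nth (hauptmodul_deriv f) k = of_nat k * fps_nth f k"
proof -
  show "fps_nth (hauptmodul_deriv f) j = 0" if "j < k"
    unfolding hauptmodul_deriv_def fps_mult_nth[of _ "fps_theta f"] using that assms by (intro sum.neutral) simp
  have "fps_nth (hauptmodul_deriv f) k = (\<Sum>i\<in>{0}. fps_nth (eisenstein_E4 * inverse eisenstein_E6) i * fps_nth (fps_theta f) (k - i))"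
    unfolding hauptmodul_deriv_def fps_mult_nth[of _ "fps_theta f"]
    using assms by (intro sum.mono_neutral_right) auto
  thus "fps_nth (hauptmodul_deriv f) k = of_nat k * fps_nth f k" by simp
qed

text \<open>The indicial polynomial is \<open>72 n^3\<close>, whose only root is 0. The terms of
  lower order do not interfere at the leading index, because \<open>eisenstein_ratio - 1\<close> has
  zero constant term.\<close>

lemma hypergeometric_op_eq_0:
  fixes f :: "'a::field_char_0 fps"
  assumes "hypergeometric_op f = 0" "fps_nth f 0 = 0"
  shows "f = 0"
proof (rule fps_ext)
  fix n
  let ?D = "hauptmodul_deriv :: 'a fps \<Rightarrow> 'a fps"
  show "fps_nth f n = fps_nth 0 n"
  proof (induction n rule: less_induct)
    case (less n)
    hence f: "\<And>j. j < n \<Longrightarrow> fps_nth f j = 0" by simp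
    have f1: "\<And>j. j < n \<Longrightarrow> fps_nth (?D f) j = 0" "fps_nth (?D f) n = of_nat n * fps_nth f n"
      using hauptmodul_deriv_leading[of n f] f by blast+
    have f2: "\<And>j. j < n \<Longrightarrow> fps_nth (?D (?D f)) j = 0" "fps_nth (?D (?D f)) n = of_nat n * fps_nth (?D f) n"
      using hauptmodul_deriv_leading[of n "?D f"] f1(1) by blast+
    have f3: "fps_nth (?D (?D (?D f))) n = of_nat n * fps_nth (?D (?D f)) n"
      using hauptmodul_deriv_leading(2)[of n "?D (?D f)"] f2(1) by blast
    show "fps_nth f n = fps_nth 0 n"
    proof (cases "n = 0")
      case False
      define g where "g = 108 * ?D (?D f) + 46 * ?D f + 5 * f"
      have g: "fps_nth g j = 0" if "j < n" for j
        using f[OF that] f1(1)[OF that] f2(1)[OF that] by (simp add: g_def numeral_fps_const)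
      have "fps_nth (eisenstein_ratio - 1 :: 'a fps) 0 = 0" by (simp add: eisenstein_ratio_def fps_power_zeroth)
      hence "fps_nth (eisenstein_ratio - 1) i * fps_nth g (n - i) = 0" for i
        using g[of "n - i"] False by (cases "i = 0") auto
      hence "fps_nth ((eisenstein_ratio - 1) * g) n = 0"
        unfolding fps_mult_nth by (intro sum.neutral) blast
      hence "fps_nth (72 * ?D (?D (?D f))) n = 0"
        using arg_cong[OF assms(1), of "\<lambda>h. fps_nth h n"] by (simp add: hypergeometric_op_def g_def)
      hence "72 * (of_nat n * (of_nat n * (of_nat n * fps_nth f n))) = 0"
        by (simp add: numeral_fps_const f1(2) f2(2) f3)
      thus ?thesis using False by simp
    qed (use assms in simp)
  qed
qed

lemma hypergeometric_fps_compose: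
  "hypergeometric_fps oo hauptmodul = (eisenstein_E4_sqrt :: 'a::field_char_0 fps)"
proof -
  have "hypergeometric_op ((hypergeometric_fps oo hauptmodul) - eisenstein_E4_sqrt) = (0 :: 'a fps)"
    by (simp add: hypergeometric_op_compose hypergeometric_op_E4_sqrt)
  moreover have "fps_nth hypergeometric_fps 0 = (1 :: 'a)"
    by (simp add: hypergeometric_fps_def hypergeometric_coeff_def)
  hence "fps_nth ((hypergeometric_fps oo hauptmodul) - eisenstein_E4_sqrt) 0 = (0 :: 'a)"
    by (simp add: fps_compose_nth)
  ultimately have "(hypergeometric_fps oo hauptmodul) - eisenstein_E4_sqrt = (0 :: 'a fps)"
    by (rule hypergeometric_op_eq_0)
  thus ?thesis by simp
qed

section \<open>Congruences modulo p\<close>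

text \<open>Isolates what the congruence argument uses of the integral closure of the p-adic
  integers; no valuation on \<open>S\<close> is involved.\<close>

locale p_integral_subring =
  fixes S :: "'a::field_char_0 set" and p :: nat
  assumes prime_p: "Factorial_Ring.prime p" and not_dvd_6: "\<not> p dvd 6"
    and one_closed [simp]: "1 \<in> S"
    and diff_closed: "x \<in> S \<Longrightarrow> y \<in> S \<Longrightarrow> x - y \<in> S"
    and mult_closed: "x \<in> S \<Longrightarrow> y \<in> S \<Longrightarrow> x * y \<in> S"
    and inverse_of_nat_closed: "\<not> p dvd n \<Longrightarrow> inverse (of_nat n) \<in> S"
begin

lemma zero_closed [simp]: "0 \<in> S"
  using diff_closed[of 1 1] by simp

lemma uminus_closed: "x \<in> S \<Longrightarrow> - x \<in> S"
  using diff_closed[of 0 x] by simp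

lemma add_closed: "x \<in> S \<Longrightarrow> y \<in> S \<Longrightarrow> x + y \<in> S"
  using diff_closed[of x "- y"] uminus_closed by simp

lemma of_nat_closed [simp]: "of_nat n \<in> S"
  by (induction n) (simp_all add: add_closed)

lemma numeral_closed [simp]: "numeral k \<in> S"
  using of_nat_closed[of "numeral k"] by simp

lemma power_closed: "x \<in> S \<Longrightarrow> x ^ n \<in> S"
  by (induction n) (simp_all add: mult_closed)

lemma sum_closed: "(\<And>i. i \<in> A \<Longrightarrow> f i \<in> S) \<Longrightarrow> sum f A \<in> S"
  by (induction A rule: infinite_finite_induct) (simp_all add: add_closed)

lemma odd_p: "odd p"
proof
  assume "even p"
  hence "p = 2" using primes_dvd_imp_eq[OF two_is_prime_nat prime_p] by simp
  thus False using not_dvd_6 by simp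
qed

lemma not_dvd_2_3: "\<not> p dvd 2" "\<not> p dvd 3"
  using not_dvd_6 dvd_mult2[of p 2 3] dvd_mult[of p 3 2] by auto

lemma inverse_1728_closed: "1 / 1728 \<in> S"
proof -
  have "\<not> p dvd 2 ^ 6 * 3 ^ 3"
    using not_dvd_2_3 prime_p by (simp only: prime_dvd_mult_iff prime_dvd_power_iff) auto
  hence "inverse (of_nat (2 ^ 6 * 3 ^ 3)) \<in> S" by (rule inverse_of_nat_closed)
  moreover have "inverse (of_nat (2 ^ 6 * 3 ^ 3)) = (1 / 1728 :: 'a)" by simp
  ultimately show ?thesis by (simp only:)
qed

definition ideal_p :: "'a set" where
  "ideal_p = (\<lambda>z. of_nat p * z) ` S"

lemma ideal_pI: "z \<in> S \<Longrightarrow> of_nat p * z \<in> ideal_p"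
  unfolding ideal_p_def by (rule imageI)

lemma ideal_p_subset: "x \<in> ideal_p \<Longrightarrow> x \<in> S"
  by (auto simp: ideal_p_def mult_closed)

lemma ideal_p_0 [simp]: "0 \<in> ideal_p"
  using ideal_pI[of 0] by simp

lemma ideal_p_add: "x \<in> ideal_p \<Longrightarrow> y \<in> ideal_p \<Longrightarrow> x + y \<in> ideal_p"
  by (auto simp: ideal_p_def add_closed simp flip: distrib_left)

lemma ideal_p_diff: "x \<in> ideal_p \<Longrightarrow> y \<in> ideal_p \<Longrightarrow> x - y \<in> ideal_p"
  by (auto simp: ideal_p_def diff_closed simp flip: right_diff_distrib)

lemma ideal_p_mult: "x \<in> ideal_p \<Longrightarrow> y \<in> S \<Longrightarrow> x * y \<in> ideal_p"
  by (auto simp: ideal_p_def mult.assoc mult_closed)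

lemma ideal_p_sum: "(\<And>i. i \<in> A \<Longrightarrow> f i \<in> ideal_p) \<Longrightarrow> sum f A \<in> ideal_p"
  by (induction A rule: infinite_finite_induct) (simp_all add: ideal_p_add)

section \<open>Power series with coefficients in \<open>S\<close>\<close>

definition integral_fps :: "'a fps set" where
  "integral_fps = {f. \<forall>n. fps_nth f n \<in> S}"

lemma integral_fps_nth: "f \<in> integral_fps \<Longrightarrow> fps_nth f n \<in> S"
  by (simp add: integral_fps_def)

lemma integral_fps_const: "c \<in> S \<Longrightarrow> fps_const c \<in> integral_fps"
  by (simp add: integral_fps_def)

lemma integral_fps_X: "fps_X \<in> integral_fps"
  by (simp add: integral_fps_def fps_X_def)

lemma integral_fps_1 [simp]: "1 \<in> integral_fps"
  by (simp add: integral_fps_def)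

lemma integral_fps_0 [simp]: "0 \<in> integral_fps"
  by (simp add: integral_fps_def)

lemma integral_fps_of_nat [simp]: "of_nat n \<in> integral_fps"
  by (simp add: integral_fps_const flip: fps_of_nat)

lemma integral_fps_numeral [simp]: "numeral k \<in> integral_fps"
  by (simp add: integral_fps_const numeral_fps_const)

lemma integral_fps_add: "f \<in> integral_fps \<Longrightarrow> g \<in> integral_fps \<Longrightarrow> f + g \<in> integral_fps"
  by (simp add: integral_fps_def add_closed)

lemma integral_fps_diff: "f \<in> integral_fps \<Longrightarrow> g \<in> integral_fps \<Longrightarrow> f - g \<in> integral_fps"
  by (simp add: integral_fps_def diff_closed)

lemma integral_fps_mult: "f \<in> integral_fps \<Longrightarrow> g \<in> integral_fps \<Longrightarrow> f * g \<in> integral_fps"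
  by (simp add: integral_fps_def fps_mult_nth sum_closed mult_closed)

lemma integral_fps_power: "f \<in> integral_fps \<Longrightarrow> f ^ n \<in> integral_fps"
  by (induction n) (simp_all add: integral_fps_mult)

lemma integral_fps_sum: "(\<And>i. i \<in> A \<Longrightarrow> f i \<in> integral_fps) \<Longrightarrow> sum f A \<in> integral_fps"
  by (induction A rule: infinite_finite_induct) (simp_all add: integral_fps_add)

lemma integral_fps_inverse:
  assumes "f \<in> integral_fps" "fps_nth f 0 = 1"
  shows "inverse f \<in> integral_fps"
proof -
  have "fps_nth (inverse f) n \<in> S" for n
  proof (induction n rule: less_induct)
    case (less n)
    show ?case
    proof (cases "n = 0")
      case False
      have "(\<Sum>i=0..n. fps_nth f i * fps_nth (inverse f) (n - i)) = fps_nth (f * inverse f) n"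
        by (simp add: fps_mult_nth)
      also have "f * inverse f = 1" using assms by (simp add: inverse_mult_eq_1')
      finally have "fps_nth (inverse f) n = - (\<Sum>i\<in>{1..n}. fps_nth f i * fps_nth (inverse f) (n - i))"
        using False assms(2) by (simp only: sum.atLeast_Suc_atMost[of 0 n]) (simp add: eq_neg_iff_add_eq_0)
      also have "\<dots> \<in> S"
        using assms(1) False by (intro uminus_closed sum_closed mult_closed less) (auto intro: integral_fps_nth)
      finally show ?thesis .
    qed (use assms in simp)
  qed
  thus ?thesis by (simp add: integral_fps_def)
qed

text \<open>Only the coefficients of \<open>f\<close> up to \<open>n\<close> are constrained, which
  admits congruences modulo \<open>p\<close> and a power of the variable.\<close>

lemma ideal_p_fps_mult:
  assumes "\<And>i. i \<le> n \<Longrightarrow> fps_nth f i \<in> ideal_p" "g \<in> integral_fps"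
  shows "fps_nth (f * g) n \<in> ideal_p"
  unfolding fps_mult_nth using assms by (intro ideal_p_sum ideal_p_mult integral_fps_nth) auto

lemma eisenstein_integral: "eisenstein_E4 \<in> integral_fps" "eisenstein_E6 \<in> integral_fps"
proof -
  have "divisor_sum k n \<in> S" for k n
    by (auto simp: divisor_sum_def intro!: sum_closed power_closed)
  hence "fps_nth eisenstein_E4 n \<in> S" "fps_nth eisenstein_E6 n \<in> S" for n
    by (cases "n = 0"; simp add: eisenstein_nth mult_closed uminus_closed)+
  thus "eisenstein_E4 \<in> integral_fps" "eisenstein_E6 \<in> integral_fps"
    by (simp_all add: integral_fps_def)
qed

text \<open>Integrality of the discriminant comes from 2 and 3 being invertible in
  \<open>S\<close>.\<close>

lemma hauptmodul_integral: "hauptmodul \<in> integral_fps"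
  unfolding hauptmodul_def modular_discriminant_def
  by (intro integral_fps_mult integral_fps_inverse integral_fps_diff integral_fps_const
      integral_fps_power inverse_1728_closed eisenstein_integral) (simp add: fps_power_zeroth)

text \<open>The inner binomial coefficients of a \<open>p\<close>-th power are divisible by
  \<open>p\<close>. The quotient \<open>h\<close> stays explicit because congruences of whole series
  are handled as equations.\<close>

lemma frobenius_fps:
  assumes "f \<in> integral_fps" "g \<in> integral_fps"
  obtains h where "h \<in> integral_fps" "(f + g) ^ p = f ^ p + g ^ p + of_nat p * h"
proof
  let ?h = "\<Sum>k\<in>{1..<p}. of_nat ((p choose k) div p) * f ^ k * g ^ (p - k)"
  show "?h \<in> integral_fps"
    using assms by (intro integral_fps_sum integral_fps_mult integral_fps_power) simp_all
  have p: "p > 1" using prime_p prime_gt_1_nat by blast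
  have "(f + g) ^ p = (\<Sum>k\<in>insert 0 (insert p {1..<p}). of_nat (p choose k) * f ^ k * g ^ (p - k))"
    unfolding binomial_ring using p by (intro sum.cong) auto
  also have "\<dots> = f ^ p + g ^ p + (\<Sum>k\<in>{1..<p}. of_nat (p choose k) * f ^ k * g ^ (p - k))"
    using p by simp
  also have "(\<Sum>k\<in>{1..<p}. of_nat (p choose k) * f ^ k * g ^ (p - k)) = of_nat p * ?h"
    unfolding sum_distrib_left
  proof (rule sum.cong)
    fix k assume "k \<in> {1..<p}"
    hence "p dvd (p choose k)" using prime_p by (intro dvd_choose_prime) auto
    hence "(p choose k) = p * ((p choose k) div p)" by simp
    hence "(of_nat (p choose k) :: 'a fps) = of_nat p * of_nat ((p choose k) div p)"
      by (metis of_nat_mult)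
    thus "of_nat (p choose k) * f ^ k * g ^ (p - k) = of_nat p * (of_nat ((p choose k) div p) * f ^ k * g ^ (p - k))"
      by (simp add: mult_ac)
  qed simp
  finally show "(f + g) ^ p = f ^ p + g ^ p + of_nat p * ?h" .
qed

text \<open>Iterated Frobenius: modulo \<open>p\<close>, each \<open>p\<close>-th power moves the
  non-constant part to multiples of a \<open>p\<close> times higher power of
  \<open>fps_X\<close>.\<close>

lemma power_prime_power_fps:
  assumes "f \<in> integral_fps" "fps_nth f 0 = 1"
  obtains g h where "g \<in> integral_fps" "h \<in> integral_fps"
    "f ^ (p ^ l) = 1 + fps_X ^ (p ^ l) * g + of_nat p * h"
proof -
  have "\<exists>g\<in>integral_fps. \<exists>h\<in>integral_fps. f ^ (p ^ l) = 1 + fps_X ^ (p ^ l) * g + of_nat p * h"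
  proof (induction l)
    case 0
    have "fps_shift 1 f \<in> integral_fps" using assms by (simp add: integral_fps_def)
    moreover have "f = 1 + fps_X * fps_shift 1 f"
      using assms(2) by (intro fps_ext) simp
    ultimately show ?case by (intro bexI[of _ "fps_shift 1 f"] bexI[of _ 0]) simp_all
  next
    case (Suc l)
    then obtain g h where gh: "g \<in> integral_fps" "h \<in> integral_fps"
      "f ^ (p ^ l) = 1 + fps_X ^ (p ^ l) * g + of_nat p * h" by blast
    define x y where "x = fps_X ^ (p ^ l) * g" "y = (of_nat p * h :: 'a fps)"
    have xy: "x \<in> integral_fps" "y \<in> integral_fps"
      using gh by (simp_all add: x_y_def integral_fps_mult integral_fps_power integral_fps_X)
    obtain h1 where h1: "h1 \<in> integral_fps" "(1 + x + y) ^ p = (1 + x) ^ p + y ^ p + of_nat p * h1"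
      using frobenius_fps[of "1 + x" y] xy integral_fps_add[OF integral_fps_1 xy(1)] by metis
    obtain h2 where h2: "h2 \<in> integral_fps" "(1 + x) ^ p = 1 ^ p + x ^ p + of_nat p * h2"
      using frobenius_fps[OF integral_fps_1 xy(1)] by metis
    \<comment> \<open>The error \<open>y\<close> is a multiple of \<open>p\<close>; splitting off
      one factor shows that \<open>y ^ p\<close> is one as well.\<close>
    have "y ^ p = y * y ^ (p - 1)"
      using power_minus_mult[OF prime_gt_0_nat[OF prime_p], of y] by (simp only: mult.commute)
    also have "\<dots> = of_nat p * (h * y ^ (p - 1))"
      by (simp only: x_y_def(2) mult.assoc)
    finally have y: "y ^ p = \<dots>" .
    have x: "x ^ p = fps_X ^ (p ^ Suc l) * g ^ p"
      by (simp only: x_y_def(1) power_mult_distrib power_mult[symmetric] power_Suc2)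
    have "f ^ (p ^ Suc l) = (f ^ (p ^ l)) ^ p" by (simp only: power_mult[symmetric] power_Suc2)
    also have "f ^ (p ^ l) = 1 + x + y" by (simp only: gh(3) x_y_def)
    also have "(1 + x + y) ^ p = 1 + x ^ p + of_nat p * h2 + y ^ p + of_nat p * h1"
      by (simp only: h1(2) h2(2) power_one)
    also have "\<dots> = 1 + fps_X ^ (p ^ Suc l) * g ^ p + of_nat p * (h2 + h * y ^ (p - 1) + h1)"
      by (simp only: x y distrib_left add.assoc)
    finally have "f ^ (p ^ Suc l) = \<dots>" .
    moreover have "g ^ p \<in> integral_fps" "h2 + h * y ^ (p - 1) + h1 \<in> integral_fps"
      using gh(1,2) xy h1(1) h2(1) by (auto intro!: integral_fps_add integral_fps_mult integral_fps_power)
    ultimately show ?case by blast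
  qed
  thus thesis using that by blast
qed

end

text \<open>The expansion of \<open>(1 - 1728 X)^(-1/2)\<close>, from that of
  \<open>(1 - 4 z)^(-1/2)\<close> with \<open>z = 432 X\<close>.\<close>

definition central_binomial_fps :: "'a::field_char_0 fps" where
  "central_binomial_fps = Abs_fps (\<lambda>m. of_nat ((2 * m) choose m) * 432 ^ m)"

lemma central_binomial_Suc:
  "of_nat (Suc m) * of_nat ((2 * Suc m) choose Suc m) =
   (2 * (2 * of_nat m + 1) * of_nat ((2 * m) choose m) :: 'a::field_char_0)"
proof -
  have 1: "of_nat ((2 * k) choose k) = (fact (2 * k) / (fact k * fact k) :: 'a)" for k
    using binomial_fact[of k "2 * k", where 'a='a] by (simp add: mult_2)
  have 2: "fact (2 * Suc m) = (2 * of_nat (Suc m)) * ((2 * of_nat m + 1) * (fact (2 * m) :: 'a))"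
  proof -
    have "2 * Suc m = Suc (Suc (2 * m))" by simp
    thus ?thesis by (simp only: fact_Suc) (simp add: algebra_simps)
  qed
  show ?thesis unfolding 1 2 fact_Suc by (simp add: divide_simps del: of_nat_Suc)
qed

text \<open>The series solves \<open>(1 - 1728 X) f' = 864 f\<close>, so the left-hand side has
  derivative zero and equals its constant term.\<close>

lemma central_binomial_fps_square:
  "central_binomial_fps ^ 2 * (1 - 1728 * fps_X) = (1 :: 'a::field_char_0 fps)"
proof -
  define f where "f = (central_binomial_fps :: 'a fps)"
  define b where "b = (\<lambda>n. of_nat ((2 * n) choose n) :: 'a)"
  have f_nth: "fps_nth f n = b n * 432 ^ n" for n by (simp add: f_def central_binomial_fps_def b_def)
  have b_Suc: "of_nat (Suc n) * b (Suc n) = 2 * (2 * of_nat n + 1) * b n" for n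
    unfolding b_def by (rule central_binomial_Suc)
  have ode: "fps_deriv f * (1 - 1728 * fps_X) = 864 * f"
  proof (rule fps_ext)
    fix n
    have "fps_nth (fps_deriv f) n = 864 * (2 * of_nat n + 1) * fps_nth f n" for n
    proof -
      have "fps_nth (fps_deriv f) n = 432 ^ Suc n * (of_nat (Suc n) * b (Suc n))"
        by (simp add: f_nth)
      also have "\<dots> = 864 * (2 * of_nat n + 1) * fps_nth f n"
        unfolding b_Suc f_nth by simp
      finally show ?thesis .
    qed
    moreover have "fps_nth (fps_deriv f * (1728 * fps_X)) n = 1728 * of_nat n * fps_nth f n"
    proof -
      have eq: "fps_deriv f * (1728 * fps_X) = fps_const 1728 * (fps_X * fps_deriv f)"
        by (simp add: numeral_fps_const mult_ac)
      show ?thesis unfolding eq by (cases n) simp_all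
    qed
    ultimately show "fps_nth (fps_deriv f * (1 - 1728 * fps_X)) n = fps_nth (864 * f) n"
      by (simp add: right_diff_distrib) (simp add: numeral_fps_const algebra_simps)
  qed
  have "fps_deriv (f ^ 2 * (1 - 1728 * fps_X)) = 2 * f * (fps_deriv f * (1 - 1728 * fps_X)) - 1728 * f ^ 2"
    by (simp add: fps_deriv_power power2_eq_square algebra_simps)
  also have "\<dots> = 0" unfolding ode by (simp add: power2_eq_square)
  finally have 1: "f ^ 2 * (1 - 1728 * fps_X) = fps_const (fps_nth (f ^ 2 * (1 - 1728 * fps_X)) 0)"
    by (simp only: fps_deriv_eq_0_iff)
  have "fps_nth (f ^ 2 * (1 - 1728 * fps_X)) 0 = 1"
    by (simp add: f_def central_binomial_fps_def power2_eq_square)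
  with 1 have "f ^ 2 * (1 - 1728 * fps_X) = 1" by (simp only: fps_const_1_eq_1)
  thus ?thesis by (simp only: f_def)
qed

text \<open>Gives integrality, and exposes the central binomial factor that \<open>p\<close> divides
  in the upper half of the range.\<close>

lemma hypergeometric_coeff_binomial:
  "hypergeometric_coeff m =
   (of_nat (((2 * m) choose m) * ((3 * m) choose m) * ((6 * m) choose (3 * m))) :: 'a::field_char_0)"
proof -
  have "of_nat ((2 * m) choose m) = (fact (2 * m) / (fact m * fact m) :: 'a)"
    using binomial_fact[of m "2 * m", where 'a='a] by (simp add: mult_2)
  moreover have "of_nat ((3 * m) choose m) = (fact (3 * m) / (fact m * fact (2 * m)) :: 'a)"
    using binomial_fact[of m "3 * m", where 'a='a] by simp
  moreover have "of_nat ((6 * m) choose (3 * m)) = (fact (6 * m) / (fact (3 * m) * fact (3 * m)) :: 'a)"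
    using binomial_fact[of "3 * m" "6 * m", where 'a='a] by simp
  ultimately show ?thesis
    by (simp add: hypergeometric_coeff_def power3_eq_cube)
qed

lemma fps_geometric_nth: "fps_nth (inverse (1 - fps_const c * fps_X)) n = (c :: 'a::field) ^ n"
proof -
  have "(1 - fps_const c * fps_X) * Abs_fps (power c) = 1"
  proof (rule fps_ext)
    fix n show "fps_nth ((1 - fps_const c * fps_X) * Abs_fps (power c)) n = fps_nth 1 n"
      unfolding left_diff_distrib mult.assoc by (cases n) simp_all
  qed
  hence "Abs_fps (power c) = inverse (1 - fps_const c * fps_X)"
    by (rule fps_inverse_unique[symmetric])
  thus ?thesis by (metis fps_nth_Abs_fps)
qed

text \<open>The coefficient is a sum of \<open>coeff Q i * c ^ (n - i)\<close> over
  \<open>i \<le> n\<close>; by the degree bound it misses no coefficient of \<open>Q\<close>, and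
  \<open>c ^ n\<close> factors out.\<close>

lemma fps_of_poly_geometric_nth:
  fixes c :: "'a::field"
  assumes "Polynomial.degree Q \<le> n" "c \<noteq> 0"
  shows "fps_nth (fps_of_poly Q * inverse (1 - fps_const c * fps_X)) n = c ^ n * poly Q (inverse c)"
proof -
  have "poly Q (inverse c) = (\<Sum>i=0..n. Polynomial.coeff Q i * inverse c ^ i)"
    unfolding poly_altdef using assms(1)
    by (intro sum.mono_neutral_left) (auto simp: coeff_eq_0)
  moreover have "c ^ (n - i) = c ^ n * inverse c ^ i" if "i \<le> n" for i
    using assms(2) that by (simp add: power_diff power_inverse divide_inverse)
  ultimately show ?thesis
    unfolding fps_mult_nth fps_geometric_nth by (simp add: sum_distrib_left mult_ac)
qed

text \<open>The \<open>G\<close> of the overview.\<close>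

definition F4_kernel :: "'a::field_char_0 \<Rightarrow> 'a fps" where
  "F4_kernel c = hypergeometric_fps * central_binomial_fps * inverse (1 - fps_const c * fps_X)"

text \<open>Both sides have a square inverse to \<open>1 - 1728 t\<close>; their constant terms 1
  rule out opposite signs.\<close>

lemma central_binomial_fps_compose:
  "central_binomial_fps oo hauptmodul = (eisenstein_E4_sqrt ^ 3 * inverse eisenstein_E6 :: 'a::field_char_0 fps)"
proof -
  define b where "b = (central_binomial_fps oo hauptmodul :: 'a fps)"
  define g where "g = (eisenstein_E4_sqrt ^ 3 * inverse eisenstein_E6 :: 'a fps)"
  define s where "s = (1 - 1728 * hauptmodul :: 'a fps)"
  have "(central_binomial_fps ^ 2 * (1 - 1728 * fps_X)) oo hauptmodul = (1 :: 'a fps)"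
    unfolding central_binomial_fps_square by simp
  hence b: "b ^ 2 * s = 1"
    by (simp add: fps_compose_mult_distrib fps_compose_sub_distrib fps_compose_power b_def s_def numeral_fps_const)
  have "g ^ 2 = (eisenstein_E4_sqrt ^ 2) ^ 3 * inverse eisenstein_E6 ^ 2"
    by (simp add: g_def power_mult_distrib flip: power_mult)
  hence "g ^ 2 * s = 1"
    unfolding eisenstein_E4_sqrt_power using eisenstein_ratio_eq[where 'a='a]
    by (simp add: eisenstein_ratio_def s_def)
  with b have "b ^ 2 * s = g ^ 2 * s" "s \<noteq> 0" by auto
  hence "b ^ 2 = g ^ 2" by simp
  moreover have "fps_nth b 0 = 1" "fps_nth g 0 = 1"
    by (simp_all add: b_def g_def central_binomial_fps_def fps_power_zeroth)
  hence "fps_nth (b + g) 0 \<noteq> 0" by simp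
  hence "b + g \<noteq> 0" by (metis fps_zero_nth)
  ultimately show ?thesis
    by (simp add: power2_eq_iff b_def g_def eq_neg_iff_add_eq_0)
qed

text \<open>With \<open>w = sqrt E4\<close> the composite contains \<open>w^4 = E4^2\<close>. One
  factor \<open>E4\<close> is absorbed by \<open>theta_hauptmodul\<close>, which brings in the
  \<open>E6\<close> that cancels its inverse.\<close>

lemma F4_kernel_compose:
  "(F4_kernel c oo hauptmodul) * fps_theta hauptmodul =
   eisenstein_E4 * hauptmodul * inverse (1 - fps_const c * (hauptmodul :: 'a::field_char_0 fps))"
proof -
  let ?t = "hauptmodul :: 'a fps" and ?w = "eisenstein_E4_sqrt :: 'a fps" and ?i = "inverse eisenstein_E6 :: 'a fps"
  have "inverse (1 - fps_const c * fps_X) oo ?t = inverse ((1 - fps_const c * fps_X) oo ?t)"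
    by (rule fps_inverse_compose) simp_all
  also have "(1 - fps_const c * fps_X) oo ?t = 1 - fps_const c * ?t"
    by (simp add: fps_compose_sub_distrib fps_compose_mult_distrib)
  finally have "(F4_kernel c oo ?t) * fps_theta ?t =
      ?w * (?w ^ 3 * ?i) * inverse (1 - fps_const c * ?t) * fps_theta ?t"
    by (simp add: F4_kernel_def fps_compose_mult_distrib hypergeometric_fps_compose central_binomial_fps_compose)
  also have "\<dots> = (?w ^ 2) * ?i * ((?w ^ 2) * fps_theta ?t) * inverse (1 - fps_const c * ?t)"
    by (simp add: power2_eq_square power3_eq_cube mult_ac)
  also have "\<dots> = eisenstein_E4 * ?t * (?i * eisenstein_E6) * inverse (1 - fps_const c * ?t)"
    unfolding eisenstein_E4_sqrt_power theta_hauptmodul by (simp only: mult_ac)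
  finally show ?thesis by simp
qed

text \<open>Multiplying numerator and denominator of \<open>E4 / (j - c)\<close> by
  \<open>t = 1 / j\<close> removes the pole of \<open>j\<close> and leaves power series.\<close>

lemma F4_eq_fps:
  "F4 c = fps_to_fls (eisenstein_E4 * hauptmodul * inverse (1 - fps_const c * (hauptmodul :: 'a::field_char_0 fps)))"
proof -
  let ?t = "hauptmodul :: 'a fps" and ?E = "eisenstein_E4 :: 'a fps"
  let ?i = "inverse (1 - fps_const c * ?t)"
  have i: "(1 - fps_const c * ?t) * ?i = 1"
    by (rule inverse_mult_eq_1') simp
  have "fps_to_fls ?t * modular_j = fps_to_fls (?t * ?E ^ 3) / fps_to_fls modular_discriminant"
    by (simp add: modular_j_def fls_times_fps_to_fls fps_to_fls_power)
  hence tj: "fps_to_fls ?t * modular_j = 1"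
    by (simp add: hauptmodul_eq modular_discriminant_nonzero)
  have c: "fls_const c = fps_to_fls (fps_const c)" by simp
  have "fps_to_fls (?E * ?t * ?i) * (modular_j - fls_const c) =
      fps_to_fls ?E * fps_to_fls ?i * (fps_to_fls ?t * modular_j) -
      fps_to_fls ?E * fps_to_fls ?i * (fps_to_fls ?t * fls_const c)"
    by (simp add: fls_times_fps_to_fls algebra_simps)
  also have "\<dots> = fps_to_fls ?E * fps_to_fls ((1 - fps_const c * ?t) * ?i)"
    unfolding tj c by (simp add: fls_times_fps_to_fls algebra_simps del: fps_const_to_fls)
  finally have eq: "fps_to_fls (?E * ?t * ?i) * (modular_j - fls_const c) = fps_to_fls ?E"
    unfolding i by simp
  hence "modular_j - fls_const c \<noteq> 0" using eisenstein_E4_nonzero[where 'a='a] by auto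
  thus ?thesis using eq unfolding F4_eq_divide by (simp add: divide_eq_eq)
qed

section \<open>The congruence for the coefficient at a power of \<open>p\<close>\<close>

context p_integral_subring
begin

text \<open>From \<open>B ^ 2 * f = 1\<close> and \<open>p ^ l = 2 N + 1\<close> follows
  \<open>B ^ (p ^ l) * f ^ N = B\<close>. So the difference is
  \<open>(B ^ (p ^ l) - 1) * f ^ N\<close>, whose first factor is a multiple of \<open>p\<close>
  below degree \<open>p ^ l\<close>.\<close>

lemma coeff_eq_central_binomial:
  assumes "i < p ^ l"
  shows "fps_nth (central_binomial_fps - (1 - 1728 * fps_X) ^ ((p ^ l - 1) div 2)) i \<in> ideal_p"
proof -
  let ?B = "central_binomial_fps :: 'a fps" and ?f = "1 - 1728 * fps_X :: 'a fps"
  define N where "N = (p ^ l - 1) div 2"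
  have "odd (p ^ l)" using odd_p by simp
  then obtain k where "p ^ l = 2 * k + 1" by (elim oddE)
  hence N: "p ^ l = Suc (2 * N)" by (simp add: N_def)
  have B: "?B \<in> integral_fps" "fps_nth ?B 0 = 1"
    by (auto simp: integral_fps_def central_binomial_fps_def intro!: mult_closed power_closed)
  obtain g h where gh: "g \<in> integral_fps" "h \<in> integral_fps"
    "?B ^ (p ^ l) = 1 + fps_X ^ (p ^ l) * g + of_nat p * h"
    using power_prime_power_fps[OF B] by blast
  have "?B ^ (p ^ l) * ?f ^ N = ?B * (?B ^ 2 * ?f) ^ N"
    unfolding N by (simp add: power_mult_distrib power_mult)
  hence "?B - ?f ^ N = (?B ^ (p ^ l) - 1) * ?f ^ N"
    unfolding central_binomial_fps_square by (simp add: left_diff_distrib)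
  also have "\<dots> = (fps_X ^ (p ^ l) * g + of_nat p * h) * ?f ^ N" unfolding gh by simp
  finally have eq: "?B - ?f ^ N = \<dots>" .
  show ?thesis unfolding N_def[symmetric] eq
  proof (rule ideal_p_fps_mult)
    fix j assume "j \<le> i"
    hence "fps_nth (fps_X ^ (p ^ l) * g) j = 0" using assms by (simp add: fps_X_power_mult_nth)
    thus "fps_nth (fps_X ^ (p ^ l) * g + of_nat p * h) j \<in> ideal_p"
      using gh(2) by (simp add: ideal_pI integral_fps_nth flip: fps_of_nat)
  qed (intro integral_fps_power integral_fps_diff integral_fps_mult integral_fps_X; simp)
qed

lemma fps_linear_power_nth_eq_0:
  assumes "N < i"
  shows "fps_nth ((1 - 1728 * fps_X :: 'a fps) ^ N) i = 0"
proof -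
  have "(1 - 1728 * fps_X :: 'a fps) = fps_of_poly [:1, -1728:]"
    by (simp add: fps_of_poly_pCons numeral_fps_const mult.commute flip: fps_const_neg)
  hence eq: "(1 - 1728 * fps_X :: 'a fps) ^ N = fps_of_poly ([:1, -1728:] ^ N)"
    by (simp add: fps_of_poly_power)
  have "Polynomial.degree ([:1, -1728 :: 'a:] ^ N) \<le> 1 * N"
    by (rule order.trans[OF degree_power_le]) simp
  thus ?thesis unfolding eq fps_of_poly_nth using assms by (intro coeff_eq_0) linarith
qed

lemma hypergeometric_coeff_closed: "hypergeometric_coeff m \<in> S"
  unfolding hypergeometric_coeff_binomial by (rule of_nat_closed)

text \<open>The polynomial \<open>(1 - 1728 X)^N\<close> has no terms beyond degree
  \<open>N\<close>, so the central binomial coefficient times \<open>432 ^ m\<close> lies in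
  \<open>ideal_p\<close>; the unit \<open>432 = 2^4 * 3^3\<close> cancels.\<close>

lemma hypergeometric_coeff_ideal:
  assumes "(p ^ l - 1) div 2 < m" "m < p ^ l"
  shows "hypergeometric_coeff m \<in> ideal_p"
proof -
  let ?C = "of_nat ((2 * m) choose m) :: 'a"
  have "?C * 432 ^ m \<in> ideal_p"
    using coeff_eq_central_binomial[OF assms(2)] fps_linear_power_nth_eq_0[OF assms(1)]
    by (simp add: central_binomial_fps_def)
  moreover have "\<not> p dvd (2 ^ 4 * 3 ^ 3) ^ m"
  proof
    assume "p dvd (2 ^ 4 * 3 ^ 3) ^ m"
    hence "p dvd 2 ^ 4 * 3 ^ 3" by (rule prime_dvd_power[OF prime_p])
    hence "p dvd 2 ^ 4 \<or> p dvd 3 ^ 3" by (simp only: prime_dvd_mult_iff[OF prime_p])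
    thus False using not_dvd_2_3 prime_p prime_dvd_power by blast
  qed
  hence "inverse (of_nat ((2 ^ 4 * 3 ^ 3) ^ m)) \<in> S" by (rule inverse_of_nat_closed)
  hence "inverse (432 ^ m) \<in> S" by simp
  ultimately have "?C * 432 ^ m * inverse (432 ^ m) \<in> ideal_p" by (rule ideal_p_mult)
  hence "?C \<in> ideal_p" by (simp add: mult.assoc)
  thus ?thesis unfolding hypergeometric_coeff_binomial of_nat_mult mult.assoc
    by (rule ideal_p_mult) (simp flip: of_nat_mult)
qed

text \<open>The exponent of \<open>p\<close> in \<open>n\<close> is below \<open>l\<close>, so a
  factor \<open>p\<close> survives and the remaining denominator is prime to
  \<open>p\<close>.\<close>

lemma prime_power_div_ideal:
  assumes "0 < n" "n < p ^ l"
  shows "of_nat (p ^ l) / of_nat n \<in> ideal_p"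
proof -
  obtain m where m: "n = p ^ multiplicity p n * m" "\<not> p dvd m"
    by (rule multiplicity_decompose'[of n p]) (use assms(1) prime_p in auto)
  define k where "k = multiplicity p n"
  note km = m(2) m(1)[folded k_def]
  have "m > 0" using km(1) by (intro Nat.gr0I) auto
  have p: "p > 1" using prime_p prime_gt_1_nat by blast
  have "k < l"
  proof (rule ccontr)
    assume "\<not> k < l"
    hence "p ^ l * 1 \<le> p ^ k * m"
      using p \<open>m > 0\<close> by (intro mult_le_mono power_increasing) auto
    thus False using assms(2) km(2) by simp
  qed
  then obtain j where l: "l = k + Suc j" by (auto simp: less_iff_Suc_add)
  have "of_nat (p ^ l) / of_nat n = (of_nat (p ^ k) * of_nat (p ^ Suc j)) / (of_nat (p ^ k) * of_nat m :: 'a)"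
    by (simp only: l km(2) power_add of_nat_mult)
  also have "\<dots> = of_nat (p ^ Suc j) / of_nat m"
    using p by (intro mult_divide_mult_cancel_left) simp
  also have "\<dots> = of_nat p * (of_nat (p ^ j) * inverse (of_nat m))"
    by (simp only: power_Suc of_nat_mult divide_inverse mult.assoc)
  finally have eq: "of_nat (p ^ l) / of_nat n = (of_nat p * (of_nat (p ^ j) * inverse (of_nat m)) :: 'a)" .
  show ?thesis unfolding eq
    by (intro ideal_pI mult_closed of_nat_closed inverse_of_nat_closed km(1))
qed

text \<open>With \<open>L\<close> a primitive of \<open>G\<close>, the product \<open>(G \<circ> t) \<theta>t\<close> is \<open>\<theta>(L \<circ> t)\<close>, and its
  coefficient at \<open>p ^ l\<close> is \<open>p ^ l\<close> times that of \<open>L \<circ> t\<close>; the factor \<open>p ^ l\<close> outweighs the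
  denominators of all coefficients of \<open>L\<close> below \<open>p ^ l\<close>.\<close>

lemma change_of_variables:
  assumes G: "G \<in> integral_fps" and t: "t \<in> integral_fps" "fps_nth t 0 = 0" "fps_nth t 1 = 1"
  shows "fps_nth ((G oo t) * fps_theta t) (p ^ l) - fps_nth G (p ^ l - 1) \<in> ideal_p"
proof -
  define P where "P = p ^ l"
  have P: "P > 0" unfolding P_def using prime_p prime_gt_0_nat by simp
  define L where "L = fps_integral0 G"
  have L: "fps_nth L n = fps_nth G (n - 1) / of_nat n" if "n > 0" for n
    using that by (simp add: L_def fps_integral_def field_simps)
  have L0: "fps_nth L 0 = 0" by (simp add: L_def)
  have "(G oo t) * fps_theta t = fps_theta (L oo t)"
    using t(2) by (simp add: fps_theta_def fps_compose_deriv L_def fps_deriv_fps_integral mult_ac)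
  hence "fps_nth ((G oo t) * fps_theta t) P = of_nat P * (\<Sum>n=0..P. fps_nth L n * fps_nth (t ^ n) P)"
    by (simp add: fps_compose_nth)
  also have "\<dots> = (\<Sum>n\<in>insert P (insert 0 {1..<P}). of_nat P * (fps_nth L n * fps_nth (t ^ n) P))"
    unfolding sum_distrib_left using P by (intro sum.cong) auto
  also have "\<dots> = of_nat P * (fps_nth L P * fps_nth (t ^ P) P) + 
      (\<Sum>n\<in>{1..<P}. of_nat P * (fps_nth L n * fps_nth (t ^ n) P))"
    using P by (simp add: L0)
  finally have 1: "fps_nth ((G oo t) * fps_theta t) P = \<dots>" .
  \<comment> \<open>\<open>t\<close> starts with \<open>q\<close>, so \<open>t ^ P\<close> has
    coefficient 1 at \<open>P\<close>; the factor \<open>P\<close> cancels the denominator of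
    \<open>L\<close> there.\<close>
  have 2: "of_nat P * (fps_nth L P * fps_nth (t ^ P) P) = fps_nth G (P - 1)"
    unfolding startsby_zero_power_nth_same[OF t(2)] t(3) L[OF P] using P by simp
  have 3: "(\<Sum>n\<in>{1..<P}. of_nat P * (fps_nth L n * fps_nth (t ^ n) P)) =
      (\<Sum>n\<in>{1..<P}. of_nat P / of_nat n * (fps_nth G (n - 1) * fps_nth (t ^ n) P))"
  proof (rule sum.cong)
    fix n assume "n \<in> {1..<P}"
    hence "n > 0" by simp
    show "of_nat P * (fps_nth L n * fps_nth (t ^ n) P) =
        of_nat P / of_nat n * (fps_nth G (n - 1) * fps_nth (t ^ n) P)"
      unfolding L[OF \<open>n > 0\<close>] by simp
  qed simp
  have "(\<Sum>n\<in>{1..<P}. of_nat P / of_nat n * (fps_nth G (n - 1) * fps_nth (t ^ n) P)) \<in> ideal_p"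
  proof (intro ideal_p_sum ideal_p_mult mult_closed)
    fix n assume "n \<in> {1..<P}"
    thus "of_nat P / of_nat n \<in> ideal_p" unfolding P_def by (intro prime_power_div_ideal) auto
  qed (use G t(1) in \<open>auto intro: integral_fps_nth integral_fps_power\<close>)
  thus ?thesis unfolding P_def[symmetric] 1 2 3 by simp
qed

theorem F4_coeff_congruence:
  assumes c: "c \<in> S" "inverse c \<in> S" "c \<noteq> 0"
  shows "fls_nth (F4 c) (int (p ^ l)) \<in> S" (is "?a \<in> S")
    and "(c * (c - 1728)) ^ ((p ^ l - 1) div 2) *
           (\<Sum>m = 0..p ^ l - 1. hypergeometric_coeff m * inverse c ^ m) \<in> S" (is "?b \<in> S")
    and "fls_nth (F4 c) (int (p ^ l)) - (c * (c - 1728)) ^ ((p ^ l - 1) div 2) *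
           (\<Sum>m = 0..p ^ l - 1. hypergeometric_coeff m * inverse c ^ m) \<in> ideal_p"
proof -
  define P N where "P = p ^ l" "N = (P - 1) div 2"
  have "odd P" unfolding P_N_def using odd_p by simp
  then obtain k where "P = 2 * k + 1" by (elim oddE)
  hence PN: "P = 2 * N + 1" by (simp add: P_N_def)
  let ?t = "hauptmodul :: 'a fps" and ?B = "central_binomial_fps :: 'a fps"
  let ?H = "hypergeometric_fps :: 'a fps" and ?f = "1 - 1728 * fps_X :: 'a fps"
  define i where "i = inverse (1 - fps_const c * fps_X)"
  have "?f \<in> integral_fps"
    by (intro integral_fps_diff integral_fps_mult integral_fps_X) simp_all
  moreover have "i \<in> integral_fps" "?B \<in> integral_fps" "?H \<in> integral_fps"
    using c(1) by (auto simp: integral_fps_def fps_geometric_nth power_closed central_binomial_fps_def i_def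
          hypergeometric_fps_def hypergeometric_coeff_closed intro!: mult_closed)
  ultimately have int: "i \<in> integral_fps" "?B \<in> integral_fps" "?H \<in> integral_fps" "?f \<in> integral_fps"
    by blast+
  have kernel: "F4_kernel c \<in> integral_fps"
    unfolding F4_kernel_def i_def[symmetric] using int by (intro integral_fps_mult)
  have "?a = fps_nth ((F4_kernel c oo ?t) * fps_theta ?t) P"
    unfolding F4_eq_fps F4_kernel_compose P_N_def(1)[symmetric] by simp
  hence a: "?a - fps_nth (F4_kernel c) (P - 1) \<in> ideal_p"
    using change_of_variables[OF kernel hauptmodul_integral, of l] by (simp add: P_N_def)
  have "fps_nth (F4_kernel c) (P - 1) \<in> S" using kernel by (rule integral_fps_nth)
  from add_closed[OF ideal_p_subset[OF a] this] show "?a \<in> S" by simp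
  show "?b \<in> S"
    using c by (intro mult_closed power_closed diff_closed sum_closed hypergeometric_coeff_closed) auto

  \<comment> \<open>Truncating at \<open>N\<close> instead of \<open>P - 1\<close> keeps the degree
    of \<open>Q\<close> within \<open>2 N = P - 1\<close>, as
    \<open>fps_of_poly_geometric_nth\<close> requires.\<close>
  define HN where "HN = (\<Sum>m\<le>N. Polynomial.monom (hypergeometric_coeff m :: 'a) m)"
  have HN_coeff: "Polynomial.coeff HN m = (if m \<le> N then hypergeometric_coeff m else 0)" for m
    by (simp add: HN_def Polynomial.coeff_sum)
  have HN_deg: "Polynomial.degree HN \<le> N"
    by (rule degree_le) (simp add: HN_coeff)
  define Q where "Q = HN * [:1, -1728:] ^ N"
  have "Polynomial.degree Q \<le> N + 1 * N"
    unfolding Q_def by (rule order.trans[OF degree_mult_le add_mono[OF HN_deg order.trans[OF degree_power_le]]]) simp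
  hence Q_deg: "Polynomial.degree Q \<le> P - 1" by (simp add: PN)
  have f_poly: "?f = fps_of_poly [:1, -1728:]"
    by (simp add: fps_of_poly_pCons numeral_fps_const mult.commute flip: fps_const_neg)
  have "fps_of_poly HN \<in> integral_fps"
    by (simp add: integral_fps_def HN_coeff hypergeometric_coeff_closed)
  \<comment> \<open>In each summand the first factor has its coefficients up to \<open>P - 1\<close>
    in \<open>ideal_p\<close>.\<close>
  have eq: "F4_kernel c - fps_of_poly Q * i =
      (?H - fps_of_poly HN) * (?B * i) + (?B - ?f ^ N) * (fps_of_poly HN * i)"
    unfolding Q_def f_poly by (simp add: F4_kernel_def i_def fps_of_poly_mult fps_of_poly_power algebra_simps)
  have 1: "fps_nth ((?H - fps_of_poly HN) * (?B * i)) (P - 1) \<in> ideal_p"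
  proof (rule ideal_p_fps_mult)
    fix m assume "m \<le> P - 1"
    thus "fps_nth (?H - fps_of_poly HN) m \<in> ideal_p"
      using hypergeometric_coeff_ideal[of l m] PN
      by (auto simp: HN_coeff hypergeometric_fps_def P_N_def)
  qed (intro integral_fps_mult int)
  have 2: "fps_nth ((?B - ?f ^ N) * (fps_of_poly HN * i)) (P - 1) \<in> ideal_p"
  proof (rule ideal_p_fps_mult)
    fix m assume "m \<le> P - 1"
    thus "fps_nth (?B - ?f ^ N) m \<in> ideal_p"
      using coeff_eq_central_binomial[of m l] PN by (simp add: P_N_def)
  qed (intro integral_fps_mult int \<open>fps_of_poly HN \<in> integral_fps\<close>)
  have "fps_nth (F4_kernel c) (P - 1) - fps_nth (fps_of_poly Q * i) (P - 1) \<in> ideal_p"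
    using ideal_p_add[OF 1 2] unfolding fps_sub_nth[symmetric] fps_add_nth[symmetric] eq .
  from ideal_p_add[OF a this] have "?a - fps_nth (fps_of_poly Q * i) (P - 1) \<in> ideal_p" by simp
  also have "fps_nth (fps_of_poly Q * i) (P - 1) =
      (c * (c - 1728)) ^ N * (\<Sum>m\<le>N. hypergeometric_coeff m * inverse c ^ m)"
  proof -
    have "fps_nth (fps_of_poly Q * i) (P - 1) = c ^ (P - 1) * poly Q (inverse c)"
      unfolding i_def using Q_deg c(3) by (rule fps_of_poly_geometric_nth)
    also have "poly Q (inverse c) = poly HN (inverse c) * (1 - 1728 * inverse c) ^ N"
      by (simp add: Q_def poly_power mult.commute)
    also have "poly HN (inverse c) = (\<Sum>m\<le>N. hypergeometric_coeff m * inverse c ^ m)"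
      by (simp add: HN_def poly_sum poly_monom)
    also have "c ^ (P - 1) = (c * c) ^ N" by (simp add: PN power_mult power2_eq_square)
    also have "(c * c) ^ N * ((\<Sum>m\<le>N. hypergeometric_coeff m * inverse c ^ m) * (1 - 1728 * inverse c) ^ N) =
        (c * c * (1 - 1728 * inverse c)) ^ N * (\<Sum>m\<le>N. hypergeometric_coeff m * inverse c ^ m)"
      by (simp only: power_mult_distrib mult_ac)
    also have "c * c * (1 - 1728 * inverse c) = c * (c - 1728)"
    proof -
      have "c * c * (1 - 1728 * inverse c) = c * (c - 1728 * (c * inverse c))"
        by Groebner_Basis.algebra
      thus ?thesis using c(3) by simp
    qed
    finally show ?thesis .
  qed
  finally have 1: "?a - (c * (c - 1728)) ^ N * (\<Sum>m\<le>N. hypergeometric_coeff m * inverse c ^ m) \<in> ideal_p" .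
  \<comment> \<open>The sum to be reached runs up to \<open>P - 1\<close>; its additional terms,
    with \<open>N < m\<close>, lie in \<open>ideal_p\<close>.\<close>
  have 2: "(\<Sum>m = 0..P - 1. hypergeometric_coeff m * inverse c ^ m) =
     (\<Sum>m\<le>N. hypergeometric_coeff m * inverse c ^ m) + (\<Sum>m\<in>{N<..<P}. hypergeometric_coeff m * inverse c ^ m)"
  proof -
    have "{0..P - 1} = {..N} \<union> {N<..<P}" by (auto simp: PN)
    thus ?thesis by (simp only:) (rule sum.union_disjoint; auto)
  qed
  have 3: "(\<Sum>m\<in>{N<..<P}. hypergeometric_coeff m * inverse c ^ m) * (c * (c - 1728)) ^ N \<in> ideal_p"
    using c hypergeometric_coeff_ideal[of l] unfolding P_N_def
    by (intro ideal_p_mult ideal_p_sum power_closed mult_closed diff_closed) auto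
  show "?a - ?b \<in> ideal_p"
    using ideal_p_diff[OF 1 3] unfolding P_N_def(1)[symmetric] P_N_def(2)[symmetric] 2 distrib_left
    by (simp only: diff_diff_eq mult.commute[of "(c * (c - 1728)) ^ N"])
qed

end

section \<open>Integral closures\<close>

locale integral_closure = comm_ring_hom hom
  for hom :: "'r::comm_ring_1 \<Rightarrow> 'k::field"
begin

definition integral_elems :: "'k set" where
  "integral_elems = {z. \<exists>P. Polynomial.lead_coeff P = 1 \<and> poly (map_poly hom P) z = 0}"

text \<open>\<open>z\<close> is an eigenvalue of a matrix with entries from the base ring, and the
  characteristic polynomial of that matrix is monic over this ring.\<close>

lemma eigenvalue_integral:
  fixes v :: "nat \<Rightarrow> 'k"
  assumes ev: "\<And>i. i < n \<Longrightarrow> z * v i = (\<Sum>j<n. hom (A i j) * v j)"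
    and nz: "i < n" "v i \<noteq> 0"
  shows "z \<in> integral_elems"
proof -
  define M where "M = Matrix.mat n n (\<lambda>(i, j). A i j)"
  have M: "M \<in> carrier_mat n n" by (simp add: M_def)
  hence MK: "map_mat hom M \<in> carrier_mat n n" by simp
  have "eigenvector (map_mat hom M) (Matrix.vec n v) z"
    unfolding eigenvector_def
  proof (intro conjI)
    show "Matrix.vec n v \<in> carrier_vec (dim_row (map_mat hom M))" by (simp add: M_def)
    show "Matrix.vec n v \<noteq> 0\<^sub>v (dim_row (map_mat hom M))"
    proof
      assume "Matrix.vec n v = 0\<^sub>v (dim_row (map_mat hom M))"
      hence "vec_index (Matrix.vec n v) i = vec_index (0\<^sub>v n) i" by (simp add: M_def)
      thus False using nz by simp
    qed
    show "map_mat hom M *\<^sub>v Matrix.vec n v = z \<cdot>\<^sub>v Matrix.vec n v"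
      by (rule eq_vecI) (auto simp: M_def scalar_prod_def ev atLeast0LessThan)
  qed
  hence "poly (char_poly (map_mat hom M)) z = 0"
    unfolding eigenvalue_root_char_poly[OF MK, symmetric] eigenvalue_def by blast
  hence "poly (map_poly hom (char_poly M)) z = 0"
    unfolding char_poly_hom[OF M] .
  moreover have "Polynomial.lead_coeff (char_poly M) = 1"
    using degree_monic_char_poly[OF M] by simp
  ultimately show ?thesis unfolding integral_elems_def by blast
qed

section \<open>Finitely generated modules; differences and products of integral elements\<close>

definition module_span :: "'k set \<Rightarrow> 'k set" where
  "module_span B = range (\<lambda>r. \<Sum>b\<in>B. hom (r b) * b)"

lemma module_span_0: "0 \<in> module_span B"
  unfolding module_span_def by (rule range_eqI[of _ _ "\<lambda>_. 0"]) simp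

lemma module_span_base:
  assumes "finite B" "b \<in> B"
  shows "b \<in> module_span B"
proof -
  have "(\<Sum>x\<in>B. hom (if x = b then 1 else 0) * x) = (\<Sum>x\<in>{b}. hom 1 * x)"
    using assms by (intro sum.mono_neutral_cong_right) auto
  thus ?thesis unfolding module_span_def by (intro range_eqI[of _ _ "\<lambda>x. if x = b then 1 else 0"]) simp
qed

lemma module_span_add: "x \<in> module_span B \<Longrightarrow> y \<in> module_span B \<Longrightarrow> x + y \<in> module_span B"
  unfolding module_span_def
proof (elim rangeE)
  fix r s assume "x = (\<Sum>b\<in>B. hom (r b) * b)" "y = (\<Sum>b\<in>B. hom (s b) * b)"
  hence "x + y = (\<Sum>b\<in>B. hom (r b + s b) * b)"
    by (simp add: hom_add distrib_right sum.distrib)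
  thus "x + y \<in> range (\<lambda>r. \<Sum>b\<in>B. hom (r b) * b)" by (intro range_eqI[of _ _ "\<lambda>b. r b + s b"])
qed

lemma module_span_scale: "x \<in> module_span B \<Longrightarrow> hom a * x \<in> module_span B"
  unfolding module_span_def
proof (elim rangeE)
  fix r assume "x = (\<Sum>b\<in>B. hom (r b) * b)"
  hence "hom a * x = (\<Sum>b\<in>B. hom (a * r b) * b)"
    by (simp add: hom_mult sum_distrib_left mult.assoc)
  thus "hom a * x \<in> range (\<lambda>r. \<Sum>b\<in>B. hom (r b) * b)" by (intro range_eqI[of _ _ "\<lambda>b. a * r b"])
qed

lemma module_span_uminus: "x \<in> module_span B \<Longrightarrow> - x \<in> module_span B"
  using module_span_scale[of x B "-1"] by (simp add: hom_uminus)

lemma module_span_sum: "(\<And>i. i \<in> I \<Longrightarrow> f i \<in> module_span B) \<Longrightarrow> sum f I \<in> module_span B"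
  by (induction I rule: infinite_finite_induct) (simp_all add: module_span_0 module_span_add)

lemma module_span_stable:
  assumes "\<And>b. b \<in> B \<Longrightarrow> z * b \<in> module_span B" "x \<in> module_span B"
  shows "z * x \<in> module_span B"
proof -
  obtain r where x: "x = (\<Sum>b\<in>B. hom (r b) * b)" using assms(2) by (auto simp: module_span_def)
  have "z * x = (\<Sum>b\<in>B. hom (r b) * (z * b))"
    unfolding x sum_distrib_left by (intro sum.cong refl) (simp only: mult_ac)
  also have "\<dots> \<in> module_span B" using assms(1) by (intro module_span_sum module_span_scale)
  finally show ?thesis .
qed

text \<open>The determinant trick: multiplication by \<open>z\<close> on the generators is given by
  a matrix over the base ring, and a nonzero generator makes the vector of generators an
  eigenvector.\<close>

lemma stable_module_integral:
  assumes B: "finite B" "b \<in> B" "b \<noteq> 0" and stable: "\<And>b. b \<in> B \<Longrightarrow> z * b \<in> module_span B"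
  shows "z \<in> integral_elems"
proof -
  obtain v where v: "bij_betw v {..<card B} B"
    using ex_bij_betw_nat_finite[OF B(1)] by (auto simp: atLeast0LessThan)
  have "\<exists>r. z * b = (\<Sum>x\<in>B. hom (r x) * x)" if "b \<in> B" for b
    using stable[OF that] by (auto simp: module_span_def)
  then obtain r where r: "\<And>b. b \<in> B \<Longrightarrow> z * b = (\<Sum>x\<in>B. hom (r b x) * x)" by metis
  obtain i where i: "i < card B" "v i = b" using B(2) bij_betw_imp_surj_on[OF v] by (metis imageE lessThan_iff)
  show ?thesis
  proof (rule eigenvalue_integral[where v = v and A = "\<lambda>i j. r (v i) (v j)"])
    fix i assume "i < card B"
    hence "v i \<in> B" using v by (auto simp: bij_betw_def)
    hence "z * v i = (\<Sum>x\<in>B. hom (r (v i) x) * x)" by (rule r)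
    also have "\<dots> = (\<Sum>j<card B. hom (r (v i) (v j)) * v j)"
      by (rule sum.reindex_bij_betw[OF v, symmetric])
    finally show "z * v i = \<dots>" .
  qed (use i B in auto)
qed

lemma integral_power_relation:
  assumes "x \<in> integral_elems"
  obtains n a where "n > 0" "x ^ n = (\<Sum>i<n. hom (a i) * x ^ i)"
proof -
  obtain P where P: "Polynomial.lead_coeff P = 1" "poly (map_poly hom P) x = 0"
    using assms by (auto simp: integral_elems_def)
  define n where "n = Polynomial.degree P"
  have cn: "Polynomial.coeff (map_poly hom P) n = 1"
    using P(1) by (simp add: coeff_map_poly n_def)
  hence deg: "Polynomial.degree (map_poly hom P) = n"
    using le_degree[of "map_poly hom P" n] degree_map_poly_le[of hom P] by (simp add: n_def)
  have sum: "(\<Sum>i\<le>n. hom (Polynomial.coeff P i) * x ^ i) = 0"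
    using P(2) unfolding poly_altdef deg by (simp add: coeff_map_poly)
  \<comment> \<open>In degree 0 the relation would read \<open>1 = 0\<close>.\<close>
  have "n > 0"
  proof (rule Nat.gr0I)
    assume "n = 0"
    with sum P(1) show False by (simp add: n_def)
  qed
  have "(\<Sum>i<n. hom (Polynomial.coeff P i) * x ^ i) + hom (Polynomial.coeff P n) * x ^ n = 0"
    using sum unfolding lessThan_Suc_atMost[symmetric] sum.lessThan_Suc .
  hence "x ^ n + (\<Sum>i<n. hom (Polynomial.coeff P i) * x ^ i) = 0"
    using P(1) by (simp add: n_def add.commute)
  hence "x ^ n = - (\<Sum>i<n. hom (Polynomial.coeff P i) * x ^ i)"
    by (simp only: eq_neg_iff_add_eq_0)
  also have "\<dots> = (\<Sum>i<n. hom (- Polynomial.coeff P i) * x ^ i)"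
    by (simp only: hom_uminus mult_minus_left sum_negf)
  finally show thesis
    by (intro that[OF \<open>n > 0\<close>, where a = "\<lambda>i. - Polynomial.coeff P i"])
qed

text \<open>The products \<open>x ^ i * y ^ j\<close> below the degrees of the two relations span a
  module stable under \<open>x\<close> and \<open>y\<close>, hence under \<open>x - y\<close> and
  \<open>x * y\<close>.\<close>

lemma integral_diff_mult:
  assumes "x \<in> integral_elems" "y \<in> integral_elems"
  shows "x - y \<in> integral_elems" and "x * y \<in> integral_elems"
proof -
  obtain n a where n: "n > 0" "x ^ n = (\<Sum>i<n. hom (a i) * x ^ i)"
    using integral_power_relation[OF assms(1)] .
  obtain m c where m: "m > 0" "y ^ m = (\<Sum>i<m. hom (c i) * y ^ i)"
    using integral_power_relation[OF assms(2)] .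
  define B where "B = (\<lambda>(i, j). x ^ i * y ^ j) ` ({..<n} \<times> {..<m})"
  have B: "finite B" "1 \<in> B"
    using n(1) m(1) by (auto simp: B_def intro!: image_eqI[of _ _ "(0, 0)"])
  have base: "x ^ i * y ^ j \<in> module_span B" if "i < n" "j < m" for i j
    using that B(1) by (intro module_span_base) (auto simp: B_def)
  have x: "x * b \<in> module_span B" if "b \<in> B" for b
  proof -
    obtain i j where ij: "i < n" "j < m" "b = x ^ i * y ^ j" using \<open>b \<in> B\<close> by (auto simp: B_def)
    show ?thesis
    proof (cases "Suc i < n")
      case True
      thus ?thesis using base[of "Suc i" j] ij by (simp add: mult.assoc)
    next
      case False
      hence "Suc i = n" using ij by simp
      hence "x * b = x ^ n * y ^ j" using ij by (auto simp: mult.assoc)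
      also have "\<dots> = (\<Sum>i<n. hom (a i) * (x ^ i * y ^ j))"
        unfolding n(2) by (simp add: sum_distrib_right mult.assoc)
      also have "\<dots> \<in> module_span B" using ij by (intro module_span_sum module_span_scale base) auto
      finally show ?thesis .
    qed
  qed
  have y: "y * b \<in> module_span B" if "b \<in> B" for b
  proof -
    obtain i j where ij: "i < n" "j < m" "b = x ^ i * y ^ j" using \<open>b \<in> B\<close> by (auto simp: B_def)
    show ?thesis
    proof (cases "Suc j < m")
      case True
      thus ?thesis using base[of i "Suc j"] ij by (simp add: mult.left_commute)
    next
      case False
      hence "Suc j = m" using ij by simp
      hence "y * b = y ^ m * x ^ i" using ij by (auto simp: mult_ac)
      also have "\<dots> = (\<Sum>j<m. hom (c j) * (x ^ i * y ^ j))"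
        unfolding m(2) sum_distrib_right by (intro sum.cong refl) (simp only: mult_ac)
      also have "\<dots> \<in> module_span B" using ij by (intro module_span_sum module_span_scale base) auto
      finally show ?thesis .
    qed
  qed
  show "x - y \<in> integral_elems"
  proof (rule stable_module_integral[OF B])
    fix b assume "b \<in> B"
    hence "x * b + - (y * b) \<in> module_span B" by (intro module_span_add module_span_uminus x y)
    thus "(x - y) * b \<in> module_span B" by (simp add: algebra_simps)
  qed simp
  show "x * y \<in> integral_elems"
  proof (rule stable_module_integral[OF B])
    fix b assume "b \<in> B"
    hence "x * (y * b) \<in> module_span B" by (intro module_span_stable[OF x] y)
    thus "(x * y) * b \<in> module_span B" by (simp only: mult.assoc)
  qed simp
qed

lemma hom_integral: "hom a \<in> integral_elems"
proof -
  have "poly (map_poly hom [:- a, 1:]) (hom a) = 0"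
    by (simp add: map_poly_pCons hom_uminus)
  thus ?thesis unfolding integral_elems_def by (intro CollectI exI[of _ "[:- a, 1:]"]) simp
qed

end

section \<open>The integral closure of the p-adic integers\<close>

text \<open>The residue modulo each \<open>p ^ n\<close> is invertible, and uniqueness of these
  inverses makes them a compatible system.\<close>

lemma padic_int_unit:
  assumes "\<not> of_nat CARD('p) dvd (u :: 'p::prime_card padic_int)"
  obtains v where "u * v = 1"
proof -
  let ?p = "int CARD('p)"
  have p: "Factorial_Ring.prime ?p" by (rule prime_card_int)
  have cop: "coprime (padic_residue u n) (?p ^ n)" for n
  proof (cases n)
    case (Suc m)
    have "padic_residue u n mod ?p ^ 1 = padic_residue u 1" by (rule padic_residue_cong) (simp add: Suc)
    hence "\<not> ?p dvd padic_residue u n"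
      using assms by (auto simp: padic_p_dvd_iff dvd_eq_mod_eq_0)
    hence "coprime ?p (padic_residue u n)" using p by (simp add: prime_imp_coprime)
    thus ?thesis by (simp add: coprime_commute)
  qed simp
  have "\<exists>x. [padic_residue u n * x = 1] (mod ?p ^ n)" for n
    using cong_solve_coprime_int[OF cop[of n]] by blast
  then obtain g where g: "\<And>n. [padic_residue u n * g n = 1] (mod ?p ^ n)" by metis
  define f where "f = (\<lambda>n. g n mod ?p ^ n)"
  have f: "f n \<in> {0..<?p ^ n} \<and> f (Suc n) mod ?p ^ n = f n" for n
    unfolding f_def
  proof (rule padic_compatible)
    have "[padic_residue u (Suc n) * g (Suc n) = 1] (mod ?p ^ n)"
      by (rule cong_dvd_modulus[OF g]) simp
    moreover have "[padic_residue u (Suc n) = padic_residue u n] (mod ?p ^ n)"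
      by (simp add: cong_def padic_residue_mod_Suc)
    ultimately have "[padic_residue u n * g (Suc n) = 1] (mod ?p ^ n)"
      using cong_trans[OF cong_scalar_right[OF cong_sym]] by blast
    hence "[padic_residue u n * g (Suc n) = padic_residue u n * g n] (mod ?p ^ n)"
      using g[of n] cong_sym cong_trans by blast
    hence "[g (Suc n) = g n] (mod ?p ^ n)"
      using cop[of n] by (simp add: cong_mult_lcancel)
    thus "g (Suc n) mod ?p ^ n = g n mod ?p ^ n" by (simp only: cong_def)
  qed
  define v where "v = (Abs_padic_int f :: 'p padic_int)"
  have v: "padic_residue v = f"
    unfolding v_def using f by (intro Abs_padic_int_inverse) auto
  have "u * v = 1"
  proof (rule padic_int_eqI)
    fix n
    have "(padic_residue u n * g n) mod ?p ^ n = 1 mod ?p ^ n" using g[of n] by (simp only: cong_def)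
    thus "padic_residue (u * v) n = padic_residue (1 :: 'p padic_int) n"
      by (simp add: times_padic_int.rep_eq one_padic_int.rep_eq v f_def mod_simps)
  qed
  thus thesis using that by blast
qed

definition padic_int_to_ac :: "'p::prime_card padic_int \<Rightarrow> 'p padic_ac" where
  "padic_int_to_ac a = to_ac (Fract a 1)"

interpretation padic_int_to_ac: integral_closure "padic_int_to_ac :: 'p::prime_card padic_int \<Rightarrow> 'p padic_ac"
proof
  fix x y :: "'p padic_int"
  show "padic_int_to_ac (x + y) = padic_int_to_ac x + padic_int_to_ac y"
    by (simp add: padic_int_to_ac_def flip: to_ac_add)
  show "padic_int_to_ac (x * y) = padic_int_to_ac x * padic_int_to_ac y"
    by (simp add: padic_int_to_ac_def flip: to_ac_mult)
qed (simp_all add: padic_int_to_ac_def fract_collapse)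

lemma padic_ac_int_eq: "padic_ac_int = padic_int_to_ac.integral_elems"
  unfolding padic_ac_int_def padic_int_to_ac.integral_elems_def padic_int_to_ac_def ..

lemma padic_ac_int_inverse_of_nat:
  assumes "\<not> CARD('p) dvd n"
  shows "inverse (of_nat n) \<in> (padic_ac_int :: 'p::prime_card padic_ac set)"
proof -
  have "\<not> of_nat CARD('p) dvd (of_nat n :: 'p padic_int)"
    using assms by (simp add: padic_p_dvd_iff padic_residue_of_nat dvd_eq_mod_eq_0 flip: of_nat_mod)
  then obtain v where "of_nat n * v = (1 :: 'p padic_int)" using padic_int_unit by blast
  hence "padic_int_to_ac (of_nat n * v) = 1" by simp
  hence "of_nat n * padic_int_to_ac v = 1"
    unfolding padic_int_to_ac.hom_mult by (simp add: padic_int_to_ac_def flip: of_nat_fract)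
  hence "inverse (of_nat n) = padic_int_to_ac v" by (rule inverse_unique)
  thus ?thesis by (simp add: padic_ac_int_eq padic_int_to_ac.hom_integral)
qed

text \<open>A reducible \<open>Q\<close> passes the root on to a factor of smaller degree; an
  irreducible one is the minimal polynomial up to a constant, by uniqueness.\<close>

lemma ac_min_poly_dvd:
  fixes x :: "'a::field alg_closure"
  assumes "Q \<noteq> 0" "poly (map_poly to_ac Q) x = 0"
  shows "ac_min_poly x dvd Q"
proof -
  interpret h: field_hom "to_ac :: 'a \<Rightarrow> _" by standard auto
  interpret hp: map_poly_comm_ring_hom "to_ac :: 'a \<Rightarrow> _" ..
  show ?thesis using assms
  proof (induction "Polynomial.degree Q" arbitrary: Q rule: less_induct)
    case (less Q)
    define c where "c = inverse (Polynomial.lead_coeff Q)"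
    have c: "c \<noteq> 0" using less.prems(1) by (simp add: c_def)
    have not_unit: "\<not> R dvd 1" if "poly (map_poly to_ac R) x = 0" for R :: "'a poly"
    proof
      assume "R dvd 1"
      then obtain S where "1 = R * S" by blast
      hence "poly (map_poly to_ac 1) x = poly (map_poly to_ac (R * S)) x" by simp
      hence "poly (map_poly to_ac R) x * poly (map_poly to_ac S) x = 1"
        unfolding hp.hom_mult hp.hom_one poly_mult poly_1 by (rule sym)
      thus False using that by simp
    qed
    show ?case
    proof (cases "Factorial_Ring.irreducible Q")
      case True
      have "ac_min_poly x = Polynomial.smult c Q"
      proof (rule ac_min_poly_eqI)
        show "Polynomial.lead_coeff (Polynomial.smult c Q) = 1"
          using less.prems(1) by (simp add: c_def)
        show "Factorial_Ring.irreducible (Polynomial.smult c Q)"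
          using True c irreducible_mult_unit_left[of "[:c:]" Q] by simp
        show "poly (map_poly to_ac (Polynomial.smult c Q)) x = 0"
          using less.prems(2) by (simp add: h.map_poly_hom_smult)
      qed
      thus ?thesis using c by (simp add: smult_dvd_iff)
    next
      case False
      then obtain a b where ab: "Q = a * b" "\<not> a dvd 1" "\<not> b dvd 1"
        using less.prems not_unit[OF less.prems(2)] by (auto simp: Factorial_Ring.irreducible_def)
      have nz: "a \<noteq> 0" "b \<noteq> 0" using ab(1) less.prems(1) by auto
      have deg: "Polynomial.degree a > 0" "Polynomial.degree b > 0"
        using ab nz by (auto simp: is_unit_iff_degree)
      have "Polynomial.degree Q = Polynomial.degree a + Polynomial.degree b"
        unfolding ab(1) using nz by (rule Polynomial.degree_mult_eq)
      hence "Polynomial.degree a < Polynomial.degree Q" "Polynomial.degree b < Polynomial.degree Q" using deg by auto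
      moreover have "poly (map_poly to_ac a) x = 0 \<or> poly (map_poly to_ac b) x = 0"
        using less.prems(2) unfolding ab(1) by (simp add: hp.hom_mult)
      ultimately have "ac_min_poly x dvd a \<or> ac_min_poly x dvd b"
        using less.hyps nz by blast
      thus ?thesis unfolding ab(1) by (auto intro: dvd_mult dvd_mult2)
    qed
  qed
qed

text \<open>All conjugates of \<open>c\<close> are integral, and their product is, up to sign, the constant
  coefficient of the minimal polynomial, which is a unit of the p-adic integers.\<close>

lemma padic_ac_int_inverse:
  fixes c :: "'p::prime_card padic_ac"
  assumes "c \<in> padic_ac_int" "padic_ac_val c = 0"
  shows "c \<noteq> 0" and "inverse c \<in> padic_ac_int"
proof -
  interpret h: field_hom "to_ac :: 'p padic \<Rightarrow> _" by standard auto
  interpret hp: map_poly_comm_ring_hom "to_ac :: 'p padic \<Rightarrow> _" ..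
  define M where "M = ac_min_poly c"
  define K where "K = map_poly to_ac M"
  note M = ac_min_poly_props(1,2,3)[of c, folded M_def]
  define a0 where "a0 = Polynomial.coeff M 0"

  obtain P :: "'p padic_int poly" where P: "Polynomial.lead_coeff P = 1"
      "poly (map_poly (\<lambda>a. to_ac (Fract a 1)) P) c = 0"
    using assms(1) by (auto simp: padic_ac_int_def)
  define PF where "PF = map_poly (\<lambda>a. Fract a 1) P"
  have PF: "map_poly to_ac PF = map_poly (\<lambda>a. to_ac (Fract a 1)) P"
    unfolding PF_def by (subst map_poly_map_poly) (simp_all add: o_def)
  have "Polynomial.coeff PF (Polynomial.degree P) = 1"
    using P(1) by (simp add: PF_def coeff_map_poly fract_collapse)
  hence "PF \<noteq> 0" by auto
  \<comment> \<open>The minimal polynomial divides the integral equation of \<open>c\<close>, so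
    every conjugate satisfies the same monic equation.\<close>
  hence "M dvd PF" unfolding M_def using P(2) by (intro ac_min_poly_dvd) (simp_all add: PF)
  hence "K dvd map_poly to_ac PF" unfolding K_def by (rule hp.hom_dvd)
  hence roots: "x \<in> padic_ac_int" if "poly K x = 0" for x
    using that P(1) unfolding PF padic_ac_int_def by (auto simp: dvd_def)

  have "Polynomial.lead_coeff K = 1" unfolding K_def using M(1) by (simp add: h.hom_lead_coeff)
  moreover have "K \<noteq> 0" using calculation by auto
  ultimately obtain A where A: "K = (\<Prod>x\<in>#A. [:-x, 1:])"
    using alg_closed_imp_factorization[of K] by auto
  have root_A: "poly K x = 0 \<longleftrightarrow> x \<in># A" for x
    unfolding A by (auto simp: poly_prod_mset prod_mset_zero_iff image_iff)
  have "c \<in># A" using M(3) root_A[of c] by (simp add: K_def)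
  then obtain A' where A': "A = add_mset c A'" by (meson mset_add)

  have closed: "- x \<in> padic_ac_int" "x * y \<in> padic_ac_int"
    if "x \<in> padic_ac_int" "y \<in> padic_ac_int" for x y :: "'p padic_ac"
    using that padic_int_to_ac.integral_diff_mult[of "0 :: 'p padic_ac" x] padic_int_to_ac.integral_diff_mult[of x y]
      padic_int_to_ac.hom_integral[of 0] unfolding padic_ac_int_eq by auto
  have one: "1 \<in> (padic_ac_int :: 'p padic_ac set)"
    using padic_int_to_ac.hom_integral[of 1] unfolding padic_ac_int_eq by simp
  \<comment> \<open>The sign is chosen such that \<open>c * d\<close> is \<open>poly K 0\<close>,
    the product of \<open>- x\<close> over all roots of \<open>K\<close> with multiplicity.\<close>
  define d where "d = - (\<Prod>x\<in>#A'. - x)"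
  have "(\<Prod>x\<in>#B. - x) \<in> padic_ac_int" if "set_mset B \<subseteq> set_mset A" for B
    using that
  proof (induction B)
    case (add x B)
    hence "x \<in> padic_ac_int" by (intro roots) (simp add: root_A)
    hence "- x * (\<Prod>x\<in>#B. - x) \<in> padic_ac_int" using add by (intro closed(2) closed(1)[OF _ one]) simp_all
    thus ?case by simp
  qed (simp add: one)
  from this[of A'] have "(\<Prod>x\<in>#A'. - x) \<in> padic_ac_int" by (simp add: A' subset_insertI)
  hence d: "d \<in> padic_ac_int" unfolding d_def by (rule closed(1)[OF _ one])
  have "to_ac a0 = poly K 0" by (simp add: a0_def K_def poly_0_coeff_0 coeff_map_poly)
  also have "\<dots> = c * d"
    unfolding A A' by (simp add: poly_prod_mset d_def)
  finally have cd: "c * d = to_ac a0" by simp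

  have deg: "Polynomial.degree M > 0"
  proof (rule Nat.gr0I)
    assume "Polynomial.degree M = 0"
    hence "M dvd 1" using M(1) by (auto simp: is_unit_iff_degree)
    thus False using M(2) by (simp add: Factorial_Ring.irreducible_def)
  qed
  have val: "padic_val a0 / ereal (real (Polynomial.degree M)) = 0"
    using assms(2) by (simp add: padic_ac_val_def M_def a0_def)
  \<comment> \<open>Otherwise the valuation would be infinite, and infinity divided by the positive
    degree is not 0.\<close>
  have "a0 \<noteq> 0"
  proof
    assume "a0 = 0"
    thus False using val deg by (simp add: padic_val_def)
  qed
  then obtain k u w where kuw: "\<not> of_nat CARD('p) dvd u" "\<not> of_nat CARD('p) dvd w"
      "a0 = of_nat CARD('p) powi k * Fract u w"
    using padic_decompose by blast
  have "padic_val a0 = ereal (of_int k)"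
    unfolding kuw(3) using kuw(1,2) by (rule padic_val_eqI)
  \<comment> \<open>Now \<open>a0\<close> is a quotient of p-adic units, and \<open>w * u'\<close>
    with \<open>u * u' = 1\<close> is its inverse.\<close>
  hence "k = 0" using val deg by simp
  hence a0: "a0 = Fract u w" using kuw by simp
  obtain u' where u': "u * u' = 1" using padic_int_unit[OF kuw(1)] .
  have "w \<noteq> 0" using kuw(2) by auto
  have "a0 * Fract (w * u') 1 = Fract (u * (w * u')) (w * 1)"
    unfolding a0 by (rule mult_fract)
  also have "u * (w * u') = (u * u') * w" by (simp only: mult_ac)
  also have "Fract (u * u' * w) (w * 1) = 1"
    using \<open>w \<noteq> 0\<close> unfolding u' One_fract_def by (subst eq_fract) simp_all
  finally have "a0 * Fract (w * u') 1 = 1" .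
  hence "to_ac (a0 * Fract (w * u') 1) = to_ac 1" by (rule arg_cong)
  hence "c * (d * padic_int_to_ac (w * u')) = 1"
    unfolding to_ac_mult to_ac_1 padic_int_to_ac_def mult.assoc[symmetric] cd .
  moreover have "padic_int_to_ac (w * u') \<in> padic_ac_int"
    unfolding padic_ac_int_eq by (rule padic_int_to_ac.hom_integral)
  ultimately show "c \<noteq> 0" "inverse c \<in> padic_ac_int"
    using inverse_unique[of c "d * padic_int_to_ac (w * u')"] closed(2)[OF d] by auto
qed

theorem theorem5p2:
  fixes p l :: nat and c :: "'p::prime_card padic_ac"
  assumes "p = CARD('p)" and "\<not> p dvd 6"
    and "c \<in> padic_ac_int" and "padic_ac_val c = 0"
    and "l \<ge> 1"
  shows "padic_ac_cong (of_nat p)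
           (fls_nth (F4 c) (int (p ^ l)))
           ((c * (c - 1728)) ^ ((p ^ l - 1) div 2) *
            (\<Sum>m = 0..p ^ l - 1. fact (6 * m) / (fact m ^ 3 * fact (3 * m)) * c powi (- int m)))"
proof -
  interpret p_integral_subring "padic_ac_int :: 'p padic_ac set" p
  proof
    show "Factorial_Ring.prime p" unfolding assms(1) by (rule prime_card)
    show "inverse (of_nat n) \<in> (padic_ac_int :: 'p padic_ac set)" if "\<not> p dvd n" for n
      using that unfolding assms(1) by (rule padic_ac_int_inverse_of_nat)
    show "1 \<in> (padic_ac_int :: 'p padic_ac set)"
      using padic_int_to_ac.hom_integral[of 1] unfolding padic_ac_int_eq by simp
  qed (use assms(2) in \<open>auto simp: padic_ac_int_eq intro: padic_int_to_ac.integral_diff_mult\<close>)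
  have sum: "(\<Sum>m = 0..p ^ l - 1. fact (6 * m) / (fact m ^ 3 * fact (3 * m)) * c powi (- int m)) =
      (\<Sum>m = 0..p ^ l - 1. hypergeometric_coeff m * inverse c ^ m)"
    by (intro sum.cong refl) (simp add: hypergeometric_coeff_def power_int_minus power_inverse)
  show ?thesis
    unfolding padic_ac_cong_def sum
    using F4_coeff_congruence[OF assms(3) padic_ac_int_inverse(2,1)[OF assms(3,4)], of l]
    by (auto simp: ideal_p_def)
qed

end
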